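(* Let $C\subset\partial_\infty\mathbb H^3\equiv\mathbb R^2$ be a simple closed curve of class $\mathcal C^2$, and let $R=C\times(0,\infty)\subset\mathbb H^3$. Then the following integrals converge and coincide: $$\int_{\mathcal L}\big(\#(\ell\cap R)-\lambda^2(\ell,C)\big)\,d\ell=\int_{A(2,1)}\ \sum_{x,y\in L\cap C}\frac{(-1)^{\#(\overline{xy}\cap C)}}{\|y-x\|}\,dL<\infty,$$ where $dL$ is an invariant measure (suitably normalized) on the space $A(2,1)$ of lines in $\mathbb R^2$.
   Context: The Poincaré half-space model is $\mathbb H^3=\{x\in\mathbb R^3: x_3>0\}$ with metric $x_3^{-2}(dx_1^2+dx_2^2+dx_3^2)$; $\partial_\infty\mathbb H^3$ is identified with $\mathbb R^2=\{x_3=0\}$ (together with $\infty$). $\mathcal L$ is the space of unoriented geodesics of $\mathbb H^3$ and $d\ell$ its isometry-invariant measure, normalized so that the hyperbolic area of a compact surface $\Sigma$ is $\frac1\pi\int_{\mathcal L}\#(\ell\cap\Sigma)\,d\ell$. Equivalently, on the double cover of oriented geodesics, parametrized up to null sets by ordered pairs of distinct ideal endpoints $(z,w)\in\mathbb R^2\times\mathbb R^2$, $d\ell=4\,dz\,dw/\|w-z\|^4$. $\lambda^2(\ell,C)$ is $1$ if the ideal endpoints of $\ell$ lie on different components of $\partial_\infty\mathbb H^3\setminus C$, and $0$ otherwise. The sum is over ordered pairs of distinct points $x,y\in L\cap C$, $\overline{xy}$ is the closed segment joining $x$ and $y$, and $\#$ denotes cardinality ($L\cap C$ is finite and transverse for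 almost every $L$). With $d\ell$ normalized so that the hyperbolic area of a compact surface $\Sigma$ is $\frac1\pi\int_{\mathcal L}\#(\ell\cap\Sigma)\,d\ell$, the normalization of the motion-invariant measure on unoriented lines is $dL=2\,dp\,d\varphi$, where the line is $\{x: x_1\cos\varphi+x_2\sin\varphi=p\}$, $p\geq0$, $\varphi\in[0,2\pi)$. *)

theory Defs
  imports "HOL-Analysis.Analysis"
begin

text \<open>\<open>\<real>\<^sup>3\<close> is written as \<open>\<real>\<^sup>2 \<times> \<real>\<close> (whose product norm is the Euclidean one), so that \<open>x\<^sub>3 = snd x\<close>
  and the plane of ideal points is \<open>\<real>\<^sup>2 \<times> {0}\<close>.\<close>

definition half_space :: "((real^2) \<times> real) set" where
  "half_space = {x. snd x > 0}"

definition hyp_length :: "(real \<Rightarrow> (real^2) \<times> real) \<Rightarrow> real" where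
  "hyp_length g = integral {0..1} (\<lambda>t. norm (vector_derivative g (at t)) / snd (g t))"

text \<open>Competitors are \<open>C\<^sup>1\<close> on the closed interval: the speed of a \<open>valid_path\<close> need not be integrable
  near a corner, and such a path would have length \<open>0\<close> by convention.\<close>

definition hyp_dist :: "(real^2) \<times> real \<Rightarrow> (real^2) \<times> real \<Rightarrow> real" where
  "hyp_dist x y = Inf {hyp_length g | g.
     g C1_differentiable_on {0..1} \<and> path_image g \<subseteq> half_space \<and> pathstart g = x \<and> pathfinish g = y}"

text \<open>Complete geodesics are the images of distance-preserving maps of the real line;
  in hyperbolic space every geodesic is globally minimizing.\<close>

definition geodesics :: "((real^2) \<times> real) set set" where
  "geodesics = {range g | g. range g \<subseteq> half_space \<and> (\<forall>s t. hyp_dist (g s) (g t) = \<bar>s - t\<bar>)}"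

text \<open>The sphere at infinity is the one-point compactification of the plane, \<open>None\<close> being \<open>\<infinity>\<close>.\<close>

definition ideal_boundary :: "(real^2) option topology" where
  "ideal_boundary = Alexandroff_compactification euclidean"

definition ideal_endpoints :: "((real^2) \<times> real) set \<Rightarrow> (real^2) option set" where
  "ideal_endpoints l =
     {Some z | z. (z, 0) \<in> closure l} \<union> (if bounded l then {} else {None})"

definition lambda2 :: "((real^2) \<times> real) set \<Rightarrow> (real^2) set \<Rightarrow> real" where
  "lambda2 l C =
     (if \<exists>a\<in>ideal_endpoints l. \<exists>b\<in>ideal_endpoints l.
           \<exists>U\<in>connected_components_of (subtopology ideal_boundary (- Some ` C)).
           \<exists>V\<in>connected_components_of (subtopology ideal_boundary (- Some ` C)).
             a \<in> U \<and> b \<in> V \<and> U \<noteq> V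
      then 1 else 0)"

text \<open>The semicircle orthogonal to the plane at infinity with end points \<open>z \<noteq> w\<close>.\<close>

definition geodesic_joining :: "real^2 \<Rightarrow> real^2 \<Rightarrow> ((real^2) \<times> real) set" where
  "geodesic_joining z w =
     {x \<in> half_space. fst x \<in> affine hull {z, w} \<and> dist x (midpoint z w, 0) = dist z w / 2}"

text \<open>Image measure on \<open>Y\<close>, on the largest \<open>\<sigma>\<close>-algebra making \<open>f\<close> measurable.\<close>

definition image_measure :: "'a measure \<Rightarrow> 'b set \<Rightarrow> ('a \<Rightarrow> 'b) \<Rightarrow> 'b measure" where
  "image_measure M Y f = distr M (sigma Y {A. A \<subseteq> Y \<and> f -` A \<inter> space M \<in> sets M}) f"

text \<open>The factor \<open>1/2\<close> accounts for each unoriented geodesic being the image of both \<open>(z, w)\<close> and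
  \<open>(w, z)\<close>; with it, the integral of \<open>#(\<ell> \<inter> \<Sigma>)\<close> is \<open>\<pi>\<close> times the hyperbolic area of \<open>\<Sigma>\<close>.
  Vertical half-lines form a null set.\<close>

definition geodesic_measure :: "((real^2) \<times> real) set measure" where
  "geodesic_measure =
     scale_measure (1/2)
       (image_measure
          (density (lebesgue_on {(z, w). z \<noteq> w}) (\<lambda>(z, w). ennreal (4 / norm (w - z) ^ 4)))
          geodesics (\<lambda>(z, w). geodesic_joining z w))"

definition lines :: "(real^2) set set" where
  "lines = {L. affine L \<and> aff_dim L = 1}"

definition line_measure :: "(real^2) set measure" where
  "line_measure =
     scale_measure 2
       (image_measure (lebesgue_on ({0..} \<times> {0..<2*pi})) lines
          (\<lambda>(p, \<phi>). {x. x$1 * cos \<phi> + x$2 * sin \<phi> = p}))"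

text \<open>As usual for curves of class \<open>C\<^sup>2\<close> regarded as subsets of the plane, the parametrization is
  regular; periodicity makes the curve \<open>C\<^sup>2\<close> at the base point, too.\<close>

definition C2_simple_closed_curve :: "(real^2) set \<Rightarrow> bool" where
  "C2_simple_closed_curve C \<longleftrightarrow>
     (\<exists>g g' g''.
        (\<forall>t. (g has_vector_derivative g' t) (at t)) \<and>
        (\<forall>t. (g' has_vector_derivative g'' t) (at t)) \<and>
        continuous_on UNIV g'' \<and>
        (\<forall>t. g' t \<noteq> 0) \<and>
        (\<forall>t. g (t + 1) = g t) \<and>
        simple_path g \<and> path_image g = C)"

end

theory Submission
  imports Defs "HOL-Real_Asymp.Real_Asymp"
begin

text \<open>
  A geodesic meets \<open>C \<times> (0, \<infinity>)\<close> above the points where the segment \<open>[z, w]\<close> between its ideal end points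
  crosses \<open>C\<close>. For almost every line all crossings are transversal, so by the Jordan curve theorem
  \<open>\<lambda>\<^sup>2\<close> is the parity of the number \<open>N\<close> of crossings on \<open>[z, w]\<close>, and
  \<open>N - \<lambda>\<^sup>2 = 2 \<lfloor>N / 2\<rfloor> = 2 \<Sum> (-1)\<^bsup>#([x, y] \<inter> C)\<^esup>\<close>, summed over the unordered pairs of crossings \<open>x, y\<close>
  lying on \<open>[z, w]\<close>. Since \<open>dz dw = \<bar>s - t\<bar> ds dt dL\<close> for points with positions \<open>s, t\<close> on the line
  \<open>L\<close>, integrating \<open>\<bar>s - t\<bar>\<^bsup>-3\<^esup>\<close> over \<open>s < x < y < t\<close>, which gives \<open>1 / (2 (y - x))\<close>, turns the left-hand side
  into the right-hand side.

  For the convergence it suffices to integrate \<open>\<Sum> 1 / \<parallel>x - y\<parallel>\<close> over all lines. Cut the curve into \<open>n\<close> arcs of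
  length \<open>O(1/n)\<close>. As \<open>C\<close> is \<open>C\<^sup>2\<close>, the lines meeting two arcs at distance \<open>d\<close> have measure \<open>O(d / n\<^sup>2)\<close>, so
  the \<open>n\<^sup>2\<close> pairs of arcs, weighted by \<open>1 / d\<close>, contribute a bounded amount, and Fatou's lemma applies.
\<close>

text \<open>Both measures are images on the largest possible sigma-algebra, so measurability of the
  integrands is obtained indirectly: each is compared almost everywhere with a Borel function of the
  parameters, and completeness of Lebesgue measure does the rest. As \<open>geodesic_measure\<close>
  is an image of pairs of end points, it suffices to recognize semicircles as geodesics. Lines are
  described by slope m and intercept b. There the tangent lines form the image of a differentiable
  curve, hence a null set, and both sides become 1/2 times the integral of
  \<open>line_density\<close>, which is 8 \<open>gap_sum\<close> / (1 + m^2)^2 on transversal lines.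
  The equality is a matter of Tonelli, since both integrands are nonnegative almost everywhere; for
  the alternating sum this is seen only by writing it as an integral of the nonnegative
  \<open>excess\<close>. Finiteness is shown for the sum without signs. A line through two arcs at
  distance d makes an angle O(d) with the curve there, so for a given direction its offset varies by
  O(d/n) only instead of O(1/n). This gain cancels the weight 1/d.\<close>

section \<open>Geodesics of the half-space model\<close>

text \<open>The vector is the Euclidean gradient of the function \<open>calibration\<close> below,
  \<open>p\<close> and \<open>q\<close> being the positions relative to the two ideal points. Its
  squared norm is |p - q|^2 / (|p|^2 |q|^2), and |p|^2 |q|^2 - h^2 |p - q|^2 splits into a
  Cauchy-Schwarz defect plus the square of P . Q + h^2.\<close>

lemma horospherical_bound:
  fixes p q :: "'a::real_inner \<times> real"
  assumes "snd p = snd q" "0 < snd p"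
  shows "norm (p /\<^sub>R (norm p)\<^sup>2 - q /\<^sub>R (norm q)\<^sup>2) * snd p \<le> 1"
proof -
  obtain P Q h where pq: "p = (P, h)" "q = (Q, h)" and h: "h > 0"
    using assms by (metis prod.collapse)
  have np: "norm p > 0" "norm q > 0"
    using assms by auto
  define A where "A = P \<bullet> P + h\<^sup>2"
  define B where "B = Q \<bullet> Q + h\<^sup>2"
  have nA: "(norm p)\<^sup>2 = A" "(norm q)\<^sup>2 = B" and pA: "p \<bullet> p = A" "q \<bullet> q = B" "p \<bullet> q = P \<bullet> Q + h\<^sup>2"
    by (simp_all add: pq A_def B_def norm_Pair dot_square_norm power2_eq_square inner_Pair)
  have AB: "A > 0" "B > 0"
    using np nA by (metis zero_less_power)+
  have "(norm (p /\<^sub>R (norm p)\<^sup>2 - q /\<^sub>R (norm q)\<^sup>2))\<^sup>2 = (A + B - 2 * (p \<bullet> q)) / (A * B)"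
    using AB unfolding nA dot_square_norm[symmetric]
    by (simp add: inner_diff_left inner_diff_right pA(1,2) inner_commute[of q p] field_simps)
  moreover have "(A + B - 2 * (p \<bullet> q)) * h\<^sup>2 \<le> A * B"
  proof -
    have "(P \<bullet> Q)\<^sup>2 \<le> (P \<bullet> P) * (Q \<bullet> Q)" by (rule Cauchy_Schwarz_ineq)
    then have "0 \<le> (P \<bullet> P) * (Q \<bullet> Q) - (P \<bullet> Q)\<^sup>2 + (P \<bullet> Q + h\<^sup>2)\<^sup>2" by simp
    also have "\<dots> = A * B - (A + B - 2 * (p \<bullet> q)) * h\<^sup>2"
      unfolding pA(3) A_def B_def by (simp add: power2_eq_square algebra_simps)
    finally show ?thesis by simp
  qed
  ultimately have "(norm (p /\<^sub>R (norm p)\<^sup>2 - q /\<^sub>R (norm q)\<^sup>2) * h)\<^sup>2 \<le> 1\<^sup>2"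
    using AB by (simp only: power_mult_distrib) (simp add: divide_le_eq)
  then have "norm (p /\<^sub>R (norm p)\<^sup>2 - q /\<^sub>R (norm q)\<^sup>2) * h \<le> 1"
    using power2_le_imp_le zero_le_one by blast
  then show ?thesis by (simp add: pq)
qed

text \<open>The function \<open>x \<mapsto> ln (\<parallel>x - z\<parallel> / \<parallel>x - w\<parallel>)\<close> is 1-Lipschitz for the hyperbolic
  metric and restricts to arc length on the geodesic from \<open>z\<close> to \<open>w\<close>; it thus calibrates that geodesic.\<close>

definition calibration :: "real^2 \<Rightarrow> real^2 \<Rightarrow> (real^2) \<times> real \<Rightarrow> real" where
  "calibration z w x = (ln ((x - (z, 0)) \<bullet> (x - (z, 0))) - ln ((x - (w, 0)) \<bullet> (x - (w, 0)))) / 2"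

text \<open>By \<open>horospherical_bound\<close> the derivative of \<open>calibration\<close> along
  \<open>g\<close> is at most Euclidean speed over height, which is the integrand of the
  length.\<close>

lemma hyp_length_ge_calibration:
  assumes "g C1_differentiable_on {0..1}" "path_image g \<subseteq> half_space"
  shows "\<bar>calibration z w (pathfinish g) - calibration z w (pathstart g)\<bar> \<le> hyp_length g"
proof -
  obtain D where D: "\<And>t. t \<in> {0..1} \<Longrightarrow> (g has_vector_derivative D t) (at t)"
    and Dc: "continuous_on {0..1} D"
    using assms(1) unfolding C1_differentiable_on_def by blast
  have pos: "snd (g t) > 0" if "t \<in> {0..1}" for t
    using assms(2) that by (force simp: path_image_def half_space_def)
  have gc: "continuous_on {0..1} g"
    using D by (meson continuous_at_imp_continuous_on has_vector_derivative_continuous)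
  define a where "a = (z, 0::real)"
  define b where "b = (w, 0::real)"
  define F' where "F' t = ((g t - a) /\<^sub>R (norm (g t - a))\<^sup>2 - (g t - b) /\<^sub>R (norm (g t - b))\<^sup>2) \<bullet> D t" for t
  have nz: "(g t - a) \<bullet> (g t - a) > 0" "(g t - b) \<bullet> (g t - b) > 0" if "t \<in> {0..1}" for t
    using pos[OF that] by (auto simp: a_def b_def)
  have half: "((\<lambda>t. ln ((g t - c) \<bullet> (g t - c))) has_real_derivative
          inverse ((g t - c) \<bullet> (g t - c)) * (2 * ((g t - c) \<bullet> D t))) (at t within {0..1})"
    if "t \<in> {0..1}" "(g t - c) \<bullet> (g t - c) > 0" for c t
  proof -
    have gd: "((\<lambda>t. g t - c) has_vector_derivative (D t - 0)) (at t within {0..1})"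
      by (intro has_vector_derivative_diff has_vector_derivative_const
          has_vector_derivative_at_within[OF D[OF that(1)]])
    have "((\<lambda>t. (g t - c) \<bullet> (g t - c)) has_vector_derivative
      ((g t - c) \<bullet> (D t - 0) + (D t - 0) \<bullet> (g t - c))) (at t within {0..1})"
      by (rule bounded_bilinear.has_vector_derivative[OF bounded_bilinear_inner gd gd])
    then have 1: "((\<lambda>t. (g t - c) \<bullet> (g t - c)) has_real_derivative (2 * ((g t - c) \<bullet> D t))) (at t within {0..1})"
      by (simp add: has_real_derivative_iff_has_vector_derivative inner_commute)
    show ?thesis
      using DERIV_chain2[OF DERIV_ln[OF that(2)] 1] by simp
  qed
  have F: "((\<lambda>t. calibration z w (g t)) has_vector_derivative F' t) (at t within {0..1})" if "t \<in> {0..1}" for t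
  proof -
    have "((\<lambda>t. (ln ((g t - a) \<bullet> (g t - a)) - ln ((g t - b) \<bullet> (g t - b))) / 2) has_real_derivative
       (inverse ((g t - a) \<bullet> (g t - a)) * (2 * ((g t - a) \<bullet> D t))
         - inverse ((g t - b) \<bullet> (g t - b)) * (2 * ((g t - b) \<bullet> D t))) / 2) (at t within {0..1})"
      by (intro DERIV_cdivide DERIV_diff half that nz)
    moreover have "(inverse ((g t - a) \<bullet> (g t - a)) * (2 * ((g t - a) \<bullet> D t))
         - inverse ((g t - b) \<bullet> (g t - b)) * (2 * ((g t - b) \<bullet> D t))) / 2 = F' t"
      unfolding F'_def inner_diff_left[of "_ /\<^sub>R _"] inner_scaleR_left dot_square_norm
      by (simp add: diff_divide_distrib)
    ultimately show ?thesis
      by (simp add: has_real_derivative_iff_has_vector_derivative calibration_def a_def b_def)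
  qed
  have hi: "(F' has_integral calibration z w (g 1) - calibration z w (g 0)) {0..1}"
    by (rule fundamental_theorem_of_calculus) (use F in auto)
  have bnd: "norm (F' t) \<le> norm (D t) / snd (g t)" if "t \<in> {0..1}" for t
  proof -
    have "norm ((g t - a) /\<^sub>R (norm (g t - a))\<^sup>2 - (g t - b) /\<^sub>R (norm (g t - b))\<^sup>2) * snd (g t - a) \<le> 1"
      by (rule horospherical_bound) (use pos[OF that] in \<open>auto simp: a_def b_def\<close>)
    then have "norm ((g t - a) /\<^sub>R (norm (g t - a))\<^sup>2 - (g t - b) /\<^sub>R (norm (g t - b))\<^sup>2) \<le> 1 / snd (g t)"
      using pos[OF that] by (simp add: a_def field_simps)
    then have "norm (F' t) \<le> 1 / snd (g t) * norm (D t)"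
      unfolding F'_def real_norm_def
      by (intro order_trans[OF Cauchy_Schwarz_ineq2] mult_right_mono) auto
    then show ?thesis by simp
  qed
  have "continuous_on {0..1} (\<lambda>t. norm (D t) / snd (g t))"
    using pos by (intro continuous_intros Dc gc) force
  then have int: "(\<lambda>t. norm (D t) / snd (g t)) integrable_on {0..1}"
    by (rule integrable_continuous_interval)
  have "norm (integral {0..1} F') \<le> integral {0..1} (\<lambda>t. norm (D t) / snd (g t))"
    using hi int bnd by (intro integral_norm_bound_integral) auto
  also have "\<dots> = hyp_length g"
    unfolding hyp_length_def by (rule integral_cong) (simp add: vector_derivative_at[OF D])
  finally show ?thesis
    using hi by (simp add: integral_unique pathstart_def pathfinish_def)
qed

text \<open>Arc length parametrization: \<open>t\<close> is the signed hyperbolic distance from the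
  top of the semicircle, running from \<open>z\<close> at minus infinity to \<open>w\<close> at plus
  infinity.\<close>

definition geodesic_param :: "real^2 \<Rightarrow> real^2 \<Rightarrow> real \<Rightarrow> (real^2) \<times> real" where
  "geodesic_param z w t = (midpoint z w + (tanh t / 2) *\<^sub>R (w - z), dist z w / 2 / cosh t)"

lemma sech_square: "1 / (cosh t)\<^sup>2 = 1 - (tanh t)\<^sup>2" for t :: real
  using cosh_real_pos[of t] by (simp add: tanh_def power_divide sinh_square_eq field_simps)

lemma tanh_artanh_real: "\<bar>k\<bar> < 1 \<Longrightarrow> tanh (artanh k) = k" for k :: real
proof -
  assume k: "\<bar>k\<bar> < 1"
  have "exp (- (2 * artanh k)) = (1 - k) / (1 + k)"
    using k by (simp add: artanh_def exp_minus)
  then show ?thesis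
    using k by (simp add: tanh_real_altdef) (simp add: field_simps)
qed

text \<open>With radius r, the squared distances to the two ends are 2 r^2 (1 + tanh t) and 2 r^2 (1
  - tanh t), and their ratio is exp (2 t).\<close>

lemma calibration_geodesic_param:
  assumes "z \<noteq> w"
  shows "calibration z w (geodesic_param z w t) = t"
proof -
  define r where "r = dist z w / 2"
  have r: "r > 0" using assms by (simp add: r_def)
  have n: "(w - z) \<bullet> (w - z) = 4 * r\<^sup>2"
    by (simp add: r_def dot_square_norm dist_norm norm_minus_commute power2_eq_square)
  have rc: "(r / cosh t) * (r / cosh t) = r\<^sup>2 * (1 - (tanh t)\<^sup>2)"
    unfolding sech_square[symmetric] by (simp add: power2_eq_square)
  have T: "- 1 < tanh t" "tanh t < 1"
    using tanh_real_gt_neg1 tanh_real_lt_1 by auto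
  have m1: "midpoint z w - z = (1/2) *\<^sub>R (w - z)" "midpoint z w - w = (-1/2) *\<^sub>R (w - z)"
    by (simp_all add: midpoint_def vec_eq_iff field_simps)
  have "geodesic_param z w t - (z, 0) = (((1 + tanh t) / 2) *\<^sub>R (w - z), r / cosh t)"
    using m1(1) by (simp add: geodesic_param_def r_def algebra_simps add_divide_distrib)
  then have 1: "(geodesic_param z w t - (z, 0)) \<bullet> (geodesic_param z w t - (z, 0)) = 2 * r\<^sup>2 * (1 + tanh t)"
    by (simp only: inner_Pair inner_scaleR_left inner_scaleR_right n inner_real_def rc)
       (simp add: power2_eq_square field_simps)
  have "geodesic_param z w t - (w, 0) = (((tanh t - 1) / 2) *\<^sub>R (w - z), r / cosh t)"
    using m1(2) by (simp add: geodesic_param_def r_def algebra_simps diff_divide_distrib)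
  then have 2: "(geodesic_param z w t - (w, 0)) \<bullet> (geodesic_param z w t - (w, 0)) = 2 * r\<^sup>2 * (1 - tanh t)"
    by (simp only: inner_Pair inner_scaleR_left inner_scaleR_right n inner_real_def rc)
       (simp add: power2_eq_square field_simps)
  have "ln (2 * r\<^sup>2 * (1 + tanh t)) - ln (2 * r\<^sup>2 * (1 - tanh t)) = ln ((1 + tanh t) / (1 - tanh t))"
    using r T by (simp add: ln_mult ln_div)
  also have "(1 + tanh t) / (1 - tanh t) = exp (2 * t)"
  proof -
    have "1 + tanh t = exp t / cosh t" "1 - tanh t = exp (-t) / cosh t"
      using cosh_real_pos[of t] by (simp_all add: tanh_def sinh_def cosh_def field_simps)
    moreover have "exp t / exp (- t) = exp (2 * t)"
      by (simp flip: exp_diff)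
    ultimately show ?thesis
      using cosh_real_pos[of t] by simp
  qed
  finally show ?thesis
    unfolding calibration_def 1 2 by simp
qed

lemma range_geodesic_param:
  assumes "z \<noteq> w"
  shows "range (geodesic_param z w) = geodesic_joining z w"
proof -
  define r where "r = dist z w / 2"
  have r: "r > 0" using assms by (simp add: r_def)
  have n: "norm (w - z) = 2 * r"
    by (simp add: r_def dist_norm norm_minus_commute)
  have rc: "(r / cosh t)\<^sup>2 = r\<^sup>2 * (1 - (tanh t)\<^sup>2)" for t
    unfolding sech_square[symmetric] by (simp add: power_divide)
  have "geodesic_param z w t \<in> geodesic_joining z w" for t
  proof -
    have "midpoint z w + (tanh t / 2) *\<^sub>R (w - z) = ((1 - tanh t) / 2) *\<^sub>R z + ((1 + tanh t) / 2) *\<^sub>R w"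
      by (simp add: midpoint_def vec_eq_iff field_simps)
    moreover have "(1 - tanh t) / 2 + (1 + tanh t) / 2 = 1" by (simp add: field_simps)
    ultimately have 1: "fst (geodesic_param z w t) \<in> affine hull {z, w}"
      by (auto simp: affine_hull_2 geodesic_param_def)
    have "(dist (geodesic_param z w t) (midpoint z w, 0))\<^sup>2 = (tanh t * r)\<^sup>2 + (r / cosh t)\<^sup>2"
      by (simp add: geodesic_param_def dist_norm norm_Pair n norm_minus_commute[of z w] power_mult_distrib power_divide)
    also have "\<dots> = r\<^sup>2"
      unfolding rc by (simp add: power2_eq_square algebra_simps)
    finally have "(dist (geodesic_param z w t) (midpoint z w, 0))\<^sup>2 = r\<^sup>2" .
    then have "dist (geodesic_param z w t) (midpoint z w, 0) = r"
      using r by (simp add: power2_eq_iff_nonneg)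
    with 1 r show ?thesis
      by (auto simp: geodesic_joining_def half_space_def r_def geodesic_param_def)
  qed
  moreover have "x \<in> range (geodesic_param z w)" if x: "x \<in> geodesic_joining z w" for x
  proof -
    obtain p h where ph: "x = (p, h)" by fastforce
    have h: "h > 0" using x ph by (simp add: geodesic_joining_def half_space_def)
    obtain u v where uv: "u + v = 1" "p = u *\<^sub>R z + v *\<^sub>R w"
      using x ph by (auto simp: geodesic_joining_def affine_hull_2)
    \<comment> \<open>Affine coordinate along the diameter, normalized to -1 at \<open>z\<close> and
      1 at \<open>w\<close>; on the semicircle it has to be tanh of the parameter.\<close>
    define k where "k = v - u"
    have "u = (1 - k) / 2" "v = (1 + k) / 2" using uv by (auto simp: k_def field_simps)
    then have p: "p = midpoint z w + (k / 2) *\<^sub>R (w - z)"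
      unfolding uv(2) by (simp only:) (simp add: midpoint_def vec_eq_iff field_simps)
    have "dist x (midpoint z w, 0) = r"
      using x by (simp add: geodesic_joining_def r_def)
    then have "(dist x (midpoint z w, 0))\<^sup>2 = r\<^sup>2" by simp
    then have e: "k\<^sup>2 * r\<^sup>2 + h\<^sup>2 = r\<^sup>2"
      by (simp add: ph p dist_norm norm_Pair n power_mult_distrib)
    then have "k\<^sup>2 * r\<^sup>2 < 1 * r\<^sup>2" using h by (smt (verit) zero_less_power)
    then have "k\<^sup>2 < 1" using mult_less_cancel_right_pos[of "r\<^sup>2"] r by (metis zero_less_power)
    then have k: "\<bar>k\<bar> < 1" by (simp add: abs_square_less_1)
    define t where "t = artanh k"
    have t: "tanh t = k" unfolding t_def using k tanh_artanh_real by blast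
    have "(r / cosh t)\<^sup>2 = h\<^sup>2"
      using e unfolding rc t by (simp add: algebra_simps)
    then have "r / cosh t = h"
      using r h cosh_real_pos[of t] by (simp add: power2_eq_iff_nonneg)
    then have "x = geodesic_param z w t"
      by (simp add: ph p geodesic_param_def t r_def)
    then show ?thesis by blast
  qed
  ultimately show ?thesis by blast
qed

lemma geodesic_param_has_vector_derivative:
  "(geodesic_param z w has_vector_derivative
     (((1 - (tanh t)\<^sup>2) / 2) *\<^sub>R (w - z), - (dist z w / 2 * sinh t / (cosh t)\<^sup>2))) (at t)"
proof -
  have c: "cosh t \<noteq> 0" using cosh_real_pos[of t] by simp
  have "((\<lambda>t. midpoint z w + (tanh t / 2) *\<^sub>R (w - z)) has_vector_derivative
        0 + ((1 - (tanh t)\<^sup>2) / 2) *\<^sub>R (w - z)) (at t)"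
    by (auto intro!: derivative_eq_intros simp: c)
  moreover have "((\<lambda>t. dist z w / 2 / cosh t) has_vector_derivative - (dist z w / 2 * sinh t / (cosh t)\<^sup>2)) (at t)"
    unfolding has_real_derivative_iff_has_vector_derivative[symmetric]
    by (auto intro!: derivative_eq_intros simp: c power2_eq_square)
  ultimately show ?thesis
    unfolding geodesic_param_def by (simp add: has_vector_derivative_Pair)
qed

lemma geodesic_param_unit_speed:
  assumes "z \<noteq> w"
  shows "norm (((1 - (tanh t)\<^sup>2) / 2) *\<^sub>R (w - z), - (dist z w / 2 * sinh t / (cosh t)\<^sup>2))
     = snd (geodesic_param z w t)"
proof -
  define r where "r = dist z w / 2"
  have r: "r > 0" using assms by (simp add: r_def)
  have n: "norm (w - z) = 2 * r"
    by (simp add: r_def dist_norm norm_minus_commute)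
  have c: "cosh t > 0" by (rule cosh_real_pos)
  have e: "(((1 - (tanh t)\<^sup>2) / 2) *\<^sub>R (w - z), - (dist z w / 2 * sinh t / (cosh t)\<^sup>2))
     = (1 / (cosh t)\<^sup>2) *\<^sub>R ((1/2) *\<^sub>R (w - z), - (r * sinh t))"
    by (simp add: sech_square[symmetric] r_def)
  have "norm ((1/2) *\<^sub>R (w - z), - (r * sinh t)) = sqrt (r\<^sup>2 + r\<^sup>2 * (sinh t)\<^sup>2)"
    by (simp add: norm_Pair n power_mult_distrib)
  also have "r\<^sup>2 + r\<^sup>2 * (sinh t)\<^sup>2 = (r * cosh t)\<^sup>2"
    by (simp add: power_mult_distrib cosh_square_eq algebra_simps)
  finally have "norm ((1/2) *\<^sub>R (w - z), - (r * sinh t)) = r * cosh t"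
    using r c by simp
  then show ?thesis
    unfolding e norm_scaleR using c by (simp add: geodesic_param_def r_def[symmetric] power2_eq_square)
qed

text \<open>The calibration bounds every competitor from below, and the semicircular arc, affinely
  reparametrized to the unit interval, attains the bound.\<close>

lemma hyp_dist_geodesic_param:
  assumes "z \<noteq> w"
  shows "hyp_dist (geodesic_param z w s) (geodesic_param z w t) = \<bar>s - t\<bar>"
proof -
  let ?g = "geodesic_param z w"
  let ?S = "{hyp_length g | g. g C1_differentiable_on {0..1} \<and> path_image g \<subseteq> half_space \<and>
      pathstart g = ?g s \<and> pathfinish g = ?g t}"
  have lower: "\<bar>s - t\<bar> \<le> x" if "x \<in> ?S" for x
    using that hyp_length_ge_calibration[of _ z w] by (force simp: calibration_geodesic_param[OF assms])
  define \<gamma> where "\<gamma> u = ?g (s + u * (t - s))" for u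
  define d where "d t = (((1 - (tanh t)\<^sup>2) / 2) *\<^sub>R (w - z), - (dist z w / 2 * sinh t / (cosh t)\<^sup>2))" for t
  have \<gamma>: "(\<gamma> has_vector_derivative (t - s) *\<^sub>R d (s + u * (t - s))) (at u)" for u
  proof -
    have 1: "((\<lambda>u. s + u * (t - s)) has_vector_derivative (t - s)) (at u)"
      by (auto simp: has_real_derivative_iff_has_vector_derivative[symmetric] intro!: derivative_eq_intros)
    have "((?g \<circ> (\<lambda>u. s + u * (t - s))) has_vector_derivative (t - s) *\<^sub>R d (s + u * (t - s))) (at u)"
      unfolding d_def by (rule vector_diff_chain_at[OF 1 geodesic_param_has_vector_derivative])
    then show ?thesis by (simp add: \<gamma>_def[abs_def] comp_def)
  qed
  have c: "cosh x \<noteq> 0" for x :: real using cosh_real_pos[of x] by simp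
  have c1: "\<gamma> C1_differentiable_on {0..1}"
    unfolding C1_differentiable_on_def
    by (rule exI[of _ "\<lambda>u. (t - s) *\<^sub>R d (s + u * (t - s))"], intro conjI ballI \<gamma>)
       (auto simp: d_def c intro!: continuous_intros)
  have im: "path_image \<gamma> \<subseteq> half_space"
    using range_geodesic_param[OF assms] by (auto simp: path_image_def \<gamma>_def geodesic_joining_def)
  have pos: "snd (?g u) > 0" for u
    using assms by (simp add: geodesic_param_def)
  have len: "hyp_length \<gamma> = \<bar>s - t\<bar>"
  proof -
    have "norm (vector_derivative \<gamma> (at u)) / snd (\<gamma> u) = \<bar>t - s\<bar>" for u
      using pos[of "s + u * (t - s)"]
      unfolding vector_derivative_at[OF \<gamma>] norm_scaleR
      unfolding d_def geodesic_param_unit_speed[OF assms] \<gamma>_def by simp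
    then show ?thesis by (simp add: hyp_length_def)
  qed
  have "\<bar>s - t\<bar> \<in> ?S"
    using c1 im len by (auto simp: \<gamma>_def pathstart_def pathfinish_def intro!: exI[of _ \<gamma>])
  then show ?thesis
    unfolding hyp_dist_def by (intro cInf_eq_minimum lower) auto
qed

text \<open>This makes the map behind \<open>geodesic_measure\<close> take its values in
  \<open>geodesics\<close>.\<close>

lemma geodesic_joining_in_geodesics: "z \<noteq> w \<Longrightarrow> geodesic_joining z w \<in> geodesics"
  using range_geodesic_param[of z w] hyp_dist_geodesic_param[of z w]
  by (force simp: geodesics_def geodesic_joining_def intro!: exI[of _ "geodesic_param z w"])

lemma bounded_geodesic_joining: "bounded (geodesic_joining z w)"
  by (rule bounded_subset[OF bounded_cball[of "(midpoint z w, 0)" "dist z w / 2"]])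
     (auto simp: geodesic_joining_def dist_commute)

text \<open>A semicircle is bounded, so infinity is excluded. Its closure stays in the full circle
  \<open>K\<close> of the vertical plane, which reaches height 0 only at \<open>z\<close> and
  \<open>w\<close>; the limits of \<open>geodesic_param\<close> show that both are reached.\<close>

lemma ideal_endpoints_geodesic_joining:
  assumes "z \<noteq> w"
  shows "ideal_endpoints (geodesic_joining z w) = {Some z, Some w}"
proof -
  have "x = z \<or> x = w" if "(x, 0) \<in> closure (geodesic_joining z w)" for x
  proof -
    define K where "K = ((affine hull {z, w}) \<times> UNIV) \<inter> sphere (midpoint z w, 0::real) (dist z w / 2)"
    have "closed K"
      unfolding K_def by (intro closed_Int closed_Times closed_affine_hull) auto
    moreover have "geodesic_joining z w \<subseteq> K"
      by (force simp: geodesic_joining_def K_def dist_commute mem_Times_iff)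
    ultimately have "(x, 0) \<in> K" using that closure_minimal by blast
    then obtain u v where uv: "u + v = 1" "x = u *\<^sub>R z + v *\<^sub>R w" and d: "dist (midpoint z w) x = dist z w / 2"
      by (auto simp: K_def affine_hull_2 dist_Pair_Pair)
    have u: "u = 1 - v" using uv by simp
    have "midpoint z w - x = ((1 - 2 * v) / 2) *\<^sub>R (w - z)"
      by (simp add: uv(2) u midpoint_def vec_eq_iff field_simps)
    then have "\<bar>1 - 2 * v\<bar> / 2 * dist z w = dist z w / 2"
      using d by (simp add: dist_norm norm_minus_commute)
    then have "\<bar>1 - 2 * v\<bar> = 1" using assms by (simp add: field_simps)
    then have "v = 0 \<or> v = 1" by linarith
    then show ?thesis using uv u by auto
  qed
  moreover have "(z, 0) \<in> closure (geodesic_joining z w)" "(w, 0) \<in> closure (geodesic_joining z w)"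
  proof -
    have ev: "\<forall>\<^sub>F t in F. geodesic_param z w t \<in> geodesic_joining z w" for F
      using range_geodesic_param[OF assms] by (intro always_eventually) auto
    have c: "((\<lambda>t. dist z w / 2 / cosh t) \<longlongrightarrow> 0) F" if "filterlim cosh at_top F" for F :: "real filter"
      by (intro real_tendsto_divide_at_top[OF tendsto_const] that)
    have "(geodesic_param z w \<longlongrightarrow> (midpoint z w + (1 / 2) *\<^sub>R (w - z), 0)) at_top"
      unfolding geodesic_param_def
      by (intro tendsto_Pair tendsto_intros tanh_real_at_top c cosh_real_at_top) auto
    moreover have "midpoint z w + (1 / 2) *\<^sub>R (w - z) = w"
      by (simp add: midpoint_def vec_eq_iff field_simps)
    ultimately show "(w, 0) \<in> closure (geodesic_joining z w)"
      by (intro Lim_in_closed_set[OF closed_closure _ trivial_limit_at_top_linorder])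
         (auto intro: eventually_mono[OF ev] closure_subset[THEN subsetD])
    have "(geodesic_param z w \<longlongrightarrow> (midpoint z w + (-1 / 2) *\<^sub>R (w - z), 0)) at_bot"
      unfolding geodesic_param_def
      by (intro tendsto_Pair tendsto_intros tanh_real_at_bot c cosh_real_at_bot) auto
    moreover have "midpoint z w + (-1 / 2) *\<^sub>R (w - z) = z"
      by (simp add: midpoint_def vec_eq_iff field_simps)
    ultimately show "(z, 0) \<in> closure (geodesic_joining z w)"
      by (intro Lim_in_closed_set[OF closed_closure _ trivial_limit_at_bot_linorder])
         (auto intro: eventually_mono[OF ev] closure_subset[THEN subsetD])
  qed
  ultimately show ?thesis
    by (auto simp: ideal_endpoints_def bounded_geodesic_joining)
qed

text \<open>Vertical projection is injective on the semicircle because the sphere equation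
  determines the positive height. A bijection transfers finiteness as well as cardinality.\<close>

lemma bij_betw_geodesic_joining_segment:
  assumes "z \<noteq> w"
  shows "bij_betw fst (geodesic_joining z w \<inter> C \<times> {0<..}) (open_segment z w \<inter> C)"
proof -
  have inj: "inj_on fst (geodesic_joining z w)"
  proof (rule inj_onI)
    fix x y assume x: "x \<in> geodesic_joining z w" and y: "y \<in> geodesic_joining z w" and e: "fst x = fst y"
    have "(dist x (midpoint z w, 0))\<^sup>2 = (dist y (midpoint z w, 0))\<^sup>2"
      using x y by (simp add: geodesic_joining_def)
    then have "(snd x)\<^sup>2 = (snd y)\<^sup>2"
      using e by (simp add: dist_prod_def)
    then have "snd x = snd y"
      using x y by (simp add: geodesic_joining_def half_space_def power2_eq_iff_nonneg)
    then show "x = y" using e by (simp add: prod_eq_iff)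
  qed
  have im: "fst ` geodesic_joining z w = open_segment z w"
  proof -
    have m: "midpoint z w + (k / 2) *\<^sub>R (w - z) = (1 - (1 + k) / 2) *\<^sub>R z + ((1 + k) / 2) *\<^sub>R w" for k :: real
      by (simp add: midpoint_def vec_eq_iff field_simps)
    have "fst (geodesic_param z w t) \<in> open_segment z w" for t
    proof -
      have "0 < (1 + tanh t) / 2" "(1 + tanh t) / 2 < 1"
        using tanh_real_gt_neg1[of t] tanh_real_lt_1[of t] by auto
      then show ?thesis
        unfolding geodesic_param_def m in_segment fst_conv using assms by blast
    qed
    moreover have "x \<in> range (\<lambda>t. fst (geodesic_param z w t))" if "x \<in> open_segment z w" for x
    proof -
      obtain u where u: "0 < u" "u < 1" "x = (1 - u) *\<^sub>R z + u *\<^sub>R w"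
        using \<open>x \<in> open_segment z w\<close> by (auto simp: in_segment)
      define k where "k = 2 * u - 1"
      have k: "tanh (artanh k) = k" using u by (intro tanh_artanh_real) (auto simp: k_def)
      have "fst (geodesic_param z w (artanh k)) = x"
        unfolding geodesic_param_def fst_conv k m by (simp add: u k_def)
      then show ?thesis by blast
    qed
    ultimately have "range (\<lambda>t. fst (geodesic_param z w t)) = open_segment z w" by blast
    then show ?thesis using range_geodesic_param[OF assms] by (metis image_image)
  qed
  show ?thesis
    unfolding bij_betw_def
  proof
    show "inj_on fst (geodesic_joining z w \<inter> C \<times> {0<..})"
      using inj by (rule inj_on_subset) auto
    show "fst ` (geodesic_joining z w \<inter> C \<times> {0<..}) = open_segment z w \<inter> C"
      unfolding im[symmetric] by (force simp: geodesic_joining_def half_space_def)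
  qed
qed

section \<open>Separation of the plane by a closed curve\<close>

text \<open>\<open>I\<close> and \<open>V\<close> stand for the inside and the outside of a Jordan
  curve. The last two assumptions, that both sides accumulate at every point of the curve, are what
  makes a crossing change sides.\<close>

locale plane_separation =
  fixes C I V :: "(real^2) set"
  assumes open_I: "open I" and open_V: "open V"
    and connected_I: "connected I" and connected_V: "connected V"
    and bounded_I: "bounded I"
    and disjoint: "I \<inter> V = {}" and cover: "I \<union> V = - C"
    and closure_I: "C \<subseteq> closure I" and closure_V: "C \<subseteq> closure V"

text \<open>The Jordan curve theorem for \<open>complex\<close>, transported along the linear
  isomorphism \<open>f\<close> with inverse \<open>h\<close>; the closure conditions come from the
  frontiers of inside and outside both being the curve.\<close>

lemma Jordan_plane_separation:
  fixes c :: "real \<Rightarrow> real^2"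
  assumes "simple_path c" "pathfinish c = pathstart c"
  obtains I V where "plane_separation (path_image c) I V"
proof -
  define f :: "real^2 \<Rightarrow> complex" where "f x = Complex (x$1) (x$2)" for x
  define h :: "complex \<Rightarrow> real^2" where "h z = vector [Re z, Im z]" for z
  have hf: "h (f x) = x" for x
    by (simp add: h_def f_def vec_eq_iff forall_2)
  have fh: "f (h z) = z" for z
    by (simp add: h_def f_def complex_eq_iff)
  have f: "bounded_linear f"
    by (intro linear_conv_bounded_linear[THEN iffD1] linearI) (auto simp: f_def complex_eq_iff)
  have h: "bounded_linear h"
    by (intro linear_conv_bounded_linear[THEN iffD1] linearI) (auto simp: h_def vec_eq_iff forall_2)
  have cf: "continuous_on S f" and ch: "continuous_on T h" for S T
    using f h by (auto simp: bounded_linear.linear linear_continuous_on)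
  have vim: "f -` A = h ` A" for A
  proof
    show "f -` A \<subseteq> h ` A" using hf by (metis imageI subsetI vimageD)
    show "h ` A \<subseteq> f -` A" using fh by auto
  qed
  have inj: "inj f" by (metis hf injI)
  let ?c = "f \<circ> c"
  have sc: "simple_path ?c"
    using inj assms(1) by (intro simple_path_continuous_image[OF assms(1) cf]) (auto intro: inj_on_subset)
  have pc: "pathfinish ?c = pathstart ?c"
    using assms(2) by (simp add: pathfinish_compose pathstart_compose)
  have im: "path_image ?c = f ` path_image c" by (simp add: path_image_compose)
  let ?A = "inside (path_image ?c)" and ?B = "outside (path_image ?c)"
  note J = Jordan_inside_outside[OF sc pc]
  have cl: "path_image c \<subseteq> closure (f -` A)" if "frontier A = path_image ?c" for A
  proof
    fix x assume "x \<in> path_image c"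
    then have "f x \<in> closure A"
      using that im by (auto simp: frontier_def)
    then have "x \<in> h ` closure A" using hf by (metis imageI)
    also have "\<dots> \<subseteq> closure (h ` A)"
      by (rule image_closure_subset[OF ch closed_closure closure_subset])
    finally show "x \<in> closure (f -` A)" by (simp add: vim)
  qed
  have "plane_separation (path_image c) (f -` ?A) (f -` ?B)"
  proof
    show "open (f -` ?A)" "open (f -` ?B)"
      using J cf by (auto intro!: open_vimage)
    show "connected (f -` ?A)" "connected (f -` ?B)"
      unfolding vim using J by (auto intro!: connected_continuous_image ch)
    show "bounded (f -` ?A)"
      unfolding vim using J h by (auto intro!: bounded_linear_image)
    show "f -` ?A \<inter> f -` ?B = {}" using J by blast
    have "f -` ?A \<union> f -` ?B = f -` (?A \<union> ?B)" by blast
    also have "\<dots> = f -` (- path_image ?c)" using J by simp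
    also have "\<dots> = - path_image c" unfolding im using inj by (auto simp: inj_def)
    finally show "f -` ?A \<union> f -` ?B = - path_image c" .
    show "path_image c \<subseteq> closure (f -` ?A)" "path_image c \<subseteq> closure (f -` ?B)"
      using J by (auto intro!: cl)
  qed
  then show ?thesis by (rule that)
qed

context plane_separation
begin

definition opposite :: "real^2 \<Rightarrow> real^2 \<Rightarrow> bool" where
  "opposite z w \<longleftrightarrow> (z \<in> I \<and> w \<in> V) \<or> (z \<in> V \<and> w \<in> I)"

lemma closed_C: "closed C"
  using open_I open_V cover by (metis closed_def open_Un)

lemma lambda2_opposite:
  assumes ends: "ideal_endpoints l = {Some z, Some w}"
  shows "lambda2 l C = of_bool (opposite z w)"
proof -
  define T where "T = subtopology ideal_boundary (- Some ` C)"
  have topT: "topspace T = - Some ` C"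
    by (auto simp: T_def ideal_boundary_def image_iff)
  have comp_eq: "A = B" if "A \<in> connected_components_of T" "B \<in> connected_components_of T" "x \<in> A" "x \<in> B" for A B x
    using connected_components_of_overlap[OF that(1,2)] that(3,4) by auto
  have conn: "connectedin T (Some ` S)" if "connected S" "S \<inter> C = {}" for S
  proof -
    have "connectedin ideal_boundary (Some ` S)"
      unfolding ideal_boundary_def
      by (rule connectedin_continuous_map_image[OF continuous_map_Some]) (simp add: that)
    moreover have "Some ` S \<subseteq> - Some ` C" using that by auto
    ultimately show ?thesis by (simp add: T_def connectedin_subtopology)
  qed
  have openI: "openin T (Some ` I)"
  proof -
    have "openin ideal_boundary (Some ` I)" using open_I by (simp add: ideal_boundary_def)
    moreover have "Some ` I = Some ` I \<inter> - Some ` C" using cover by auto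
    ultimately show ?thesis unfolding T_def by (metis openin_subtopology)
  qed
  have closedI: "closedin T (Some ` I)"
  proof -
    have "compact (closure I)" using bounded_I by (simp add: compact_closure)
    then have "closedin ideal_boundary (Some ` closure I)" by (simp add: ideal_boundary_def)
    moreover have "Some ` I = Some ` closure I \<inter> - Some ` C"
    proof -
      have "closure I \<inter> V = {}"
        using open_V disjoint open_Int_closure_eq_empty[of V I] by blast
      then have "closure I - C = I" using closure_subset[of I] cover by blast
      then show ?thesis by auto
    qed
    ultimately show ?thesis unfolding T_def by (metis closedin_subtopology)
  qed
  have sep: False if "A \<in> connected_components_of T" "Some x \<in> A" "Some y \<in> A" "x \<in> I" "y \<in> V" for A x y
  proof -
    have "connectedin T A" using that(1) by (rule connectedin_connected_components_of)
    then have "A \<subseteq> Some ` I \<or> disjnt A (Some ` I)"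
      using connectedin_clopen_cases[OF _ closedI openI] by blast
    then show False using that disjoint by (auto simp: disjnt_iff)
  qed
  have ex: "\<exists>A\<in>connected_components_of T. Some x \<in> A" if "x \<notin> C" for x
    using Union_connected_components_of[of T] topT that by blast
  have same: "A = B" if "A \<in> connected_components_of T" "B \<in> connected_components_of T"
      "Some x \<in> A" "Some y \<in> B" "S \<inter> C = {}" "connected S" "x \<in> S" "y \<in> S" for A B x y S
  proof -
    have "Some ` S \<subseteq> A"
      using connected_components_of_maximal[OF that(1) conn[OF that(6,5)]] that by (auto simp: disjnt_iff)
    then show ?thesis using comp_eq[OF that(1,2)] that by blast
  qed
  have notC: "x \<notin> C" if "A \<in> connected_components_of T" "Some x \<in> A" for A x
    using connected_components_of_subset[OF that(1)] that(2) topT by auto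
  have "(\<exists>a\<in>{Some z, Some w}. \<exists>b\<in>{Some z, Some w}. \<exists>A\<in>connected_components_of T.
           \<exists>B\<in>connected_components_of T. a \<in> A \<and> b \<in> B \<and> A \<noteq> B) \<longleftrightarrow> opposite z w" (is "?L = ?R")
  proof
    assume ?L
    then obtain x y A B where AB: "A \<in> connected_components_of T" "B \<in> connected_components_of T"
      "Some x \<in> A" "Some y \<in> B" "A \<noteq> B" and xy: "x \<in> {z, w}" "y \<in> {z, w}"
      by auto
    have "x \<in> I \<union> V" "y \<in> I \<union> V" using notC AB cover by auto
    moreover have "\<not> (x \<in> I \<and> y \<in> I)"
      using same[OF AB(1-4) _ connected_I] AB(5) cover by auto
    moreover have "\<not> (x \<in> V \<and> y \<in> V)"
      using same[OF AB(1-4) _ connected_V] AB(5) cover by auto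
    moreover have "x \<noteq> y" using AB comp_eq by blast
    ultimately show ?R using xy by (auto simp: opposite_def)
  next
    assume ?R
    then have "z \<notin> C" "w \<notin> C" using cover by (auto simp: opposite_def)
    then obtain A B where AB: "A \<in> connected_components_of T" "B \<in> connected_components_of T"
      "Some z \<in> A" "Some w \<in> B" using ex[of z] ex[of w] by auto
    have "A \<noteq> B" using sep[of A z w] sep[of A w z] \<open>?R\<close> AB unfolding opposite_def by auto
    with AB show ?L by blast
  qed
  then show ?thesis unfolding lambda2_def ends T_def by simp
qed

lemma connected_same_side:
  assumes "connected S" "S \<inter> C = {}"
  shows "S \<subseteq> I \<or> S \<subseteq> V"
proof -
  have "S \<subseteq> I \<union> V" using assms(2) cover by blast
  then show ?thesis
    using connectedD[OF assms(1) open_I open_V] disjoint by blast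
qed

end

text \<open>Induction on the number of points between \<open>s\<close> and \<open>t\<close>,
  removing the last one: \<open>e\<close> flips across it and is constant from there to
  \<open>t\<close>.\<close>

lemma parity_of_flips:
  fixes e :: "real \<Rightarrow> bool"
  assumes "finite X"
    and const: "\<And>a b. a < b \<Longrightarrow> {a..b} \<inter> X = {} \<Longrightarrow> e a = e b"
    and flip: "\<And>x. x \<in> X \<Longrightarrow> \<exists>\<epsilon>>0. \<forall>a b. x - \<epsilon> < a \<longrightarrow> a < x \<longrightarrow> x < b \<longrightarrow> b < x + \<epsilon> \<longrightarrow> e a \<noteq> e b"
    and "s < t" "s \<notin> X" "t \<notin> X"
  shows "e s = e t \<longleftrightarrow> even (card (X \<inter> {s<..<t}))"
  using \<open>s < t\<close> \<open>t \<notin> X\<close>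
proof (induction "card (X \<inter> {s<..<t})" arbitrary: t)
  case 0
  then have "X \<inter> {s<..<t} = {}" using \<open>finite X\<close> by simp
  moreover have "{s..t} = insert s (insert t {s<..<t})" using 0 by auto
  ultimately have "{s..t} \<inter> X = {}" using \<open>s \<notin> X\<close> 0(3) by (auto simp only: Int_insert_left Int_commute if_False)
  then show ?case using const[OF 0(2)] 0(1) by simp
next
  case (Suc n)
  define Y where "Y = X \<inter> {s<..<t}"
  have Y: "finite Y" "Y \<noteq> {}" using \<open>finite X\<close> Suc(2) by (auto simp: Y_def)
  define x where "x = Max Y"
  have x: "x \<in> Y" "\<And>y. y \<in> Y \<Longrightarrow> y \<le> x" using Y by (auto simp: x_def)
  \<comment> \<open>The point preceding \<open>x\<close>, or \<open>s\<close> if there is none; a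
    point \<open>a\<close> between \<open>m\<close> and \<open>x\<close> then has exactly one point
    of \<open>X\<close> fewer to its left.\<close>
  define m where "m = Max (insert s (Y - {x}))"
  have m: "m < x" "s \<le> m" "\<And>y. y \<in> Y - {x} \<Longrightarrow> y \<le> m"
  proof -
    have "\<forall>y\<in>insert s (Y - {x}). y < x" using x by (force simp: Y_def)
    then show "m < x" using Y unfolding m_def by (subst Max_less_iff) auto
    show "s \<le> m" "\<And>y. y \<in> Y - {x} \<Longrightarrow> y \<le> m" using Y by (auto simp: m_def)
  qed
  obtain \<epsilon> where eps: "\<epsilon> > 0" "\<And>a b. x - \<epsilon> < a \<Longrightarrow> a < x \<Longrightarrow> x < b \<Longrightarrow> b < x + \<epsilon> \<Longrightarrow> e a \<noteq> e b"
    using flip[of x] x(1) Y_def by blast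
  obtain a where a: "max m (x - \<epsilon>) < a" "a < x" using m(1) eps(1) dense[of "max m (x - \<epsilon>)" x] by auto
  have "x < t" using x(1) by (simp add: Y_def)
  then obtain b where b: "x < b" "b < min t (x + \<epsilon>)" using eps(1) dense[of x "min t (x + \<epsilon>)"] by auto
  have sa: "s < a" using a m by auto
  have aX: "a \<notin> X"
  proof
    assume "a \<in> X"
    then have "a \<in> Y - {x}" using sa a \<open>x < t\<close> by (auto simp: Y_def)
    then show False using m(3) a by force
  qed
  have Xa: "X \<inter> {s<..<a} = Y - {x}"
    using a m(3) \<open>x < t\<close> by (force simp: Y_def)
  then have "n = card (X \<inter> {s<..<a})" using Suc(2) Y x(1) by (simp add: Y_def[symmetric])
  then have "e s = e a \<longleftrightarrow> even n" using Suc(1)[of a] sa aX by blast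
  moreover have "e a \<noteq> e b" using eps(2)[of a b] a b by auto
  moreover have "e b = e t"
  proof -
    have "{b..t} \<inter> X = {}"
    proof (rule ccontr)
      assume "{b..t} \<inter> X \<noteq> {}"
      then obtain y where y: "b \<le> y" "y \<le> t" "y \<in> X" by auto
      then have "y < t" using Suc(4) by (cases "y = t") auto
      then have "y \<in> Y" using y b x(1) by (auto simp: Y_def)
      then show False using x(2)[of y] y b by auto
    qed
    then show ?thesis using const[of b t] b by auto
  qed
  ultimately show ?case using Suc(2) by (metis even_Suc)
qed

section \<open>Crossings of a closed curve of class C^2 with a nonvertical line\<close>

locale C2_curve =
  fixes g g' g'' :: "real \<Rightarrow> real^2" and C :: "(real^2) set"
  assumes deriv: "\<And>t. (g has_vector_derivative g' t) (at t)"
    and deriv2: "\<And>t. (g' has_vector_derivative g'' t) (at t)"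
    and cont2: "continuous_on UNIV g''"
    and regular: "\<And>t. g' t \<noteq> 0"
    and periodic: "\<And>t. g (t + 1) = g t"
    and simple: "simple_path g"
    and image: "path_image g = C"

lemma vec_nth_has_real_derivative:
  assumes "(f has_vector_derivative D) F"
  shows "((\<lambda>t. f t $ i) has_real_derivative D $ i) F"
  unfolding has_real_derivative_iff_has_vector_derivative
  by (rule bounded_linear.has_vector_derivative[OF bounded_linear_vec_nth assms])

text \<open>Nonvertical lines parametrized by abscissa, so that positions on the line are plain
  reals; Euclidean distance is sqrt (1 + m^2) times the difference of positions.\<close>

definition pt :: "real \<Rightarrow> real \<Rightarrow> real \<Rightarrow> real^2" where
  "pt m b x = vector [x, m * x + b]"

lemma pt_nth [simp]: "pt m b x $ 1 = x" "pt m b x $ 2 = m * x + b"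
  by (simp_all add: pt_def)

lemma pt_eqI: "p $ 2 - m * p $ 1 - b = 0 \<Longrightarrow> p = pt m b (p $ 1)"
  by (simp add: vec_eq_iff forall_2)

lemma pt_eq_iff [simp]: "pt m b x = pt m b y \<longleftrightarrow> x = y"
  by (metis pt_nth(1))

lemma continuous_pt [continuous_intros]: "continuous_on S (pt m b)"
proof -
  have "pt m b x = (0 + b *\<^sub>R axis 2 1) + x *\<^sub>R vector [1, m]" for x
    by (simp add: vec_eq_iff forall_2 axis_def)
  then have "pt m b = (\<lambda>x. (0 + b *\<^sub>R axis 2 1) + x *\<^sub>R vector [1, m])" by (rule ext)
  then show ?thesis by (auto intro!: continuous_intros)
qed

context C2_curve
begin

lemma periodic_int: "g (t + of_int k) = g t"
proof (induction k rule: int_induct[where k = 0])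
  case (step1 i) then show ?case using periodic[of "t + of_int i"] by (simp add: add.assoc)
next
  case (step2 i) then show ?case using periodic[of "t + of_int i - 1"] by (simp add: algebra_simps)
qed simp

lemma g_frac: "g (a + frac (t - a)) = g t"
  using periodic_int[of t "- \<lfloor>t - a\<rfloor>"] by (simp add: frac_def algebra_simps)

lemma g_eq_iff: "g s = g t \<longleftrightarrow> s - t \<in> \<int>"
proof
  assume "s - t \<in> \<int>"
  then obtain k where "s = t + of_int k" by (auto elim!: Ints_cases simp: algebra_simps)
  then show "g s = g t" by (simp add: periodic_int)
next
  assume "g s = g t"
  then have "g (frac s) = g (frac t)" using g_frac[of 0 s] g_frac[of 0 t] by simp
  \<comment> \<open>\<open>loop_free\<close> still allows the end points 0 and 1 to be identified;
    values of \<open>frac\<close> below 1 rule this out.\<close>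
  moreover have "frac s \<in> {0..1}" "frac t \<in> {0..1}" "frac s < 1" "frac t < 1"
    by (auto simp: frac_lt_1 less_imp_le)
  ultimately have "frac s = frac t"
    using simple unfolding simple_path_def loop_free_def by fastforce
  then have "s - t = of_int (\<lfloor>s\<rfloor> - \<lfloor>t\<rfloor>)" by (simp add: frac_def)
  then show "s - t \<in> \<int>" by (metis Ints_of_int)
qed

lemma range_g: "range g = C"
proof -
  have "g t \<in> g ` {0..1}" for t
    using g_frac[of 0 t] frac_lt_1[of t] by (metis add_0 atLeastAtMost_iff diff_zero frac_ge_0 imageI less_imp_le)
  then show ?thesis using image by (auto simp: path_image_def)
qed

text \<open>The period may start at any \<open>a\<close>: later it is chosen to end away from a
  given crossing, or to be centred at a given parameter.\<close>

lemma param: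
  assumes "p \<in> C"
  obtains s where "a \<le> s" "s < a + 1" "g s = p"
proof -
  obtain t where "g t = p" using assms range_g by auto
  then show ?thesis using that[of "a + frac (t - a)"] g_frac frac_lt_1[of "t - a"] by auto
qed

lemma cont_g: "continuous_on S g" and cont_g': "continuous_on S g'"
  using deriv deriv2 by (meson continuous_at_imp_continuous_on has_vector_derivative_continuous)+

text \<open>Vertical displacement of the curve from the line: its zeros are the incidences, and a
  zero shared with the derivative \<open>height'\<close> is a tangency.\<close>

definition height :: "real \<Rightarrow> real \<Rightarrow> real \<Rightarrow> real" where
  "height m b s = g s $ 2 - m * g s $ 1 - b"

definition height' :: "real \<Rightarrow> real \<Rightarrow> real" where
  "height' m s = g' s $ 2 - m * g' s $ 1"

lemma height_deriv: "(height m b has_real_derivative height' m s) (at s)"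
  unfolding height_def[abs_def] height'_def
  by (rule derivative_eq_intros vec_nth_has_real_derivative[OF deriv] refl)+ simp

lemma height_eq_0I: "g s = pt m b x \<Longrightarrow> height m b s = 0"
  by (simp add: height_def)

definition transversal :: "real \<Rightarrow> real \<Rightarrow> bool" where
  "transversal m b \<longleftrightarrow> (\<forall>s. height m b s = 0 \<longrightarrow> height' m s \<noteq> 0)"

definition crossings :: "real \<Rightarrow> real \<Rightarrow> real set" where
  "crossings m b = {x. pt m b x \<in> C}"

text \<open>Infinitely many zeros of \<open>height\<close> in a compact period would accumulate at a
  zero with vanishing derivative.\<close>

lemma finite_crossings:
  assumes "transversal m b"
  shows "finite (crossings m b)"
proof -
  define Z where "Z = {s\<in>{0..1}. height m b s = 0}"
  have "continuous_on {0..1} (height m b)"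
    using height_deriv by (meson DERIV_isCont continuous_at_imp_continuous_on)
  then have "closed Z" unfolding Z_def
    using continuous_closed_preimage_constant[of "{0..1}" "height m b" 0] by (simp add: vimage_def Int_def)
  then have Zc: "compact Z"
    using compact_Int_closed[of "{0..1}" Z] by (simp add: Z_def Int_def conj_ac)
  have "finite Z"
  proof (rule ccontr)
    assume "infinite Z"
    then obtain s where s: "s \<in> Z" "s islimpt Z"
      using Heine_Borel_imp_Bolzano_Weierstrass[OF Zc] by blast
    then have h: "height m b s = 0" "height' m s \<noteq> 0"
      using assms by (auto simp: Z_def transversal_def)
    have "((\<lambda>t. (height m b t - height m b s) / (t - s)) \<longlongrightarrow> height' m s) (at s)"
      using height_deriv by (simp add: has_field_derivative_iff)
    then have "\<forall>\<^sub>F t in at s. (height m b t - height m b s) / (t - s) \<noteq> 0"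
      using h by (intro tendsto_imp_eventually_ne)
    then have "\<forall>\<^sub>F t in at s. t \<notin> Z"
      by eventually_elim (auto simp: h Z_def)
    then show False using s(2) by (simp add: islimpt_iff_eventually)
  qed
  moreover have "crossings m b \<subseteq> (\<lambda>s. g s $ 1) ` Z"
  proof
    fix x assume "x \<in> crossings m b"
    then obtain s where "0 \<le> s" "s < 1" "g s = pt m b x"
      using param[of "pt m b x" 0] by (auto simp: crossings_def)
    then show "x \<in> (\<lambda>s. g s $ 1) ` Z"
      by (auto simp: Z_def height_eq_0I intro!: rev_image_eqI[of s])
  qed
  ultimately show ?thesis using finite_surj by blast
qed

end

locale separating_C2_curve = C2_curve + plane_separation
begin

text \<open>Near a transversal crossing, \<open>(s, \<tau>) \<mapsto> g s + \<tau> d\<close> (with \<open>d\<close> the direction of the line) is a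
  homeomorphism straightening the curve to \<open>\<tau> = 0\<close>. Both sides of the curve accumulate at the
  crossing point, so the two connected halves lie on different sides.\<close>

lemma crossing_flip:
  assumes tr: "transversal m b" and x: "x \<in> crossings m b"
  shows "\<exists>\<epsilon>>0. \<forall>a c. x - \<epsilon> < a \<longrightarrow> a < x \<longrightarrow> x < c \<longrightarrow> c < x + \<epsilon> \<longrightarrow> (pt m b a \<in> I) \<noteq> (pt m b c \<in> I)"
proof -
  obtain s0 where s0: "g s0 = pt m b x"
    using x param[of "pt m b x" 0] by (auto simp: crossings_def)
  then have "height m b s0 = 0" by (rule height_eq_0I)
  then have ne: "height' m s0 \<noteq> 0" using tr by (simp add: transversal_def)
  have "isCont (height' m) s0"
    unfolding height'_def[abs_def]
    using cont_g'[of UNIV] by (intro continuous_intros) (auto simp: continuous_on_eq_continuous_at)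
  then have "\<forall>\<^sub>F s in nhds s0. height' m s \<noteq> 0"
    using ne by (intro tendsto_imp_eventually_ne) (auto simp: continuous_at tendsto_at_iff_tendsto_nhds)
  then obtain d where d: "d > 0" "\<And>s. dist s s0 < d \<Longrightarrow> height' m s \<noteq> 0"
    by (auto simp: eventually_nhds_metric)
  \<comment> \<open>The bound 1/3 keeps \<delta> below 1/2, so that the complementary interval in
    the definition of \<open>K\<close> is nonempty and contains its right end point.\<close>
  define \<delta> where "\<delta> = min d (1/3)"
  have \<delta>: "\<delta> > 0" "\<delta> < 1/2" "\<And>s. \<bar>s - s0\<bar> < \<delta> \<Longrightarrow> height' m s \<noteq> 0"
    using d by (auto simp: \<delta>_def dist_real_def)
  have hinj: "s = t" if st: "\<bar>s - s0\<bar> < \<delta>" "\<bar>t - s0\<bar> < \<delta>" "height m b s = height m b t" for s t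
  proof -
    have False if "u < v" "\<bar>u - s0\<bar> < \<delta>" "\<bar>v - s0\<bar> < \<delta>" "height m b u = height m b v" for u v
    proof -
      obtain z where "u < z" "z < v" "height m b v - height m b u = (v - u) * height' m z"
        using MVT2[OF \<open>u < v\<close> height_deriv] by blast
      then have "height' m z = 0" "\<bar>z - s0\<bar> < \<delta>" using that by auto
      then show False using \<delta>(3) by blast
    qed
    then show ?thesis using st by (metis linorder_neqE)
  qed
  define e :: "real^2" where "e = vector [1, m]"
  define \<Psi> where "\<Psi> = (\<lambda>(s, \<tau>). g s + \<tau> *\<^sub>R e)"
  have \<Psi>c: "continuous_on S \<Psi>" for S
    unfolding \<Psi>_def case_prod_unfold
    by (intro continuous_intros continuous_on_compose2[OF cont_g[of UNIV]]) auto
  have \<Psi>inj: "s = s' \<and> \<tau> = \<tau>'"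
    if "\<bar>s - s0\<bar> < \<delta>" "\<bar>s' - s0\<bar> < \<delta>" "\<Psi> (s, \<tau>) = \<Psi> (s', \<tau>')" for s s' \<tau> \<tau>'
  proof -
    have c: "g s $ 1 + \<tau> = g s' $ 1 + \<tau>'" "g s $ 2 + \<tau> * m = g s' $ 2 + \<tau>' * m"
      using that(3) by (auto simp: \<Psi>_def e_def vec_eq_iff forall_2)
    have "m * g s $ 1 + \<tau> * m = m * g s' $ 1 + \<tau>' * m"
      using c(1) by (metis distrib_left mult.commute)
    then have "height m b s = height m b s'"
      unfolding height_def using c(2) by linarith
    then have "s = s'" using hinj that by blast
    then show ?thesis using c by simp
  qed
  \<comment> \<open>The rest of the curve, compact and not containing the crossing point; a small
    enough patch therefore meets the curve only in the nearby arc.\<close>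
  define K where "K = g ` {s0 + \<delta>..s0 + 1 - \<delta>}"
  have "compact K" unfolding K_def by (intro compact_continuous_image cont_g) auto
  then have "closed K" by (rule compact_imp_closed)
  have "\<Psi> (s0, 0) \<notin> K"
  proof
    assume "\<Psi> (s0, 0) \<in> K"
    then obtain s where s: "s0 + \<delta> \<le> s" "s \<le> s0 + 1 - \<delta>" "g s0 = g s"
      by (auto simp: K_def \<Psi>_def)
    then obtain k where k: "s0 - s = of_int k" using g_eq_iff by (auto elim: Ints_cases)
    then have "real_of_int (- 1) < real_of_int k" "real_of_int k < real_of_int 0" using s \<delta> by auto
    then show False unfolding of_int_less_iff by linarith
  qed
  moreover have "open (\<Psi> -` (- K))"
    using \<open>closed K\<close> \<Psi>c by (intro open_vimage) auto
  ultimately obtain A B where "open A" "open B" "(s0, 0) \<in> A \<times> B" "A \<times> B \<subseteq> \<Psi> -` (- K)"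
    by (elim open_prod_elim[where x = "(s0, 0)"]) auto
  then have AB: "open A" "open B" "s0 \<in> A" "0 \<in> B" "A \<times> B \<subseteq> \<Psi> -` (- K)" by auto
  obtain \<epsilon>1 where e1: "\<epsilon>1 > 0" "ball s0 \<epsilon>1 \<subseteq> A" using AB openE by blast
  obtain \<epsilon>2 where e2: "\<epsilon>2 > 0" "ball 0 \<epsilon>2 \<subseteq> B" using AB openE by blast
  define \<epsilon> where "\<epsilon> = min \<delta> (min \<epsilon>1 \<epsilon>2)"
  have eps: "\<epsilon> > 0" "\<epsilon> \<le> \<delta>" using e1 e2 \<delta> by (auto simp: \<epsilon>_def)
  define S where "S = {s0 - \<epsilon><..<s0 + \<epsilon>}"
  have S: "\<bar>s - s0\<bar> < \<delta>" if "s \<in> S" for s using that eps by (auto simp: S_def)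
  have notK: "\<Psi> (s, \<tau>) \<notin> K" if "s \<in> S" "\<bar>\<tau>\<bar> < \<epsilon>" for s \<tau>
  proof -
    have "s \<in> A" "\<tau> \<in> B" using that e1 e2 by (auto simp: S_def \<epsilon>_def dist_real_def subset_iff)
    then show ?thesis using AB by blast
  qed
  have notC: "\<Psi> (s, \<tau>) \<notin> C" if "s \<in> S" "\<bar>\<tau>\<bar> < \<epsilon>" "\<tau> \<noteq> 0" for s \<tau>
  proof
    assume "\<Psi> (s, \<tau>) \<in> C"
    then obtain t where t: "s0 - \<delta> \<le> t" "t < s0 - \<delta> + 1" "g t = \<Psi> (s, \<tau>)" using param by metis
    have "t \<notin> {s0 + \<delta>..s0 + 1 - \<delta>}" using t notK[OF that(1,2)] by (metis K_def imageI)
    then have "t < s0 + \<delta>" using t by auto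
    \<comment> \<open>The half-open period contains its left end, which is the same curve point as
      \<open>g (s0 + 1 - \<delta>)\<close> and hence belongs to \<open>K\<close>.\<close>
    moreover have "t \<noteq> s0 - \<delta>"
    proof
      assume "t = s0 - \<delta>"
      then have "s0 + 1 - \<delta> = t + 1" by simp
      then have "g (s0 + 1 - \<delta>) = \<Psi> (s, \<tau>)" using t(3) periodic[of t] by metis
      then show False using notK[OF that(1,2)] \<delta> by (auto simp: K_def intro!: rev_image_eqI[of "s0 + 1 - \<delta>"])
    qed
    ultimately have "\<bar>t - s0\<bar> < \<delta>" using t by auto
    moreover have "\<Psi> (t, 0) = \<Psi> (s, \<tau>)" using t(3) by (simp add: \<Psi>_def)
    ultimately show False using \<Psi>inj[of t s 0 \<tau>] S[OF that(1)] that(3) by auto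
  qed
  define U where "U = \<Psi> ` (S \<times> {-\<epsilon><..<\<epsilon>})"
  define Up where "Up = \<Psi> ` (S \<times> {0<..<\<epsilon>})"
  define Um where "Um = \<Psi> ` (S \<times> {-\<epsilon><..<0})"
  have U: "U - C \<subseteq> Up \<union> Um"
  proof
    fix p assume p: "p \<in> U - C"
    then obtain s \<tau> where st: "s \<in> S" "-\<epsilon> < \<tau>" "\<tau> < \<epsilon>" "p = \<Psi> (s, \<tau>)" by (auto simp: U_def)
    have "\<tau> \<noteq> 0" using st p range_g by (auto simp: \<Psi>_def)
    then show "p \<in> Up \<union> Um" using st by (cases "\<tau> > 0") (auto simp: Up_def Um_def)
  qed
  have conn: "connected (\<Psi> ` (S \<times> {u<..<v}))" for u v
    by (intro connected_continuous_image \<Psi>c convex_connected convex_Times) (auto simp: S_def)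
  have "Up \<inter> C = {}" "Um \<inter> C = {}" using notC by (auto simp: Up_def Um_def)
  then have side: "Up \<subseteq> I \<or> Up \<subseteq> V" "Um \<subseteq> I \<or> Um \<subseteq> V"
    using connected_same_side conn by (auto simp: Up_def Um_def)
  \<comment> \<open>Invariance of domain: continuity and injectivity of \<Psi> suffice, without
    differentiating an inverse.\<close>
  have "open U" unfolding U_def
  proof (rule invariance_of_domain_gen[OF _ \<Psi>c])
    show "open (S \<times> {-\<epsilon><..<\<epsilon>})" by (auto simp: S_def intro!: open_Times)
    show "inj_on \<Psi> (S \<times> {-\<epsilon><..<\<epsilon>})" using \<Psi>inj S unfolding inj_on_def by (metis SigmaE prod.inject)
  qed simp
  moreover have "pt m b x \<in> U"
    using eps s0 by (auto simp: U_def S_def \<Psi>_def intro!: rev_image_eqI[of "(s0, 0)"])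
  moreover have "pt m b x \<in> closure I" "pt m b x \<in> closure V"
    using x closure_I closure_V by (auto simp: crossings_def)
  ultimately have "U \<inter> I \<noteq> {}" "U \<inter> V \<noteq> {}"
    using open_Int_closure_eq_empty[of U I] open_Int_closure_eq_empty[of U V] by auto
  moreover have "U \<inter> I \<subseteq> Up \<union> Um" "U \<inter> V \<subseteq> Up \<union> Um" using U cover by auto
  \<comment> \<open>Off the curve the patch consists of two halves, each on one side. As the patch
    meets both sides, the halves cannot be on the same one.\<close>
  ultimately have diff: "(Up \<subseteq> I \<and> Um \<subseteq> V) \<or> (Up \<subseteq> V \<and> Um \<subseteq> I)"
    using side disjoint by blast
  have P: "pt m b y = \<Psi> (s0, y - x)" for y
    by (simp add: \<Psi>_def s0 e_def vec_eq_iff forall_2 algebra_simps)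
  show ?thesis
  proof (intro exI[of _ \<epsilon>] conjI allI impI)
    fix a c assume ac: "x - \<epsilon> < a" "a < x" "x < c" "c < x + \<epsilon>"
    have "s0 \<in> S" using eps by (auto simp: S_def)
    then have "pt m b a \<in> Um" "pt m b c \<in> Up"
      unfolding P using ac by (auto simp: Um_def Up_def)
    then show "(pt m b a \<in> I) \<noteq> (pt m b c \<in> I)" using diff disjoint by blast
  qed (rule eps)
qed

lemma opposite_iff_odd_crossings:
  assumes tr: "transversal m b" and "s < t" "s \<notin> crossings m b" "t \<notin> crossings m b"
  shows "opposite (pt m b s) (pt m b t) \<longleftrightarrow> odd (card (crossings m b \<inter> {s<..<t}))"
proof -
  have "(pt m b s \<in> I) = (pt m b t \<in> I) \<longleftrightarrow> even (card (crossings m b \<inter> {s<..<t}))"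
  proof (rule parity_of_flips[OF finite_crossings[OF tr] _ crossing_flip[OF tr] assms(2-4)])
    fix a c :: real assume ac: "a < c" "{a..c} \<inter> crossings m b = {}"
    have "connected (pt m b ` {a..c})" by (intro connected_continuous_image continuous_pt) simp
    moreover have "pt m b ` {a..c} \<inter> C = {}" using ac(2) by (auto simp: crossings_def)
    ultimately have "pt m b ` {a..c} \<subseteq> I \<or> pt m b ` {a..c} \<subseteq> V" by (rule connected_same_side)
    moreover have "pt m b a \<in> pt m b ` {a..c}" "pt m b c \<in> pt m b ` {a..c}" using ac by auto
    ultimately show "(pt m b a \<in> I) = (pt m b c \<in> I)" using disjoint by blast
  qed
  moreover have "pt m b s \<in> I \<union> V" "pt m b t \<in> I \<union> V"
    using assms cover by (auto simp: crossings_def)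
  ultimately show ?thesis using disjoint by (auto simp: opposite_def)
qed

end

section \<open>Alternating sums over points on a line\<close>

text \<open>The exponents run through 1, ..., card B, so the sum is -1 + 1 - 1 and so on; in the
  induction a new minimum leaves the other tails unchanged.\<close>

lemma alternating_tail_sum:
  fixes B :: "real set"
  assumes "finite B"
  shows "(\<Sum>x\<in>B. (-1) ^ card (B \<inter> {x..})) = (if odd (card B) then -1 else 0 :: real)"
  using assms
proof (induction B rule: finite_linorder_min_induct)
  case (insert b A)
  have "insert b A \<inter> {x..} = A \<inter> {x..}" if "x \<in> A" for x using insert that by force
  then have "(\<Sum>x\<in>A. (-1) ^ card (insert b A \<inter> {x..})) = (\<Sum>x\<in>A. (-1) ^ card (A \<inter> {x..}) :: real)"
    by (intro sum.cong) auto
  moreover have "insert b A \<inter> {b..} = insert b A" using insert by force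
  moreover have "b \<notin> A" using insert by force
  ultimately show ?case using insert by simp
qed simp

text \<open>A new maximum \<open>M\<close> adds the pairs (x, M), and these contribute minus the
  tail sum of \<open>B\<close>: 1 if \<open>card B\<close> is odd and 0 otherwise, which is the
  increment of the halved cardinality.\<close>

lemma alternating_pair_sum:
  fixes A :: "real set"
  assumes "finite A"
  shows "(\<Sum>(x, y)\<in>{(x, y). x \<in> A \<and> y \<in> A \<and> x < y}. (-1) ^ card (A \<inter> {x..y})) = real (card A div 2)"
  using assms
proof (induction A rule: finite_linorder_max_induct)
  case (insert M B)
  let ?P = "\<lambda>A. {(x, y). x \<in> A \<and> y \<in> A \<and> x < y}"
  have M: "M \<notin> B" using insert by force
  have fin: "finite (?P A)" if "finite A" for A :: "real set"
    by (rule finite_subset[of _ "A \<times> A"]) (use that in auto)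
  have P: "?P (insert M B) = ?P B \<union> (\<lambda>x. (x, M)) ` B" using insert by (auto dest: less_asym)
  have "?P B \<inter> (\<lambda>x. (x, M)) ` B = {}" using M by auto
  then have "(\<Sum>(x, y)\<in>?P (insert M B). (-1) ^ card (insert M B \<inter> {x..y}))
    = (\<Sum>(x, y)\<in>?P B. (-1) ^ card (insert M B \<inter> {x..y})) + (\<Sum>(x, y)\<in>(\<lambda>x. (x, M)) ` B. (-1) ^ card (insert M B \<inter> {x..y}) :: real)"
    unfolding P using insert by (intro sum.union_disjoint fin) auto
  also have "(\<Sum>(x, y)\<in>?P B. (-1) ^ card (insert M B \<inter> {x..y})) = (\<Sum>(x, y)\<in>?P B. (-1) ^ card (B \<inter> {x..y}) :: real)"
  proof (intro sum.cong refl, clarify)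
    fix x y assume "y \<in> B"
    then have "insert M B \<inter> {x..y} = B \<inter> {x..y}" using insert by force
    then show "(-1) ^ card (insert M B \<inter> {x..y}) = ((-1) ^ card (B \<inter> {x..y}) :: real)" by simp
  qed
  also have "(\<Sum>(x, y)\<in>(\<lambda>x. (x, M)) ` B. (-1) ^ card (insert M B \<inter> {x..y})) = (\<Sum>x\<in>B. - ((-1) ^ card (B \<inter> {x..})) :: real)"
  proof (subst sum.reindex, force intro: inj_onI, intro sum.cong refl, clarsimp)
    fix x assume x: "x \<in> B"
    then have "insert M B \<inter> {x..M} = insert M (B \<inter> {x..})" using insert by force
    then show "(-1) ^ card (insert M B \<inter> {x..M}) = - ((-1) ^ card (B \<inter> {x..}) :: real)"
      using insert M by simp
  qed
  also have "\<dots> = (if odd (card B) then 1 else 0)"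
    using alternating_tail_sum[OF insert(1)] by (simp add: sum_negf)
  finally show ?case
    using insert M by (auto simp: odd_Suc_div_two)
qed simp

lemma nn_integral_inverse_cube_atLeast:
  fixes s y :: real
  assumes "s < y"
  shows "(\<integral>\<^sup>+t. ennreal (1 / (t - s) ^ 3) * indicator {y..} t \<partial>lborel) = ennreal (1 / (2 * (y - s)\<^sup>2))"
proof -
  have "(\<integral>\<^sup>+t. ennreal (1 / (t - s) ^ 3) * indicator {y..} t \<partial>lborel)
      = ennreal (0 - (- (1 / (2 * (y - s)\<^sup>2))))"
  proof (rule nn_integral_FTC_atLeast)
    fix x assume "y \<le> x"
    then have "x - s > 0" using assms by simp
    then show "((\<lambda>t. - (1 / (2 * (t - s)\<^sup>2))) has_real_derivative 1 / (x - s) ^ 3) (at x)"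
      by (auto intro!: derivative_eq_intros simp: divide_simps) (simp add: algebra_simps power4_eq_xxxx power3_eq_cube)
    show "0 \<le> 1 / (x - s) ^ 3" using \<open>x - s > 0\<close> by simp
  qed (measurable, real_asymp)
  then show ?thesis by simp
qed

lemma nn_integral_inverse_square_atMost:
  fixes x y :: real
  assumes "x < y"
  shows "(\<integral>\<^sup>+s. ennreal (1 / (2 * (y - s)\<^sup>2)) * indicator {..x} s \<partial>lborel) = ennreal (1 / (2 * (y - x)))"
proof -
  have "(\<integral>\<^sup>+s. ennreal (1 / (2 * (y - s)\<^sup>2)) * indicator {..x} s \<partial>lborel)
      = (\<integral>\<^sup>+s. ennreal (1 / (2 * (y + s)\<^sup>2)) * indicator {-x..} s \<partial>lborel)"
    by (subst nn_integral_real_affine[where c = "-1" and t = 0])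
       (auto simp: indicator_def intro!: nn_integral_cong)
  also have "\<dots> = ennreal (0 - (- (1 / (2 * (y + (- x))))))"
  proof (rule nn_integral_FTC_atLeast)
    fix t assume "- x \<le> t"
    then have "y + t > 0" using assms by simp
    then show "((\<lambda>t. - (1 / (2 * (y + t)))) has_real_derivative 1 / (2 * (y + t)\<^sup>2)) (at t)"
      by (auto intro!: derivative_eq_intros simp: divide_simps) (simp add: power2_eq_square algebra_simps)
  qed (measurable, simp, real_asymp)
  finally show ?thesis by simp
qed

text \<open>The Bochner form allows these integrals to be added with the alternating signs as
  coefficients.\<close>

lemma has_bochner_integral_gap:
  fixes x y :: real
  assumes "x < y"
  shows "has_bochner_integral (lborel \<Otimes>\<^sub>M lborel)
    (\<lambda>(s, t). indicat_real {..x} s * indicat_real {y..} t / (t - s) ^ 3) (1 / (2 * (y - x)))"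
proof (rule has_bochner_integral_nn_integral)
  have "(\<integral>\<^sup>+p. ennreal (case p of (s, t) \<Rightarrow> indicat_real {..x} s * indicat_real {y..} t / (t - s) ^ 3) \<partial>(lborel \<Otimes>\<^sub>M lborel))
      = (\<integral>\<^sup>+s. \<integral>\<^sup>+t. ennreal (indicat_real {..x} s * indicat_real {y..} t / (t - s) ^ 3) \<partial>lborel \<partial>lborel)"
    by (subst lborel.nn_integral_fst[symmetric]) auto
  also have "\<dots> = (\<integral>\<^sup>+s. ennreal (1 / (2 * (y - s)\<^sup>2)) * indicator {..x} s \<partial>lborel)"
  proof (rule nn_integral_cong)
    fix s :: real
    show "(\<integral>\<^sup>+t. ennreal (indicat_real {..x} s * indicat_real {y..} t / (t - s) ^ 3) \<partial>lborel)
      = ennreal (1 / (2 * (y - s)\<^sup>2)) * indicator {..x} s"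
    proof (cases "s \<le> x")
      case True
      have "(\<integral>\<^sup>+t. ennreal (indicat_real {..x} s * indicat_real {y..} t / (t - s) ^ 3) \<partial>lborel)
        = (\<integral>\<^sup>+t. ennreal (1 / (t - s) ^ 3) * indicator {y..} t \<partial>lborel)"
        using True by (auto simp: indicator_def intro!: nn_integral_cong)
      then show ?thesis using nn_integral_inverse_cube_atLeast[of s y] True assms by simp
    qed simp
  qed
  also have "\<dots> = ennreal (1 / (2 * (y - x)))"
    by (rule nn_integral_inverse_square_atMost[OF assms])
  finally show "(\<integral>\<^sup>+p. ennreal (case p of (s, t) \<Rightarrow> indicat_real {..x} s * indicat_real {y..} t / (t - s) ^ 3) \<partial>(lborel \<Otimes>\<^sub>M lborel))
      = ennreal (1 / (2 * (y - x)))" .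
  show "AE p in lborel \<Otimes>\<^sub>M lborel. 0 \<le> (case p of (s, t) \<Rightarrow> indicat_real {..x} s * indicat_real {y..} t / (t - s) ^ 3)"
    using assms by (auto simp: indicator_def)
qed (use assms in \<open>auto\<close>)

text \<open>The alternating sum on one line with each unordered pair counted once and distances
  measured in abscissae.\<close>

definition gap_sum :: "real set \<Rightarrow> real" where
  "gap_sum X = (\<Sum>(x, y)\<in>{(x, y). x \<in> X \<and> y \<in> X \<and> x < y}. (-1) ^ card (X \<inter> {x..y}) / (y - x))"

text \<open>The number of points between \<open>s\<close> and \<open>t\<close> rounded down to an
  even number, that is, the number minus its parity. It vanishes for
  \<open>t \<le> s\<close>.\<close>

definition excess :: "real set \<Rightarrow> real \<Rightarrow> real \<Rightarrow> real" where
  "excess X s t = real (2 * (card (X \<inter> {s<..<t}) div 2))"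

text \<open>Only pairs with both points between \<open>s\<close> and \<open>t\<close> survive, and
  for these the exponent sees only points between \<open>s\<close> and \<open>t\<close>, so
  \<open>alternating_pair_sum\<close> applies. As \<open>s\<close> and \<open>t\<close> avoid
  \<open>X\<close>, the closed half-lines agree with the open interval in
  \<open>excess\<close>.\<close>

lemma excess_eq_sum:
  assumes "finite X" "s \<notin> X" "t \<notin> X"
  shows "excess X s t = (\<Sum>(x, y)\<in>{(x, y). x \<in> X \<and> y \<in> X \<and> x < y}.
     2 * (-1) ^ card (X \<inter> {x..y}) * (indicat_real {..x} s * indicat_real {y..} t))"
proof -
  let ?P = "\<lambda>A. {(x, y). x \<in> A \<and> y \<in> A \<and> x < y}"
  let ?Y = "X \<inter> {s<..<t}"
  have fin: "finite (?P X)"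
    by (rule finite_subset[of _ "X \<times> X"]) (use assms in auto)
  have sX: "s < x \<longleftrightarrow> s \<le> x" "x < t \<longleftrightarrow> x \<le> t" if "x \<in> X" for x
    using assms that by (auto simp: less_le)
  have "(\<Sum>(x, y)\<in>?P X. 2 * (-1) ^ card (X \<inter> {x..y}) * (indicat_real {..x} s * indicat_real {y..} t))
      = (\<Sum>(x, y)\<in>?P ?Y. 2 * (-1) ^ card (?Y \<inter> {x..y}))"
  proof (rule sum.mono_neutral_cong_right[OF fin])
    show "?P ?Y \<subseteq> ?P X" by auto
    show "\<forall>i\<in>?P X - ?P ?Y. (case i of (x, y) \<Rightarrow> 2 * (-1) ^ card (X \<inter> {x..y}) * (indicat_real {..x} s * indicat_real {y..} t)) = 0"
      by (auto simp: indicator_def dest: sX)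
    fix p assume "p \<in> ?P ?Y"
    then obtain x y where p: "p = (x, y)" "x \<in> ?Y" "y \<in> ?Y" "x < y" by auto
    then have "?Y \<inter> {x..y} = X \<inter> {x..y}" by auto
    then show "(case p of (x, y) \<Rightarrow> 2 * (-1) ^ card (X \<inter> {x..y}) * (indicat_real {..x} s * indicat_real {y..} t))
       = (case p of (x, y) \<Rightarrow> 2 * (-1) ^ card (?Y \<inter> {x..y}))"
      using p by simp
  qed
  also have "\<dots> = 2 * (\<Sum>(x, y)\<in>?P ?Y. (-1) ^ card (?Y \<inter> {x..y}))"
    by (simp add: sum_distrib_left case_prod_unfold)
  also have "\<dots> = 2 * real (card ?Y div 2)"
    using alternating_pair_sum[of ?Y] assms by simp
  finally show ?thesis by (simp add: excess_def)
qed

lemma measurable_excess [measurable]: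
  assumes "finite X"
  shows "(\<lambda>(s, t). excess X s t) \<in> borel_measurable (lborel \<Otimes>\<^sub>M lborel)"
proof -
  have "card (X \<inter> {s<..<t}) = (\<Sum>x\<in>X. of_bool (s < x \<and> x < t))" for s t
    using assms by (simp add: sum.If_cases of_bool_def Int_def conj_ac)
  then have "(\<lambda>(s, t). excess X s t) = (\<lambda>(s, t). real (2 * ((\<Sum>x\<in>X. if s < x \<and> x < t then 1 else 0) div 2)))"
    by (simp add: excess_def of_bool_def)
  also have "\<dots> \<in> borel_measurable (lborel \<Otimes>\<^sub>M lborel)" by measurable
  finally show ?thesis .
qed

lemma AE_lborel_notin_finite: "finite X \<Longrightarrow> AE x in lborel. (x::real) \<notin> X"
  by (intro AE_not_in finite_imp_null_set_lborel)

text \<open>Term by term integration of \<open>excess_eq_sum\<close>; the factor 2 there cancels the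
  1/2 of \<open>has_bochner_integral_gap\<close>. Nonnegativity of \<open>gap_sum\<close>, hidden by
  the signs, is inherited from the integrand.\<close>

lemma nn_integral_excess_half:
  assumes "finite X"
  shows "gap_sum X \<ge> 0" and
    "(\<integral>\<^sup>+p. (case p of (s, t) \<Rightarrow> ennreal (excess X s t / (t - s) ^ 3)) \<partial>(lborel \<Otimes>\<^sub>M lborel)) = ennreal (gap_sum X)"
proof -
  let ?P = "{(x, y). x \<in> X \<and> y \<in> X \<and> x < y}"
  define f where "f = (\<lambda>i::real\<times>real. (\<lambda>p. (2 * (-1) ^ card (X \<inter> {fst i..snd i})) *
     (case p of (s, t) \<Rightarrow> indicat_real {..fst i} s * indicat_real {snd i..} t / (t - s) ^ 3)))"
  have "has_bochner_integral (lborel \<Otimes>\<^sub>M lborel) (\<lambda>p. \<Sum>i\<in>?P. f i p)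
     (\<Sum>i\<in>?P. (2 * (-1) ^ card (X \<inter> {fst i..snd i})) * (1 / (2 * (snd i - fst i))))"
    unfolding f_def
    by (intro has_bochner_integral_sum has_bochner_integral_mult_right has_bochner_integral_gap) auto
  also have "(\<Sum>i\<in>?P. (2 * (-1) ^ card (X \<inter> {fst i..snd i})) * (1 / (2 * (snd i - fst i)))) = gap_sum X"
    unfolding gap_sum_def by (intro sum.cong) (auto simp: divide_simps)
  finally have hb: "has_bochner_integral (lborel \<Otimes>\<^sub>M lborel) (\<lambda>p. \<Sum>i\<in>?P. f i p) (gap_sum X)" .
  have AE: "AE p in lborel \<Otimes>\<^sub>M lborel. (\<Sum>i\<in>?P. f i p) = (case p of (s, t) \<Rightarrow> excess X s t / (t - s) ^ 3)"
  proof -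
    have [measurable]: "X \<in> sets borel"
      using assms by (intro borel_closed finite_imp_closed)
    have "{p \<in> space (lborel \<Otimes>\<^sub>M lborel). fst p \<notin> X \<and> snd p \<notin> X} \<in> sets (lborel \<Otimes>\<^sub>M lborel)"
      by measurable
    then have "AE p in lborel \<Otimes>\<^sub>M lborel. fst p \<notin> X \<and> snd p \<notin> X"
      using AE_lborel_notin_finite[OF assms]
      by (intro lborel_pair.AE_pair_measure) auto
    then show ?thesis
    proof eventually_elim
      case (elim p)
      obtain s t where p: "p = (s, t)" by fastforce
      have "(\<Sum>i\<in>?P. f i p) = (\<Sum>(x, y)\<in>?P. 2 * (-1) ^ card (X \<inter> {x..y}) * (indicat_real {..x} s * indicat_real {y..} t)) / (t - s) ^ 3"
        by (simp add: f_def p case_prod_unfold sum_divide_distrib)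
      then show ?case using excess_eq_sum[OF assms, of s t] elim p by simp
    qed
  qed
  have nn: "0 \<le> excess X s t / (t - s) ^ 3" for s t
    by (cases "s < t") (auto simp: excess_def)
  have AEn: "AE p in lborel \<Otimes>\<^sub>M lborel. 0 \<le> (\<Sum>i\<in>?P. f i p)"
    using AE by eventually_elim (simp add: nn case_prod_unfold)
  show "gap_sum X \<ge> 0"
    using integral_nonneg_AE[OF AEn] has_bochner_integral_integral_eq[OF hb] by simp
  have "(\<integral>\<^sup>+p. ennreal (\<Sum>i\<in>?P. f i p) \<partial>(lborel \<Otimes>\<^sub>M lborel)) = ennreal (gap_sum X)"
    using nn_integral_eq_integral[OF integrable.intros[OF hb] AEn] has_bochner_integral_integral_eq[OF hb] by simp
  moreover have "(\<integral>\<^sup>+p. ennreal (\<Sum>i\<in>?P. f i p) \<partial>(lborel \<Otimes>\<^sub>M lborel)) =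
    (\<integral>\<^sup>+p. (case p of (s, t) \<Rightarrow> ennreal (excess X s t / (t - s) ^ 3)) \<partial>(lborel \<Otimes>\<^sub>M lborel))"
    by (rule nn_integral_cong_AE) (use AE in \<open>eventually_elim, auto\<close>)
  ultimately show "(\<integral>\<^sup>+p. (case p of (s, t) \<Rightarrow> ennreal (excess X s t / (t - s) ^ 3)) \<partial>(lborel \<Otimes>\<^sub>M lborel)) = ennreal (gap_sum X)"
    by simp
qed

text \<open>The end points are an ordered pair here, so the two orders contribute equally; this is
  the factor 2.\<close>

lemma nn_integral_excess:
  assumes [simp]: "finite X"
  shows "(\<integral>\<^sup>+s. \<integral>\<^sup>+t. ennreal (excess X (min s t) (max s t) / \<bar>t - s\<bar> ^ 3) \<partial>lborel \<partial>lborel) = ennreal (2 * gap_sum X)"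
proof -
  have [measurable]: "(\<lambda>(s, t). excess X s t) \<in> borel_measurable (lborel \<Otimes>\<^sub>M lborel)"
    by (rule measurable_excess) simp
  let ?h = "\<lambda>s t. ennreal (excess X s t / (t - s) ^ 3)"
  have M: "(\<lambda>(s, t). ?h s t) \<in> borel_measurable (lborel \<Otimes>\<^sub>M lborel)"
    by measurable
  have M': "(\<lambda>(s, t). ?h t s) \<in> borel_measurable (lborel \<Otimes>\<^sub>M lborel)"
    by measurable
  have 0: "excess X s t = 0" if "t \<le> s" for s t
    using that by (simp add: excess_def)
  have split: "ennreal (excess X (min s t) (max s t) / \<bar>t - s\<bar> ^ 3) = ?h s t + ?h t s" for s t
    by (cases s t rule: linorder_cases) (auto simp: 0 abs_if)
  have half: "(\<integral>\<^sup>+s. \<integral>\<^sup>+t. ?h s t \<partial>lborel \<partial>lborel) = ennreal (gap_sum X)"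
    using lborel.nn_integral_fst[OF M] nn_integral_excess_half(2)[of X] by simp
  have half': "(\<integral>\<^sup>+s. \<integral>\<^sup>+t. ?h t s \<partial>lborel \<partial>lborel) = ennreal (gap_sum X)"
    using lborel_pair.Fubini'[OF M'] half by simp
  have "(\<integral>\<^sup>+s. \<integral>\<^sup>+t. ?h s t + ?h t s \<partial>lborel \<partial>lborel) =
     (\<integral>\<^sup>+s. \<integral>\<^sup>+t. ?h s t \<partial>lborel \<partial>lborel) + (\<integral>\<^sup>+s. \<integral>\<^sup>+t. ?h t s \<partial>lborel \<partial>lborel)"
    by (subst nn_integral_add[symmetric]) (auto intro!: nn_integral_cong nn_integral_add)
  then show ?thesis
    unfolding split half half' using nn_integral_excess_half(1)[of X] by (simp flip: ennreal_plus)
qed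

section \<open>Measures on pairs of points and on lines\<close>

definition vec2 :: "real \<Rightarrow> real \<Rightarrow> real^2" where "vec2 x y = vector [x, y]"

lemma vec2_nth [simp]: "vec2 x y $ 1 = x" "vec2 x y $ 2 = y"
  by (simp_all add: vec2_def)

lemma vec2_linear: "vec2 x y = x *\<^sub>R axis 1 1 + y *\<^sub>R axis 2 1"
  by (simp add: vec_eq_iff forall_2 axis_def)

lemma measurable_vec2 [measurable (raw)]:
  assumes [measurable]: "f \<in> borel_measurable M" "h \<in> borel_measurable M"
  shows "(\<lambda>x. vec2 (f x) (h x)) \<in> borel_measurable M"
  unfolding vec2_linear by measurable

lemma lborel_distr_vec2: "distr (lborel \<Otimes>\<^sub>M lborel) borel (\<lambda>(x, y). vec2 x y) = lborel"
proof (rule lborel_eqI[symmetric])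
  fix l u :: "real^2"
  assume le: "\<And>b. b \<in> Basis \<Longrightarrow> l \<bullet> b \<le> u \<bullet> b"
  have B: "(Basis :: (real^2) set) = {axis 1 1, axis 2 1}"
    by (auto simp: Basis_vec_def UNIV_2)
  have lu: "l $ 1 \<le> u $ 1" "l $ 2 \<le> u $ 2"
    using le[of "axis 1 1"] le[of "axis 2 1"] by (auto simp: B inner_axis)
  have ne: "axis 1 (1::real) \<noteq> (axis 2 1 :: real^2)" by (simp add: axis_eq_axis)
  have pre: "(\<lambda>(x, y). vec2 x y) -` box l u \<inter> space (lborel \<Otimes>\<^sub>M lborel) = {l$1<..<u$1} \<times> {l$2<..<u$2}"
    by (auto simp: mem_box_cart forall_2 space_pair_measure)
  have "emeasure (distr (lborel \<Otimes>\<^sub>M lborel) borel (\<lambda>(x, y). vec2 x y)) (box l u)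
     = emeasure (lborel \<Otimes>\<^sub>M lborel) ({l$1<..<u$1} \<times> {l$2<..<u$2})"
    by (subst emeasure_distr) (auto simp: pre)
  also have "\<dots> = ennreal (u$1 - l$1) * ennreal (u$2 - l$2)"
    using lu by (subst lborel.emeasure_pair_measure_Times) auto
  also have "\<dots> = ennreal (\<Prod>b\<in>Basis. (u - l) \<bullet> b)"
    using lu by (simp add: B ne inner_axis ennreal_mult)
  finally show "emeasure (distr (lborel \<Otimes>\<^sub>M lborel) borel (\<lambda>(x, y). vec2 x y)) (box l u)
     = ennreal (\<Prod>b\<in>Basis. (u - l) \<bullet> b)" .
qed simp

lemma nn_integral_vec2:
  fixes f :: "real^2 \<Rightarrow> ennreal"
  assumes [measurable]: "f \<in> borel_measurable borel"
  shows "(\<integral>\<^sup>+z. f z \<partial>lborel) = (\<integral>\<^sup>+x. \<integral>\<^sup>+y. f (vec2 x y) \<partial>lborel \<partial>lborel)"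
proof -
  have "(\<integral>\<^sup>+z. f z \<partial>lborel) = (\<integral>\<^sup>+p. f (case p of (x, y) \<Rightarrow> vec2 x y) \<partial>(lborel \<Otimes>\<^sub>M lborel))"
    by (subst lborel_distr_vec2[symmetric], subst nn_integral_distr) auto
  also have "\<dots> = (\<integral>\<^sup>+x. \<integral>\<^sup>+y. f (vec2 x y) \<partial>lborel \<partial>lborel)"
    by (subst lborel.nn_integral_fst[symmetric]) auto
  finally show ?thesis .
qed

lemma pt_vec2: "pt m b x = vec2 x (m * x + b)"
  by (simp add: pt_def vec2_def)

lemma measurable_pt [measurable (raw)]:
  assumes [measurable]: "m \<in> borel_measurable M" "b \<in> borel_measurable M" "x \<in> borel_measurable M"
  shows "(\<lambda>p. pt (m p) (b p) (x p)) \<in> borel_measurable M"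
  unfolding pt_vec2 by measurable

text \<open>The affine Blaschke--Petkantschin formula in slope-intercept coordinates.\<close>

lemma nn_integral_pairs_of_points:
  fixes F :: "(real^2) \<times> (real^2) \<Rightarrow> ennreal"
  assumes F: "F \<in> borel_measurable borel"
  shows "(\<integral>\<^sup>+p. F p \<partial>lborel) =
    (\<integral>\<^sup>+m. \<integral>\<^sup>+b. \<integral>\<^sup>+s. \<integral>\<^sup>+t. ennreal \<bar>t - s\<bar> * F (pt m b s, pt m b t) \<partial>lborel \<partial>lborel \<partial>lborel \<partial>lborel)"
proof -
  have F' [measurable]: "F \<in> borel_measurable (borel \<Otimes>\<^sub>M borel)" using F by (simp add: borel_prod)
  \<comment> \<open>The slope \<open>m\<close> replaces the second ordinate, with Jacobian |x2 -
    x1|; afterwards the intercept replaces the first ordinate by a shear of Jacobian 1.\<close>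
  define k where "k x1 y1 x2 m = ennreal \<bar>x2 - x1\<bar> * F (vec2 x1 y1, vec2 x2 (y1 + m * (x2 - x1)))" for x1 y1 x2 m
  have "(\<integral>\<^sup>+p. F p \<partial>lborel) = (\<integral>\<^sup>+z. \<integral>\<^sup>+w. F (z, w) \<partial>lborel \<partial>lborel)"
    unfolding lborel_prod[symmetric] by (subst lborel.nn_integral_fst[symmetric]) auto
  also have "\<dots> = (\<integral>\<^sup>+x1. \<integral>\<^sup>+y1. \<integral>\<^sup>+x2. \<integral>\<^sup>+y2. F (vec2 x1 y1, vec2 x2 y2) \<partial>lborel \<partial>lborel \<partial>lborel \<partial>lborel)"
    by (subst nn_integral_vec2, measurable) (rule nn_integral_cong, rule nn_integral_cong, rule nn_integral_vec2, measurable)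
  also have "\<dots> = (\<integral>\<^sup>+x1. \<integral>\<^sup>+y1. \<integral>\<^sup>+x2. \<integral>\<^sup>+m. k x1 y1 x2 m \<partial>lborel \<partial>lborel \<partial>lborel \<partial>lborel)"
  proof (rule nn_integral_cong, rule nn_integral_cong, rule nn_integral_cong_AE)
    fix x1 y1 :: real
    have "AE x2 in lborel. x2 \<noteq> x1" by (rule AE_lborel_singleton)
    then show "AE x2 in lborel. (\<integral>\<^sup>+y2. F (vec2 x1 y1, vec2 x2 y2) \<partial>lborel) = (\<integral>\<^sup>+m. k x1 y1 x2 m \<partial>lborel)"
    proof eventually_elim
      case (elim x2)
      have "(\<integral>\<^sup>+y2. F (vec2 x1 y1, vec2 x2 y2) \<partial>lborel) =
         ennreal \<bar>x2 - x1\<bar> * (\<integral>\<^sup>+m. F (vec2 x1 y1, vec2 x2 (y1 + (x2 - x1) * m)) \<partial>lborel)"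
        using elim by (intro nn_integral_real_affine) auto
      then show ?case unfolding k_def by (simp add: nn_integral_cmult mult.commute)
    qed
  qed
  also have "\<dots> = (\<integral>\<^sup>+x1. \<integral>\<^sup>+y1. \<integral>\<^sup>+m. \<integral>\<^sup>+x2. k x1 y1 x2 m \<partial>lborel \<partial>lborel \<partial>lborel \<partial>lborel)"
    unfolding k_def by (rule nn_integral_cong, rule nn_integral_cong, rule lborel_pair.Fubini'[symmetric]) measurable
  also have "\<dots> = (\<integral>\<^sup>+x1. \<integral>\<^sup>+m. \<integral>\<^sup>+y1. \<integral>\<^sup>+x2. k x1 y1 x2 m \<partial>lborel \<partial>lborel \<partial>lborel \<partial>lborel)"
    unfolding k_def by (rule nn_integral_cong, rule lborel_pair.Fubini'[symmetric]) measurable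
  also have "\<dots> = (\<integral>\<^sup>+x1. \<integral>\<^sup>+m. \<integral>\<^sup>+b. \<integral>\<^sup>+x2. k x1 (m * x1 + 1 * b) x2 m \<partial>lborel \<partial>lborel \<partial>lborel \<partial>lborel)"
  proof (rule nn_integral_cong, rule nn_integral_cong)
    fix x1 m :: real
    have "(\<integral>\<^sup>+y1. \<integral>\<^sup>+x2. k x1 y1 x2 m \<partial>lborel \<partial>lborel) =
      ennreal \<bar>1\<bar> * (\<integral>\<^sup>+b. \<integral>\<^sup>+x2. k x1 (m * x1 + 1 * b) x2 m \<partial>lborel \<partial>lborel)"
      unfolding k_def by (rule nn_integral_real_affine) auto
    then show "(\<integral>\<^sup>+y1. \<integral>\<^sup>+x2. k x1 y1 x2 m \<partial>lborel \<partial>lborel) =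
      (\<integral>\<^sup>+b. \<integral>\<^sup>+x2. k x1 (m * x1 + 1 * b) x2 m \<partial>lborel \<partial>lborel)" by simp
  qed
  also have "\<dots> = (\<integral>\<^sup>+m. \<integral>\<^sup>+x1. \<integral>\<^sup>+b. \<integral>\<^sup>+x2. k x1 (m * x1 + 1 * b) x2 m \<partial>lborel \<partial>lborel \<partial>lborel \<partial>lborel)"
    unfolding k_def by (rule lborel_pair.Fubini'[symmetric]) measurable
  also have "\<dots> = (\<integral>\<^sup>+m. \<integral>\<^sup>+b. \<integral>\<^sup>+x1. \<integral>\<^sup>+x2. k x1 (m * x1 + 1 * b) x2 m \<partial>lborel \<partial>lborel \<partial>lborel \<partial>lborel)"
    unfolding k_def by (rule nn_integral_cong, rule lborel_pair.Fubini'[symmetric]) measurable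
  also have "\<dots> = (\<integral>\<^sup>+m. \<integral>\<^sup>+b. \<integral>\<^sup>+s. \<integral>\<^sup>+t. ennreal \<bar>t - s\<bar> * F (pt m b s, pt m b t) \<partial>lborel \<partial>lborel \<partial>lborel \<partial>lborel)"
    by (intro nn_integral_cong) (simp add: k_def pt_vec2 algebra_simps)
  finally show ?thesis .
qed

text \<open>Substitution on compact intervals exhausting both sides, the limit being continuity from
  below of the measures with the given densities.\<close>

lemma nn_integral_arctan_substitution:
  fixes K :: "real \<Rightarrow> ennreal"
  assumes [measurable]: "K \<in> borel_measurable borel"
  shows "(\<integral>\<^sup>+\<theta>. K \<theta> * indicator {-(pi/2)<..<pi/2} \<theta> \<partial>lborel) = (\<integral>\<^sup>+m. K (arctan m) * ennreal (1 / (1 + m\<^sup>2)) \<partial>lborel)"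
proof -
  \<comment> \<open>The \<open>+ 1\<close> keeps the intervals nondegenerate also for
    \<open>n = 0\<close>.\<close>
  define A where "A n = {arctan (- (real n + 1))..arctan (real n + 1)}" for n
  define B where "B n = {- (real n + 1)..real n + 1}" for n
  have UA: "(\<Union>n. A n) = {-(pi/2)<..<pi/2}"
  proof (intro equalityI subsetI)
    fix \<theta> assume "\<theta> \<in> (\<Union>n. A n)"
    then obtain n where "arctan (- (real n + 1)) \<le> \<theta>" "\<theta> \<le> arctan (real n + 1)" by (auto simp: A_def)
    then show "\<theta> \<in> {-(pi/2)<..<pi/2}"
      using arctan_bounded[of "- (real n + 1)"] arctan_bounded[of "real n + 1"] by auto
  next
    fix \<theta> assume th: "\<theta> \<in> {-(pi/2)<..<pi/2}"
    obtain n where n: "\<bar>tan \<theta>\<bar> \<le> real n" using real_arch_simple by blast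
    have "arctan (tan \<theta>) = \<theta>" using th by (intro arctan_tan) auto
    moreover have "- (real n + 1) \<le> tan \<theta>" "tan \<theta> \<le> real n + 1" using n by auto
    ultimately have "\<theta> \<in> A n" unfolding A_def by (metis arctan_le_iff atLeastAtMost_iff)
    then show "\<theta> \<in> (\<Union>n. A n)" by blast
  qed
  have UB: "(\<Union>n. B n) = UNIV"
  proof -
    have "x \<in> (\<Union>n. B n)" for x
    proof -
      obtain n where "\<bar>x\<bar> \<le> real n" using real_arch_simple by blast
      then have "x \<in> B n" by (auto simp: B_def)
      then show ?thesis by blast
    qed
    then show ?thesis by auto
  qed
  have "incseq A" unfolding A_def by (intro monoI) (auto intro: order_trans simp: arctan_le_iff)
  have "incseq B" unfolding B_def by (intro monoI) auto
  have [measurable]: "A n \<in> sets borel" "B n \<in> sets borel" for n by (auto simp: A_def B_def)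
  have eq: "(\<integral>\<^sup>+\<theta>. K \<theta> * indicator (A n) \<theta> \<partial>lborel) = (\<integral>\<^sup>+m. K (arctan m) * ennreal (1 / (1 + m\<^sup>2)) * indicator (B n) m \<partial>lborel)" for n
    unfolding A_def B_def
    by (rule nn_integral_substitution_aux)
       (auto intro!: derivative_eq_intros continuous_intros simp: inverse_eq_divide add_nonneg_eq_0_iff)
  have "(\<integral>\<^sup>+\<theta>. K \<theta> * indicator {-(pi/2)<..<pi/2} \<theta> \<partial>lborel) = emeasure (density lborel K) (\<Union>n. A n)"
    unfolding UA by (subst emeasure_density) auto
  also have "\<dots> = (SUP n. emeasure (density lborel K) (A n))"
    by (rule SUP_emeasure_incseq[symmetric]) (use \<open>incseq A\<close> in auto)
  also have "\<dots> = (SUP n. emeasure (density lborel (\<lambda>m. K (arctan m) * ennreal (1 / (1 + m\<^sup>2)))) (B n))"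
    by (auto simp: emeasure_density eq)
  also have "\<dots> = emeasure (density lborel (\<lambda>m. K (arctan m) * ennreal (1 / (1 + m\<^sup>2)))) (\<Union>n. B n)"
    by (rule SUP_emeasure_incseq) (use \<open>incseq B\<close> in auto)
  also have "\<dots> = (\<integral>\<^sup>+m. K (arctan m) * ennreal (1 / (1 + m\<^sup>2)) \<partial>lborel)"
    unfolding UB by (subst emeasure_density) auto
  finally show ?thesis .
qed

text \<open>The line \<open>x\<^sub>1 cos \<phi> + x\<^sub>2 sin \<phi> = p\<close> has slope \<open>- cos \<phi> / sin \<phi>\<close> and intercept \<open>p / sin \<phi>\<close>.\<close>

lemma nn_integral_lines:
  fixes G :: "real \<times> real \<Rightarrow> ennreal"
  assumes G: "G \<in> borel_measurable borel"
  shows "(\<integral>\<^sup>+\<phi>. \<integral>\<^sup>+p. G (- cos \<phi> / sin \<phi>, p / sin \<phi>) * indicator {0..} p * indicator {0..<2*pi} \<phi> \<partial>lborel \<partial>lborel)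
    = (\<integral>\<^sup>+m. \<integral>\<^sup>+b. G (m, b) * ennreal (1 / sqrt (1 + m\<^sup>2) ^ 3) \<partial>lborel \<partial>lborel)"
proof -
  have G' [measurable]: "G \<in> borel_measurable (borel \<Otimes>\<^sub>M borel)" using G by (simp add: borel_prod)
  define s where "s \<phi> = - cos \<phi> / sin \<phi>" for \<phi> :: real
  have [measurable]: "s \<in> borel_measurable borel" unfolding s_def by measurable
  have [measurable]: "(tan :: real \<Rightarrow> real) \<in> borel_measurable borel" unfolding tan_def[abs_def] by measurable
  \<comment> \<open>For a given slope, angles in (0, pi) yield the intercepts
    \<open>b \<ge> 0\<close> and angles in (pi, 2 pi) those with \<open>b \<le> 0\<close>; together
    each nonvertical line is obtained once, up to a null set.\<close>
  define U where "U m = (\<integral>\<^sup>+b. G (m, b) * indicator {0..} b \<partial>lborel)" for m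
  define L where "L m = (\<integral>\<^sup>+b. G (m, b) * indicator {..0} b \<partial>lborel)" for m
  define K where "K m = (\<integral>\<^sup>+b. G (m, b) \<partial>lborel)" for m
  have [measurable]: "U \<in> borel_measurable borel" "L \<in> borel_measurable borel" "K \<in> borel_measurable borel"
    unfolding U_def L_def K_def by measurable
  have UL: "U m + L m = K m" for m
  proof -
    have "U m + L m = (\<integral>\<^sup>+b. G (m, b) * indicator {0..} b + G (m, b) * indicator {..0} b \<partial>lborel)"
      unfolding U_def L_def by (subst nn_integral_add) auto
    also have "\<dots> = K m"
      unfolding K_def
    proof (rule nn_integral_cong_AE)
      show "AE b in lborel. G (m, b) * indicator {0..} b + G (m, b) * indicator {..0} b = G (m, b)"
        using AE_lborel_singleton[of "0::real"] by eventually_elim (auto simp: indicator_def)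
    qed
    finally show ?thesis .
  qed
  have inner: "(\<integral>\<^sup>+p. G (s \<phi>, p / sin \<phi>) * indicator {0..} p \<partial>lborel) =
      ennreal \<bar>sin \<phi>\<bar> * (if sin \<phi> > 0 then U (s \<phi>) else L (s \<phi>))" if "sin \<phi> \<noteq> 0" for \<phi>
  proof -
    have "(\<integral>\<^sup>+p. G (s \<phi>, p / sin \<phi>) * indicator {0..} p \<partial>lborel) =
      ennreal \<bar>sin \<phi>\<bar> * (\<integral>\<^sup>+b. G (s \<phi>, (0 + sin \<phi> * b) / sin \<phi>) * indicator {0..} (0 + sin \<phi> * b) \<partial>lborel)"
      by (rule nn_integral_real_affine) (use that in auto)
    also have "(\<integral>\<^sup>+b. G (s \<phi>, (0 + sin \<phi> * b) / sin \<phi>) * indicator {0..} (0 + sin \<phi> * b) \<partial>lborel)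
      = (if sin \<phi> > 0 then U (s \<phi>) else L (s \<phi>))"
      unfolding U_def L_def using that
      by (auto intro!: nn_integral_cong simp: indicator_def zero_le_mult_iff)
    finally show ?thesis .
  qed
  have "(\<integral>\<^sup>+\<phi>. \<integral>\<^sup>+p. G (- cos \<phi> / sin \<phi>, p / sin \<phi>) * indicator {0..} p * indicator {0..<2*pi} \<phi> \<partial>lborel \<partial>lborel)
    = (\<integral>\<^sup>+\<phi>. (\<integral>\<^sup>+p. G (s \<phi>, p / sin \<phi>) * indicator {0..} p \<partial>lborel) * indicator {0..<2*pi} \<phi> \<partial>lborel)"
    unfolding s_def by (rule nn_integral_cong, rule nn_integral_multc) measurable
  also have "\<dots> = (\<integral>\<^sup>+\<phi>. ennreal (sin \<phi>) * U (s \<phi>) * indicator {0<..<pi} \<phi> +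
       ennreal (- sin \<phi>) * L (s \<phi>) * indicator {pi<..<2*pi} \<phi> \<partial>lborel)"
  proof (rule nn_integral_cong_AE)
    have "AE \<phi> in lborel. \<phi> \<notin> {0, pi}" by (intro AE_not_in finite_imp_null_set_lborel) auto
    then show "AE \<phi> in lborel. (\<integral>\<^sup>+p. G (s \<phi>, p / sin \<phi>) * indicator {0..} p \<partial>lborel) * indicator {0..<2*pi} \<phi> =
       ennreal (sin \<phi>) * U (s \<phi>) * indicator {0<..<pi} \<phi> + ennreal (- sin \<phi>) * L (s \<phi>) * indicator {pi<..<2*pi} \<phi>"
    proof eventually_elim
      case (elim \<phi>)
      consider "0 < \<phi>" "\<phi> < pi" | "pi < \<phi>" "\<phi> < 2 * pi" | "\<phi> \<notin> {0..<2*pi}" "\<phi> \<notin> {0<..<pi}" "\<phi> \<notin> {pi<..<2*pi}"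
        using elim pi_gt_zero by (cases "\<phi> < 0"; cases "\<phi> < pi"; cases "\<phi> < 2 * pi"; auto simp: not_less le_less)
      then show ?case
      proof cases
        case 1
        then have "sin \<phi> > 0" by (rule sin_gt_zero)
        then show ?thesis using 1 inner[of \<phi>] by simp
      next
        case 2
        then have "sin \<phi> < 0" by (intro sin_lt_zero) auto
        then show ?thesis using 2 inner[of \<phi>] by simp
      qed simp
    qed
  qed
  also have "\<dots> = (\<integral>\<^sup>+\<phi>. ennreal (sin \<phi>) * U (s \<phi>) * indicator {0<..<pi} \<phi> \<partial>lborel) +
       (\<integral>\<^sup>+\<phi>. ennreal (- sin \<phi>) * L (s \<phi>) * indicator {pi<..<2*pi} \<phi> \<partial>lborel)"
    by (rule nn_integral_add) auto
  also have "(\<integral>\<^sup>+\<phi>. ennreal (- sin \<phi>) * L (s \<phi>) * indicator {pi<..<2*pi} \<phi> \<partial>lborel) =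
      (\<integral>\<^sup>+\<phi>. ennreal (sin \<phi>) * L (s \<phi>) * indicator {0<..<pi} \<phi> \<partial>lborel)"
    by (subst nn_integral_real_affine[where c = 1 and t = pi])
       (auto intro!: nn_integral_cong simp: s_def indicator_def)
  also have "(\<integral>\<^sup>+\<phi>. ennreal (sin \<phi>) * U (s \<phi>) * indicator {0<..<pi} \<phi> \<partial>lborel) + \<dots> =
      (\<integral>\<^sup>+\<phi>. ennreal (sin \<phi>) * K (s \<phi>) * indicator {0<..<pi} \<phi> \<partial>lborel)"
    by (subst nn_integral_add[symmetric]) (auto intro!: nn_integral_cong simp: UL[symmetric] algebra_simps)
  \<comment> \<open>Shifting the angle by pi/2 turns the slope into tan \<theta> and the weight sin
    \<phi> into cos \<theta>.\<close>
  also have "\<dots> = (\<integral>\<^sup>+\<theta>. ennreal (cos \<theta>) * K (tan \<theta>) * indicator {-(pi/2)<..<pi/2} \<theta> \<partial>lborel)"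
    by (subst nn_integral_real_affine[where c = 1 and t = "pi/2"])
       (auto intro!: nn_integral_cong simp: s_def indicator_def sin_add cos_add tan_def)
  also have "\<dots> = (\<integral>\<^sup>+m. ennreal (cos (arctan m)) * K (tan (arctan m)) * ennreal (1 / (1 + m\<^sup>2)) \<partial>lborel)"
    by (rule nn_integral_arctan_substitution) measurable
  also have "\<dots> = (\<integral>\<^sup>+m. K m * ennreal (1 / sqrt (1 + m\<^sup>2) ^ 3) \<partial>lborel)"
  proof (intro nn_integral_cong)
    fix m :: real
    have "cos (arctan m) * (1 / (1 + m\<^sup>2)) = 1 / sqrt (1 + m\<^sup>2) ^ 3"
      by (simp add: cos_arctan power3_eq_cube add_nonneg_nonneg)
    then have "ennreal (cos (arctan m)) * ennreal (1 / (1 + m\<^sup>2)) = ennreal (1 / sqrt (1 + m\<^sup>2) ^ 3)"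
      by (subst ennreal_mult''[symmetric]) simp_all
    then show "ennreal (cos (arctan m)) * K (tan (arctan m)) * ennreal (1 / (1 + m\<^sup>2)) = K m * ennreal (1 / sqrt (1 + m\<^sup>2) ^ 3)"
      by (simp add: tan_arctan mult_ac)
  qed
  also have "\<dots> = (\<integral>\<^sup>+m. \<integral>\<^sup>+b. G (m, b) * ennreal (1 / sqrt (1 + m\<^sup>2) ^ 3) \<partial>lborel \<partial>lborel)"
    unfolding K_def by (rule nn_integral_cong, rule nn_integral_multc[symmetric]) measurable
  finally show ?thesis .
qed

section \<open>Lines meeting two arcs of the curve\<close>

definition normal :: "real \<Rightarrow> real^2" where "normal \<phi> = vec2 (cos \<phi>) (sin \<phi>)"

lemma inner_normal: "x \<bullet> normal \<phi> = x$1 * cos \<phi> + x$2 * sin \<phi>"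
  by (simp add: normal_def inner_vec_def sum_2)

lemma norm_normal [simp]: "norm (normal \<phi>) = 1"
  using inner_normal[of "normal \<phi>" \<phi>]
  by (simp add: normal_def norm_eq_sqrt_inner power2_eq_square[symmetric])

lemma continuous_on_normal [continuous_intros]:
  fixes f :: "'a::t2_space \<Rightarrow> real"
  shows "continuous_on S f \<Longrightarrow> continuous_on S (\<lambda>x. normal (f x))"
  unfolding normal_def vec2_linear by (intro continuous_intros continuous_on_cos continuous_on_sin)

text \<open>For positive y the half angle is at most pi/4, below pi/3, so the cosine in the mean
  value theorem is at least 1/2.\<close>

lemma abs_sin_ge:
  assumes "\<bar>y\<bar> \<le> pi / 2"
  shows "\<bar>y\<bar> / 4 \<le> \<bar>sin y\<bar>"
proof -
  have pos: "y / 4 \<le> sin y" if "0 < y" "y \<le> pi / 2" for y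
  proof -
    have "\<exists>z>0. z < y / 2 \<and> sin (y / 2) - sin 0 = (y / 2 - 0) * cos z"
      by (rule MVT2) (use that in auto)
    then obtain z where z: "0 < z" "z < y / 2" "sin (y / 2) - sin 0 = (y / 2 - 0) * cos z"
      by blast
    have "cos (pi / 3) \<le> cos z" using z that by (intro cos_monotone_0_pi_le) auto
    then have "(y / 2) * (1 / 2) \<le> (y / 2) * cos z" using that by (intro mult_left_mono) (auto simp: cos_60)
    also have "\<dots> = sin (y / 2)" using z by simp
    also have "\<dots> \<le> sin y" using that by (intro sin_monotone_2pi_le) auto
    finally show ?thesis by simp
  qed
  show ?thesis
    using pos[of "\<bar>y\<bar>"] assms by (cases "y = 0"; cases "y > 0") auto
qed

text \<open>With \<open>v\<close> at angle \<alpha> the inner product is |v| cos (\<phi> -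
  \<alpha>), so \<phi> is within \<open>r\<close> = 4 \<epsilon> / |v| of a zero of the cosine. Five
  zeros are relevant, each with an interval of length 2 r, whence 40.\<close>

lemma emeasure_nearly_orthogonal_directions:
  fixes v :: "real^2"
  assumes v: "v \<noteq> 0" and e: "0 \<le> \<epsilon>"
  shows "emeasure lborel {\<phi>\<in>{0..2*pi}. \<bar>v \<bullet> normal \<phi>\<bar> \<le> \<epsilon>} \<le> ennreal (40 * \<epsilon> / norm v)"
proof -
  have nv: "norm v > 0" using v by simp
  have "(v$1 / norm v)\<^sup>2 + (v$2 / norm v)\<^sup>2 = 1"
    using nv by (simp add: power_divide add_divide_distrib[symmetric])
      (simp add: norm_vec_def L2_set_def sum_2 sum_power2_ge_zero)
  then obtain \<alpha> where a: "0 \<le> \<alpha>" "\<alpha> < 2 * pi" "v$1 / norm v = cos \<alpha>" "v$2 / norm v = sin \<alpha>"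
    by (rule sincos_total_2pi)
  have vi: "v \<bullet> normal \<phi> = norm v * cos (\<phi> - \<alpha>)" for \<phi>
    using nv unfolding inner_normal cos_diff a(3,4)[symmetric] by (simp add: field_simps)
  define r where "r = 4 * \<epsilon> / norm v"
  have r: "r \<ge> 0" using e by (simp add: r_def)
  define B where "B k = {\<alpha> + of_int k * pi + pi / 2 - r..\<alpha> + of_int k * pi + pi / 2 + r}" for k :: int
  have sub: "{\<phi>\<in>{0..2*pi}. \<bar>v \<bullet> normal \<phi>\<bar> \<le> \<epsilon>} \<subseteq> (\<Union>k\<in>{-2..2}. B k)"
  proof safe
    fix \<phi> assume p: "\<phi> \<in> {0..2*pi}" "\<bar>v \<bullet> normal \<phi>\<bar> \<le> \<epsilon>"
    define k where "k = \<lfloor>(\<phi> - \<alpha>) / pi\<rfloor>"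
    have k: "of_int k * pi \<le> \<phi> - \<alpha>" "\<phi> - \<alpha> < (of_int k + 1) * pi"
      unfolding k_def using pi_gt_zero by (auto simp: pos_le_divide_eq[symmetric] pos_divide_less_eq[symmetric])
    \<comment> \<open>Since \<phi> and \<alpha> lie in a period, \<phi> - \<alpha> is between -2 pi
      and 2 pi.\<close>
    have "-2 \<le> k"
      unfolding k_def using p a pi_gt_zero by (auto simp: le_floor_iff field_simps)
    moreover have "k \<le> 2"
      unfolding k_def using p a pi_gt_zero by (auto simp: floor_le_iff field_simps)
    moreover have "\<phi> \<in> B k"
    proof -
      define y where "y = \<phi> - \<alpha> - of_int k * pi - pi / 2"
      have y: "\<bar>y\<bar> \<le> pi / 2" using k unfolding y_def distrib_right by linarith
      have s0: "sin (of_int k * pi) = 0" using sin_zero_iff_int2 by blast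
      have c1: "\<bar>cos (of_int k * pi)\<bar> = 1"
        using sin_cos_squared_add[of "of_int k * pi"] s0 by (simp add: abs_square_eq_1)
      have "\<phi> - \<alpha> = (y + pi / 2) + of_int k * pi" by (simp add: y_def)
      then have "\<bar>cos (\<phi> - \<alpha>)\<bar> = \<bar>cos (y + pi / 2)\<bar>"
        using s0 c1 by (simp only: cos_add[of "y + pi/2" "of_int k * pi"]) (simp add: abs_mult)
      also have "\<dots> = \<bar>sin y\<bar>" by (simp add: cos_add)
      finally have "norm v * \<bar>sin y\<bar> \<le> \<epsilon>"
        using p(2) nv by (simp add: vi abs_mult)
      moreover have "norm v * (\<bar>y\<bar> / 4) \<le> norm v * \<bar>sin y\<bar>"
        by (intro mult_left_mono abs_sin_ge y) simp
      ultimately have "norm v * (\<bar>y\<bar> / 4) \<le> \<epsilon>" by linarith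
      then have "\<bar>y\<bar> \<le> r" using nv by (simp add: r_def field_simps)
      then show ?thesis by (auto simp: B_def y_def abs_le_iff)
    qed
    ultimately show "\<phi> \<in> (\<Union>k\<in>{-2..2}. B k)" by auto
  qed
  have "emeasure lborel {\<phi>\<in>{0..2*pi}. \<bar>v \<bullet> normal \<phi>\<bar> \<le> \<epsilon>} \<le> emeasure lborel (\<Union>k\<in>{-2..2}. B k)"
    by (intro emeasure_mono sub) (auto simp: B_def)
  also have "\<dots> \<le> (\<Sum>k\<in>{-2..2}. emeasure lborel (B k))"
    by (intro emeasure_subadditive_finite) (auto simp: B_def)
  also have "\<dots> = (\<Sum>k\<in>{-2..2::int}. ennreal (2 * r))"
    using r by (intro sum.cong) (auto simp: B_def)
  also have "\<dots> = ennreal (5 * (2 * r))"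
    using r by (simp add: ennreal_mult')
  also have "5 * (2 * r) = 40 * \<epsilon> / norm v" by (simp add: r_def)
  finally show ?thesis .
qed

section \<open>Difference quotients of the curve\<close>

context C2_curve
begin

text \<open>The difference quotient of \<open>g\<close>, written as an average of \<open>g'\<close>
  so that it extends across \<open>s = t\<close> and inherits the regularity of
  \<open>g'\<close>.\<close>

definition chord :: "real \<Rightarrow> real \<Rightarrow> real^2" where
  "chord s t = integral {0..1} (\<lambda>u. g' (s + u * (t - s)))"

lemma chord_same [simp]: "chord s s = g' s"
  by (simp add: chord_def)

lemma integrable_chord: "(\<lambda>u. g' (s + u * (t - s))) integrable_on {0..1}"
  by (intro integrable_continuous_interval continuous_on_compose2[OF cont_g'[of UNIV]] continuous_intros) auto

lemma chord_eq: "g t - g s = (t - s) *\<^sub>R chord s t"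
proof -
  have "((\<lambda>u. (t - s) *\<^sub>R g' (s + u * (t - s))) has_integral (g (s + 1 * (t - s)) - g (s + 0 * (t - s)))) {0..1}"
  proof (rule fundamental_theorem_of_calculus)
    fix u :: real
    have 1: "((\<lambda>u. s + u * (t - s)) has_vector_derivative (t - s)) (at u)"
      by (auto simp: has_real_derivative_iff_has_vector_derivative[symmetric] intro!: derivative_eq_intros)
    have "((g \<circ> (\<lambda>u. s + u * (t - s))) has_vector_derivative (t - s) *\<^sub>R g' (s + u * (t - s))) (at u)"
      by (rule vector_diff_chain_at[OF 1 deriv])
    then show "((\<lambda>u. g (s + u * (t - s))) has_vector_derivative (t - s) *\<^sub>R g' (s + u * (t - s))) (at u within {0..1})"
      by (simp add: comp_def has_vector_derivative_at_within)
  qed simp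
  from integral_unique[OF this] show ?thesis by (simp add: chord_def)
qed

lemma continuous_chord: "continuous_on UNIV (\<lambda>(s, t). chord s t)"
proof -
  have "continuous_on UNIV (\<lambda>x. integral (cbox 0 1) (\<lambda>u. g' (fst x + u * (snd x - fst x))))"
    by (rule integral_continuous_on_param)
       (auto simp: case_prod_unfold intro!: continuous_on_compose2[OF cont_g'[of UNIV]] continuous_intros)
  then show ?thesis by (simp add: chord_def case_prod_unfold)
qed

text \<open>The constant is a bound for \<open>g''\<close>; this is where the second derivative
  enters the estimate of the energy. The interval leaves room around the parameters of all cells
  used later.\<close>

lemma chord_lipschitz:
  obtains M where "M > 0"
    "\<And>s t s' t'. s \<in> {-2..3} \<Longrightarrow> t \<in> {-2..3} \<Longrightarrow> s' \<in> {-2..3} \<Longrightarrow> t' \<in> {-2..3} \<Longrightarrow>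
       norm (chord s t - chord s' t') \<le> M * (\<bar>s - s'\<bar> + \<bar>t - t'\<bar>)"
proof -
  have "compact (g'' ` {-2..3})"
    by (intro compact_continuous_image continuous_on_subset[OF cont2]) auto
  then obtain M where M: "M > 0" "\<And>t. t \<in> {-2..3} \<Longrightarrow> norm (g'' t) \<le> M"
    using compact_imp_bounded bounded_pos by (metis imageI)
  have lip: "norm (g' x - g' y) \<le> M * norm (x - y)" if "x \<in> {-2..3}" "y \<in> {-2..3}" for x y
  proof (rule differentiable_bound[of "{-2..3}"])
    fix z :: real assume "z \<in> {-2..3}"
    show "(g' has_derivative (\<lambda>h. h *\<^sub>R g'' z)) (at z within {-2..3})"
      using deriv2[of z] unfolding has_vector_derivative_def by (rule has_derivative_at_withinI)
    show "onorm (\<lambda>h. h *\<^sub>R g'' z) \<le> M"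
      using M(2)[OF \<open>z \<in> {-2..3}\<close>] by (intro onorm_bound) (auto simp: mult.commute[of M] M(1) less_imp_le intro!: mult_left_mono)
  qed (use that in auto)
  have "norm (chord s t - chord s' t') \<le> M * (\<bar>s - s'\<bar> + \<bar>t - t'\<bar>)"
    if st: "s \<in> {-2..3}" "t \<in> {-2..3}" "s' \<in> {-2..3}" "t' \<in> {-2..3}" for s t s' t'
  proof -
    have seg: "s + u * (t - s) \<in> {-2..3}" if "s \<in> {-2..3}" "t \<in> {-2..3}" "u \<in> {0..1}" for s t u :: real
    proof -
      have "(1 - u) *\<^sub>R s + u *\<^sub>R t \<in> {-2..3}"
        using that by (intro convexD_alt) auto
      then show ?thesis by (simp add: algebra_simps)
    qed
    have "chord s t - chord s' t' = integral {0..1} (\<lambda>u. g' (s + u * (t - s)) - g' (s' + u * (t' - s')))"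
      unfolding chord_def by (intro integral_diff[symmetric] integrable_chord)
    also have "norm \<dots> \<le> integral {0..1} (\<lambda>u::real. M * (\<bar>s - s'\<bar> + \<bar>t - t'\<bar>))"
    proof (rule integral_norm_bound_integral)
      fix u :: real assume u: "u \<in> {0..1}"
      have "norm (g' (s + u * (t - s)) - g' (s' + u * (t' - s'))) \<le> M * norm ((s + u * (t - s)) - (s' + u * (t' - s')))"
        by (intro lip seg st u)
      also have "(s + u * (t - s)) - (s' + u * (t' - s')) = (1 - u) * (s - s') + u * (t - t')"
        by (simp add: algebra_simps)
      also have "norm \<dots> \<le> (1 - u) * \<bar>s - s'\<bar> + u * \<bar>t - t'\<bar>"
        using u by (intro order_trans[OF norm_triangle_ineq]) (simp add: abs_mult)
      also have "\<dots> \<le> 1 * \<bar>s - s'\<bar> + 1 * \<bar>t - t'\<bar>"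
        using u by (intro add_mono mult_right_mono) auto
      finally show "norm (g' (s + u * (t - s)) - g' (s' + u * (t' - s'))) \<le> M * (\<bar>s - s'\<bar> + \<bar>t - t'\<bar>)"
        using M(1) by (simp add: mult_left_mono)
    qed (auto intro!: integrable_diff integrable_chord)
    finally show ?thesis by simp
  qed
  then show ?thesis using that M(1) by blast
qed

text \<open>Compactness, once \<open>chord\<close> is known not to vanish: on the diagonal by
  regularity, off it because parameters less than 1 apart give distinct points. The bound 3/4 is
  half a period plus room for rounding to cells.\<close>

lemma chord_lower_bound:
  obtains c where "c > 0" "\<And>s t. s \<in> {-1..2} \<Longrightarrow> t \<in> {-1..2} \<Longrightarrow> \<bar>t - s\<bar> \<le> 3/4 \<Longrightarrow> c \<le> norm (chord s t)"
proof -
  define S where "S = ({-1..2} \<times> {-1..2}) \<inter> {(s, t). \<bar>t - s\<bar> \<le> (3/4::real)}"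
  have "closed {(s, t). \<bar>t - s\<bar> \<le> (3/4::real)}"
    unfolding case_prod_unfold by (intro closed_Collect_le continuous_intros)
  then have "compact S" unfolding S_def by (intro compact_Int_closed compact_Times) auto
  moreover have "(0, 0) \<in> S" by (simp add: S_def)
  moreover have "continuous_on S (\<lambda>(s, t). norm (chord s t))"
    using continuous_on_subset[OF continuous_chord, of S]
    unfolding case_prod_unfold by (intro continuous_on_norm) simp
  ultimately obtain p where p: "p \<in> S" "\<And>q. q \<in> S \<Longrightarrow> (\<lambda>(s, t). norm (chord s t)) p \<le> (\<lambda>(s, t). norm (chord s t)) q"
    using continuous_attains_inf by (metis (no_types, lifting) empty_iff)
  obtain s0 t0 where st: "p = (s0, t0)" by fastforce
  have "chord s0 t0 \<noteq> 0"
  proof (cases "s0 = t0")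
    case False
    have "s0 - t0 \<notin> \<int>"
    proof
      assume "s0 - t0 \<in> \<int>"
      then obtain k where k: "s0 - t0 = of_int k" by (auto elim: Ints_cases)
      have "\<bar>s0 - t0\<bar> \<le> 3/4" using p(1) st by (simp add: S_def abs_minus_commute)
      then have "\<bar>k\<bar> < 1" unfolding k by linarith
      then show False using k False by simp
    qed
    then have "g s0 \<noteq> g t0" by (simp add: g_eq_iff)
    then show ?thesis using chord_eq[of t0 s0] by auto
  qed (simp add: regular)
  then show ?thesis
    using p st by (intro that[of "norm (chord s0 t0)"]) (auto simp: S_def)
qed

end

lemma finite_real_set_separated:
  fixes V :: "real set"
  assumes finV: "finite V"
  obtains \<delta> where "\<delta> > 0" "\<And>a b. a \<in> V \<Longrightarrow> b \<in> V \<Longrightarrow> a \<noteq> b \<Longrightarrow> \<delta> \<le> \<bar>a - b\<bar>"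
proof -
  \<comment> \<open>The element 1 covers the case of fewer than two points.\<close>
  define D where "D = insert 1 ((\<lambda>(a, b). \<bar>a - b\<bar>) ` {(a, b). a \<in> V \<and> b \<in> V \<and> a \<noteq> b})"
  have "finite {(a, b). a \<in> V \<and> b \<in> V \<and> a \<noteq> b}"
    by (rule finite_subset[of _ "V \<times> V"]) (use finV in auto)
  then have D: "finite D" "D \<noteq> {}" by (auto simp: D_def)
  have "Min D > 0" using D by (subst Min_gr_iff) (auto simp: D_def)
  moreover have "Min D \<le> \<bar>a - b\<bar>" if "a \<in> V" "b \<in> V" "a \<noteq> b" for a b
    using D that by (intro Min_le) (auto simp: D_def)
  ultimately show ?thesis using that by blast
qed

definition cell :: "nat \<Rightarrow> int \<Rightarrow> real set" where
  "cell n j = {of_int j / real n..(of_int j + 1) / real n}"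

text \<open>The first cell lies in one period and the second within about half a period of it,
  without reduction modulo \<open>n\<close>, so that |k - j| / n measures the distance along the
  shorter arc. The \<open>+ 2\<close> is the rounding error of two floors.\<close>

definition cell_pairs :: "nat \<Rightarrow> (int \<times> int) set" where
  "cell_pairs n = {(j, k). 0 \<le> j \<and> j < int n \<and> j \<noteq> k \<and> 2 * \<bar>k - j\<bar> \<le> int n + 2}"

lemma floor_in_cell: "n > 0 \<Longrightarrow> x \<in> cell n \<lfloor>real n * x\<rfloor>"
  unfolding cell_def by (auto simp: divide_le_eq le_divide_eq mult.commute)

lemma cell_pairs_bound:
  assumes "n \<ge> 2"
  shows "finite (cell_pairs n)" "card (cell_pairs n) \<le> 4 * n\<^sup>2"
proof -
  have sub: "cell_pairs n \<subseteq> {0..<int n} \<times> {- int n..2 * int n}"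
    using assms by (auto simp: cell_pairs_def abs_if split: if_splits)
  then show fin: "finite (cell_pairs n)" by (rule finite_subset) auto
  have "card (cell_pairs n) \<le> card ({0..<int n} \<times> {- int n..2 * int n})"
    by (intro card_mono sub) auto
  also have "\<dots> = n * (3 * n + 1)" using assms by (simp add: nat_add_distrib nat_mult_distrib)
  also have "\<dots> \<le> 4 * n\<^sup>2" using assms by (simp add: power2_eq_square algebra_simps)
  finally show "card (cell_pairs n) \<le> 4 * n\<^sup>2" .
qed

context C2_curve
begin

text \<open>Lines meeting both arcs \<open>g ` cell n j\<close> and \<open>g ` cell n k\<close>; orthogonality to the chord, rather than
  a second incidence, excludes the shared end point of adjacent cells.\<close>

definition meets :: "nat \<Rightarrow> int \<Rightarrow> int \<Rightarrow> (real \<times> real) set" where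
  "meets n j k = {(\<phi>, p). \<phi> \<in> {0..2*pi} \<and>
     (\<exists>s\<in>cell n j. \<exists>t\<in>cell n k. g s \<bullet> normal \<phi> = p \<and> chord s t \<bullet> normal \<phi> = 0)}"

text \<open>Projection of a closed set along the compact square of parameters.\<close>

lemma closed_meets: "closed (meets n j k)"
proof -
  define T where "T = {x :: (real \<times> real) \<times> (real \<times> real). g (fst (fst x)) \<bullet> normal (fst (snd x)) = snd (snd x)}
     \<inter> {x. chord (fst (fst x)) (snd (fst x)) \<bullet> normal (fst (snd x)) = 0} \<inter> (UNIV \<times> ({0..2*pi} \<times> UNIV))"
  have c: "continuous_on UNIV (\<lambda>x :: (real \<times> real) \<times> (real \<times> real). chord (fst (fst x)) (snd (fst x)))"
    using continuous_on_compose2[OF continuous_chord, of UNIV "\<lambda>x :: (real \<times> real) \<times> (real \<times> real). fst x"]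
    by (simp add: case_prod_unfold continuous_on_fst)
  have "closed T"
    unfolding T_def
    by (intro closed_Int closed_Collect_eq closed_Times continuous_intros c
        continuous_on_compose2[OF cont_g[of UNIV]]) auto
  then have "closed {y. \<exists>x. x \<in> cell n j \<times> cell n k \<and> (x, y) \<in> T}"
    by (intro closed_compact_projection) (auto simp: cell_def intro!: compact_Times)
  also have "{y. \<exists>x. x \<in> cell n j \<times> cell n k \<and> (x, y) \<in> T} = meets n j k"
    by (auto simp: meets_def T_def; blast)
  finally show ?thesis .
qed

text \<open>Both factors come from the Lipschitz bound for \<open>chord\<close>. The normal of such
  a line is orthogonal to some chord between the two cells, hence nearly orthogonal to the fixed
  chord \<open>q\<close>: directions of measure O(1/N). For a fixed direction, moving along the
  first arc by 1/N changes the offset at a rate O(d/N) only, as the chord within the arc differs by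
  O(d/N) from the one orthogonal to the normal.\<close>

lemma emeasure_meets:
  assumes M: "M > 0"
    "\<And>s t s' t'. s \<in> {-2..3} \<Longrightarrow> t \<in> {-2..3} \<Longrightarrow> s' \<in> {-2..3} \<Longrightarrow> t' \<in> {-2..3} \<Longrightarrow>
       norm (chord s t - chord s' t') \<le> M * (\<bar>s - s'\<bar> + \<bar>t - t'\<bar>)"
    and c: "c > 0" "\<And>s t. s \<in> {-1..2} \<Longrightarrow> t \<in> {-1..2} \<Longrightarrow> \<bar>t - s\<bar> \<le> 3/4 \<Longrightarrow> c \<le> norm (chord s t)"
    and n: "n \<ge> 8" and jk: "(j, k) \<in> cell_pairs n"
  shows "emeasure (lborel \<Otimes>\<^sub>M lborel) (meets n j k) \<le> ennreal (320 * M\<^sup>2 * of_int \<bar>k - j\<bar> / (c * real n ^ 3))"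
proof -
  define N where "N = real n"
  have N: "N \<ge> 8" using n by (simp add: N_def)
  define d where "d = real_of_int \<bar>k - j\<bar>"
  have jk': "0 \<le> j" "j < int n" "j \<noteq> k" "2 * \<bar>k - j\<bar> \<le> int n + 2" using jk by (auto simp: cell_pairs_def)
  have "1 \<le> \<bar>k - j\<bar>" using jk' by auto
  then have d1: "1 \<le> d" unfolding d_def by linarith
  have "real_of_int (2 * \<bar>k - j\<bar>) \<le> real_of_int (int n + 2)" using jk' of_int_le_iff by blast
  then have d2: "2 * d \<le> N + 2" by (simp add: d_def N_def)
  have dd: "of_int k - of_int j \<le> d" "of_int j - of_int k \<le> (d::real)" unfolding d_def by auto
  have j: "0 \<le> real_of_int j" "real_of_int j \<le> N - 1" using jk' unfolding N_def by auto
  have cellj: "of_int j / N \<le> s \<and> s \<le> (of_int j + 1) / N \<and> 0 \<le> s \<and> s \<le> 1" if "s \<in> cell n j" for s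
  proof -
    have 1: "of_int j / N \<le> s" "s \<le> (of_int j + 1) / N" using that by (auto simp: cell_def N_def)
    have "0 \<le> of_int j / N" using j N by auto
    moreover have "(of_int j + 1) / N \<le> 1" using j N by simp
    ultimately show ?thesis using 1 by linarith
  qed
  have near: "\<bar>t - s\<bar> \<le> (d + 1) / N" if "s \<in> cell n j" "t \<in> cell n k" for s t
  proof -
    have "of_int j \<le> s * N" "s * N \<le> of_int j + 1" "of_int k \<le> t * N" "t * N \<le> of_int k + 1"
      using that N by (auto simp: cell_def N_def divide_le_eq le_divide_eq)
    then have "\<bar>t * N - s * N\<bar> \<le> d + 1" using dd by linarith
    then have "\<bar>t - s\<bar> * N \<le> d + 1" using N by (simp add: left_diff_distrib[symmetric] abs_mult)
    then show ?thesis using N by (simp add: le_divide_eq)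
  qed
  \<comment> \<open>Here \<open>n \<ge> 8\<close> enters: (d + 1) / N is at most 1/2 + 2/N.\<close>
  have dN: "(d + 1) / N \<le> 3/4" using d2 N by (simp add: divide_le_eq)
  have cellk: "-1 \<le> t \<and> t \<le> 2" if "t \<in> cell n k" for t
  proof -
    have "of_int j / N \<in> cell n j" using N by (auto simp: cell_def N_def divide_right_mono)
    from near[OF this that] cellj[OF this] dN show ?thesis by linarith
  qed
  have lower: "of_int j / N \<in> cell n j" "of_int k / N \<in> cell n k"
    using N by (auto simp: cell_def N_def divide_right_mono)
  have width: "\<bar>s - s'\<bar> \<le> 1 / N" if "s \<in> cell n i" "s' \<in> cell n i" for s s' i
    using that by (auto simp: cell_def N_def abs_le_iff add_divide_distrib)
  define q where "q = chord (of_int j / N) (of_int k / N)"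
  have "c \<le> norm q" unfolding q_def
    using cellj[OF lower(1)] cellk[OF lower(2)] order_trans[OF near[OF lower] dN] by (intro c(2)) auto
  then have q: "c \<le> norm q" "q \<noteq> 0" using c(1) by auto
  define \<Phi> where "\<Phi> = {\<phi>\<in>{0..2*pi}. \<bar>q \<bullet> normal \<phi>\<bar> \<le> 2 * M / N}"
  have "closed \<Phi>"
  proof -
    have "closed ({0..2*pi} \<inter> {\<phi>. \<bar>q \<bullet> normal \<phi>\<bar> \<le> 2 * M / N})"
      by (intro closed_Int closed_Collect_le continuous_intros)
    then show ?thesis by (simp add: \<Phi>_def Int_def)
  qed
  then have [measurable]: "\<Phi> \<in> sets borel" by auto
  have inner: "\<bar>x \<bullet> normal \<phi>\<bar> \<le> norm x" for x \<phi>
    using Cauchy_Schwarz_ineq2[of x "normal \<phi>"] by simp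
  \<comment> \<open>The factor 2 absorbs d + 1, which is at most 2 d as distinct cells have
    \<open>d \<ge> 1\<close>.\<close>
  define r where "r = 2 * M * d / N\<^sup>2"
  have r: "r \<ge> 0" using M d1 by (simp add: r_def)
  have slice: "emeasure lborel (Pair \<phi> -` meets n j k) \<le> ennreal (2 * r) * indicator \<Phi> \<phi>" for \<phi>
  proof (cases "Pair \<phi> -` meets n j k = {}")
    case False
    then obtain p0 where "(\<phi>, p0) \<in> meets n j k" by auto
    then obtain s1 t1 where st: "\<phi> \<in> {0..2*pi}" "s1 \<in> cell n j" "t1 \<in> cell n k"
      "g s1 \<bullet> normal \<phi> = p0" "chord s1 t1 \<bullet> normal \<phi> = 0"
      by (auto simp: meets_def)
    have "\<bar>q \<bullet> normal \<phi>\<bar> = \<bar>(q - chord s1 t1) \<bullet> normal \<phi>\<bar>" using st by (simp add: inner_diff_left)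
    also have "\<dots> \<le> norm (q - chord s1 t1)" by (rule inner)
    also have "\<dots> \<le> M * (\<bar>of_int j / N - s1\<bar> + \<bar>of_int k / N - t1\<bar>)"
      unfolding q_def using cellj cellk lower st by (intro M(2)) force+
    also have "\<dots> \<le> M * (1 / N + 1 / N)"
      using M(1) width[OF lower(1) st(2)] width[OF lower(2) st(3)] by (intro mult_left_mono add_mono) auto
    finally have "\<phi> \<in> \<Phi>" using st by (simp add: \<Phi>_def mult.commute)
    have "Pair \<phi> -` meets n j k \<subseteq> {p0 - r..p0 + r}"
    proof
      fix p assume "p \<in> Pair \<phi> -` meets n j k"
      then obtain s2 where s2: "s2 \<in> cell n j" "g s2 \<bullet> normal \<phi> = p" by (auto simp: meets_def)
      have "p - p0 = (s2 - s1) * (chord s1 s2 \<bullet> normal \<phi>)"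
        using chord_eq[of s2 s1] s2 st by (metis inner_diff_left inner_scaleR_left)
      also have "chord s1 s2 \<bullet> normal \<phi> = (chord s1 s2 - chord s1 t1) \<bullet> normal \<phi>"
        using st by (simp add: inner_diff_left)
      finally have "\<bar>p - p0\<bar> = \<bar>s2 - s1\<bar> * \<bar>(chord s1 s2 - chord s1 t1) \<bullet> normal \<phi>\<bar>"
        by (simp add: abs_mult)
      also have "\<dots> \<le> (1 / N) * (M * ((d + 1) / N))"
      proof (intro mult_mono)
        show "\<bar>s2 - s1\<bar> \<le> 1 / N" using width s2 st by blast
        have "\<bar>(chord s1 s2 - chord s1 t1) \<bullet> normal \<phi>\<bar> \<le> norm (chord s1 s2 - chord s1 t1)" by (rule inner)
        also have "\<dots> \<le> M * (\<bar>s1 - s1\<bar> + \<bar>s2 - t1\<bar>)"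
          using cellj cellk s2 st by (intro M(2)) force+
        also have "\<dots> \<le> M * ((d + 1) / N)"
          using near[OF s2(1) st(3)] M(1) by (intro mult_left_mono) (auto simp: abs_minus_commute)
        finally show "\<bar>(chord s1 s2 - chord s1 t1) \<bullet> normal \<phi>\<bar> \<le> M * ((d + 1) / N)" .
      qed (use N in auto)
      also have "\<dots> = M * (d + 1) / N\<^sup>2" by (simp add: power2_eq_square)
      also have "\<dots> \<le> r" unfolding r_def using d1 M(1) by (intro divide_right_mono) auto
      finally show "p \<in> {p0 - r..p0 + r}" by auto
    qed
    then have "emeasure lborel (Pair \<phi> -` meets n j k) \<le> emeasure lborel {p0 - r..p0 + r}"
      by (intro emeasure_mono) auto
    then show ?thesis using \<open>\<phi> \<in> \<Phi>\<close> r by simp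
  qed simp
  have "meets n j k \<in> sets (lborel \<Otimes>\<^sub>M lborel)"
    unfolding lborel_prod using borel_closed[OF closed_meets] by simp
  then have "emeasure (lborel \<Otimes>\<^sub>M lborel) (meets n j k) = (\<integral>\<^sup>+\<phi>. emeasure lborel (Pair \<phi> -` meets n j k) \<partial>lborel)"
    by (rule lborel.emeasure_pair_measure_alt)
  also have "\<dots> \<le> (\<integral>\<^sup>+\<phi>. ennreal (2 * r) * indicator \<Phi> \<phi> \<partial>lborel)"
    by (intro nn_integral_mono slice)
  also have "\<dots> = ennreal (2 * r) * emeasure lborel \<Phi>"
    by (subst nn_integral_cmult_indicator) auto
  also have "\<dots> \<le> ennreal (2 * r) * ennreal (40 * (2 * M / N) / norm q)"
    unfolding \<Phi>_def using M(1) N q by (intro mult_left_mono emeasure_nearly_orthogonal_directions) auto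
  also have "\<dots> \<le> ennreal (2 * r) * ennreal (40 * (2 * M / N) / c)"
    using M(1) N q c(1) by (intro mult_left_mono ennreal_leI divide_left_mono) auto
  also have "\<dots> = ennreal (2 * r * (40 * (2 * M / N) / c))"
    using r M N c by (intro ennreal_mult[symmetric]) auto
  also have "2 * r * (40 * (2 * M / N) / c) = 320 * M\<^sup>2 * d / (c * N ^ 3)"
    using N c by (simp add: r_def field_simps power2_eq_square power3_eq_cube)
  finally show ?thesis by (simp add: d_def N_def)
qed

text \<open>A discretized sum of inverse distances over pairs of points on one line, with n / |k -
  j| as inverse parameter distance; the factor 2 pays for rounding.\<close>

definition energy :: "nat \<Rightarrow> real \<times> real \<Rightarrow> ennreal" where
  "energy n x = (\<Sum>(j, k)\<in>cell_pairs n. ennreal (2 * real n / of_int \<bar>k - j\<bar>) * indicator (meets n j k) x)"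

lemma measurable_energy [measurable]: "energy n \<in> borel_measurable borel"
proof -
  have [measurable]: "meets n j k \<in> sets borel" for j k using closed_meets by auto
  show ?thesis unfolding energy_def case_prod_unfold by measurable
qed

text \<open>The weight 1 / |k - j| cancels the factor |k - j| of \<open>emeasure_meets\<close>: each
  of at most 4 n^2 pairs contributes at most 640 M^2 / (c n^2).\<close>

lemma energy_bounded:
  obtains B where "\<And>n. n \<ge> 8 \<Longrightarrow> (\<integral>\<^sup>+x. energy n x \<partial>lborel) \<le> ennreal B"
proof -
  obtain M where M: "M > 0"
    "\<And>s t s' t'. s \<in> {-2..3} \<Longrightarrow> t \<in> {-2..3} \<Longrightarrow> s' \<in> {-2..3} \<Longrightarrow> t' \<in> {-2..3} \<Longrightarrow>
       norm (chord s t - chord s' t') \<le> M * (\<bar>s - s'\<bar> + \<bar>t - t'\<bar>)"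
    by (rule chord_lipschitz) (rule that, assumption, blast)
  obtain c where c: "c > 0" "\<And>s t. s \<in> {-1..2} \<Longrightarrow> t \<in> {-1..2} \<Longrightarrow> \<bar>t - s\<bar> \<le> 3/4 \<Longrightarrow> c \<le> norm (chord s t)"
    by (rule chord_lower_bound) (rule that, assumption, blast)
  have [measurable]: "meets n j k \<in> sets borel" for n j k using closed_meets by auto
  have "(\<integral>\<^sup>+x. energy n x \<partial>lborel) \<le> ennreal (2560 * M\<^sup>2 / c)" if n: "n \<ge> 8" for n
  proof -
    have "(\<integral>\<^sup>+x. energy n x \<partial>lborel) =
       (\<Sum>i\<in>cell_pairs n. ennreal (2 * real n / of_int \<bar>snd i - fst i\<bar>) * emeasure lborel (meets n (fst i) (snd i)))"
      unfolding energy_def case_prod_unfold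
      by (subst nn_integral_sum) (auto simp: nn_integral_cmult_indicator)
    also have "\<dots> \<le> (\<Sum>i\<in>cell_pairs n. ennreal (640 * M\<^sup>2 / (c * (real n)\<^sup>2)))"
    proof (rule sum_mono)
      fix i assume i: "i \<in> cell_pairs n"
      define d where "d = real_of_int \<bar>snd i - fst i\<bar>"
      have d: "d > 0" using i by (auto simp: d_def cell_pairs_def)
      have "emeasure lborel (meets n (fst i) (snd i)) \<le> ennreal (320 * M\<^sup>2 * d / (c * real n ^ 3))"
        unfolding d_def using emeasure_meets[OF M c n, of "fst i" "snd i"] i by (simp add: lborel_prod)
      then have "ennreal (2 * real n / d) * emeasure lborel (meets n (fst i) (snd i)) \<le>
          ennreal (2 * real n / d) * ennreal (320 * M\<^sup>2 * d / (c * real n ^ 3))"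
        by (rule mult_left_mono) simp
      also have "\<dots> = ennreal (2 * real n / d * (320 * M\<^sup>2 * d / (c * real n ^ 3)))"
        using M c d by (intro ennreal_mult[symmetric]) auto
      also have "2 * real n / d * (320 * M\<^sup>2 * d / (c * real n ^ 3)) = 640 * M\<^sup>2 / (c * (real n)\<^sup>2)"
        using d c n by (simp add: field_simps power2_eq_square power3_eq_cube)
      finally show "ennreal (2 * real n / of_int \<bar>snd i - fst i\<bar>) * emeasure lborel (meets n (fst i) (snd i))
         \<le> ennreal (640 * M\<^sup>2 / (c * (real n)\<^sup>2))" by (simp add: d_def)
    qed
    also have "\<dots> = ennreal (real (card (cell_pairs n)) * (640 * M\<^sup>2 / (c * (real n)\<^sup>2)))"
      using c(1) by (subst ennreal_mult) (auto simp: ennreal_of_nat_eq_real_of_nat)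
    also have "\<dots> \<le> ennreal (2560 * M\<^sup>2 / c)"
    proof (rule ennreal_leI)
      have "real (card (cell_pairs n)) \<le> real (4 * n\<^sup>2)"
        using cell_pairs_bound(2)[of n] n by (intro of_nat_mono) simp
      then have "real (card (cell_pairs n)) * (640 * M\<^sup>2 / (c * (real n)\<^sup>2)) \<le> 4 * (real n)\<^sup>2 * (640 * M\<^sup>2 / (c * (real n)\<^sup>2))"
        using c by (intro mult_right_mono) auto
      also have "\<dots> = 2560 * M\<^sup>2 / c" using n by simp
      finally show "real (card (cell_pairs n)) * (640 * M\<^sup>2 / (c * (real n)\<^sup>2)) \<le> 2560 * M\<^sup>2 / c" .
    qed
    finally show ?thesis .
  qed
  then show ?thesis by (rule that)
qed

text \<open>Once 1/n is at most the separation \<delta> of the parameters, distinct parameters fall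
  into distinct cells. Distinct pairs of points then occupy distinct pairs of cells, and each term
  is dominated by its weight. How large \<open>n\<close> must be depends on the line, hence the
  liminf.\<close>

lemma line_energy_le_liminf:
  assumes c: "c > 0" "\<And>s t. s \<in> {-1..2} \<Longrightarrow> t \<in> {-1..2} \<Longrightarrow> \<bar>t - s\<bar> \<le> 3/4 \<Longrightarrow> c \<le> norm (chord s t)"
    and \<phi>: "\<phi> \<in> {0..2*pi}" and fin: "finite Z" and Z: "Z \<subseteq> C" "\<And>x. x \<in> Z \<Longrightarrow> x \<bullet> normal \<phi> = p"
  shows "ennreal (c * (\<Sum>(x, y)\<in>{(x, y). x \<in> Z \<and> y \<in> Z \<and> x \<noteq> y}. 1 / norm (y - x))) \<le> liminf (\<lambda>n. energy n (\<phi>, p))"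
proof -
  let ?P = "{(x, y). x \<in> Z \<and> y \<in> Z \<and> x \<noteq> y}"
  have finP: "finite ?P" by (rule finite_subset[of _ "Z \<times> Z"]) (use fin in auto)
  have "\<forall>x\<in>Z. \<exists>s. 0 \<le> s \<and> s < 1 \<and> g s = x"
  proof
    fix x assume "x \<in> Z"
    then have "x \<in> C" using Z by auto
    then show "\<exists>s. 0 \<le> s \<and> s < 1 \<and> g s = x" using param[of x 0] by auto
  qed
  then obtain s where s: "\<And>x. x \<in> Z \<Longrightarrow> 0 \<le> s x" "\<And>x. x \<in> Z \<Longrightarrow> s x < 1" "\<And>x. x \<in> Z \<Longrightarrow> g (s x) = x"
    by metis
  \<comment> \<open>The second point receives a parameter depending on the first one, within half a
    period of it; this makes the cell pair admissible and \<open>c\<close> applicable.\<close>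
  have "\<forall>i\<in>?P. \<exists>t. s (fst i) - 1/2 \<le> t \<and> t < s (fst i) + 1/2 \<and> g t = snd i"
  proof
    fix i assume "i \<in> ?P"
    then have "snd i \<in> C" using Z by auto
    then obtain u where "s (fst i) - 1/2 \<le> u" "u < s (fst i) - 1/2 + 1" "g u = snd i"
      by (rule param)
    then show "\<exists>t. s (fst i) - 1/2 \<le> t \<and> t < s (fst i) + 1/2 \<and> g t = snd i"
      by (intro exI[of _ u]) auto
  qed
  from bchoice[OF this] obtain t
    where t0: "\<forall>i\<in>?P. s (fst i) - 1/2 \<le> t i \<and> t i < s (fst i) + 1/2 \<and> g (t i) = snd i"
    by (elim exE)
  have t: "s (fst i) - 1/2 \<le> t i" "t i < s (fst i) + 1/2" "g (t i) = snd i" if "i \<in> ?P" for i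
    using bspec[OF t0 that] by auto
  define V where "V = s ` Z \<union> t ` ?P"
  have finV: "finite V" using fin finP by (simp add: V_def)
  obtain \<delta> where \<delta>: "\<delta> > 0" "\<And>a b. a \<in> V \<Longrightarrow> b \<in> V \<Longrightarrow> a \<noteq> b \<Longrightarrow> \<delta> \<le> \<bar>a - b\<bar>"
    by (rule finite_real_set_separated[OF finV]) (rule that, assumption, blast)
  have bound: "ennreal (c * (\<Sum>(x, y)\<in>?P. 1 / norm (y - x))) \<le> energy n (\<phi>, p)" if n: "n \<ge> 8" "1 \<le> real n * \<delta>" for n
  proof -
    have sep: "1 \<le> \<bar>real n * a - real n * b\<bar>" if "a \<in> V" "b \<in> V" "a \<noteq> b" for a b
    proof -
      have "1 \<le> real n * \<delta>" by (rule n)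
      also have "\<dots> \<le> real n * \<bar>a - b\<bar>" by (intro mult_left_mono \<delta> that) simp
      also have "\<dots> = \<bar>real n * a - real n * b\<bar>" by (simp add: right_diff_distrib[symmetric] abs_mult)
      finally show ?thesis .
    qed
    have flinj: "a = b" if "a \<in> V" "b \<in> V" "\<lfloor>real n * a\<rfloor> = \<lfloor>real n * b\<rfloor>" for a b
    proof (rule ccontr)
      assume "a \<noteq> b"
      then have "1 \<le> \<bar>real n * a - real n * b\<bar>" using sep that by blast
      then show False using that(3) by linarith
    qed
    define h where "h i = (\<lfloor>real n * s (fst i)\<rfloor>, \<lfloor>real n * t i\<rfloor>)" for i
    have stV: "s (fst i) \<in> V" "t i \<in> V" if "i \<in> ?P" for i using that by (auto simp: V_def)
    have hinj: "inj_on h ?P"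
    proof (rule inj_onI)
      fix i i' assume i: "i \<in> ?P" "i' \<in> ?P" "h i = h i'"
      then have e: "s (fst i) = s (fst i')" "t i = t i'" using flinj stV by (auto simp: h_def)
      have Zi: "fst i \<in> Z" "fst i' \<in> Z" using i by auto
      have "fst i = fst i'" using s(3)[OF Zi(1)] s(3)[OF Zi(2)] unfolding e(1) by simp
      moreover have "snd i = snd i'" using t(3)[OF i(1)] t(3)[OF i(2)] unfolding e(2) by simp
      ultimately show "i = i'" by (simp add: prod_eq_iff)
    qed
    have hterm: "h i \<in> cell_pairs n \<and> c * (1 / norm (snd i - fst i)) \<le> 2 * real n / of_int \<bar>snd (h i) - fst (h i)\<bar>
        \<and> (\<phi>, p) \<in> meets n (fst (h i)) (snd (h i))" if i: "i \<in> ?P" for i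
    proof -
      have Zi: "fst i \<in> Z" "snd i \<in> Z" "fst i \<noteq> snd i" using i by auto
      define a where "a = s (fst i)"
      define b where "b = t i"
      have ga: "g a = fst i" "g b = snd i" using s(3) t(3)[OF i] Zi by (auto simp: a_def b_def)
      have ab: "0 \<le> a" "a < 1" "a - 1/2 \<le> b" "b < a + 1/2" using s Zi t[OF i] by (auto simp: a_def b_def)
      have neab: "a \<noteq> b" using ga Zi by auto
      have le: "\<bar>b - a\<bar> \<le> 1/2" using ab by linarith
      have hi: "h i = (\<lfloor>real n * a\<rfloor>, \<lfloor>real n * b\<rfloor>)" by (simp add: h_def a_def b_def)
      define j where "j = \<lfloor>real n * a\<rfloor>"
      define k where "k = \<lfloor>real n * b\<rfloor>"
      have abV: "a \<in> V" "b \<in> V" using stV[OF i] by (auto simp: a_def b_def)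
      have jk: "j \<noteq> k" using flinj[OF abV] neab by (auto simp: j_def k_def)
      have diff: "\<bar>real n * b - real n * a\<bar> = real n * \<bar>b - a\<bar>" by (simp add: right_diff_distrib[symmetric] abs_mult)
      have fl: "of_int \<bar>k - j\<bar> < real n * \<bar>b - a\<bar> + 1"
        unfolding diff[symmetric] j_def k_def by linarith
      have "0 \<le> j" using ab by (simp add: j_def)
      moreover have "j < int n" using ab n unfolding j_def by (simp add: floor_less_iff)
      moreover have "2 * \<bar>k - j\<bar> \<le> int n + 2"
      proof -
        have "real n * \<bar>b - a\<bar> \<le> real n * (1/2)" by (intro mult_left_mono le) simp
        then have "real_of_int (2 * \<bar>k - j\<bar>) \<le> real_of_int (int n + 2)" using fl by simp
        then show ?thesis using of_int_le_iff by blast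
      qed
      ultimately have 1: "(j, k) \<in> cell_pairs n" using jk by (simp add: cell_pairs_def)
      have "c * \<bar>b - a\<bar> \<le> norm (chord a b) * \<bar>b - a\<bar>"
        using ab le by (intro mult_right_mono c(2)) auto
      also have "\<dots> = norm (snd i - fst i)" using chord_eq[of b a] ga by simp
      finally have "c * (1 / norm (snd i - fst i)) \<le> 1 / \<bar>b - a\<bar>"
        using Zi neab by (simp add: field_simps)
      also have "\<dots> \<le> 2 * real n / of_int \<bar>k - j\<bar>"
      proof -
        \<comment> \<open>Rounding adds less than 1, and separation makes n |b - a| at least
          1.\<close>
        have "of_int \<bar>k - j\<bar> \<le> 2 * (real n * \<bar>b - a\<bar>)"
          using fl sep[OF abV(2,1)] neab unfolding diff by linarith
        then show ?thesis using neab jk by (simp add: field_simps)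
      qed
      finally have 2: "c * (1 / norm (snd i - fst i)) \<le> 2 * real n / of_int \<bar>k - j\<bar>" .
      have "a \<in> cell n j" "b \<in> cell n k" unfolding j_def k_def using n by (auto intro: floor_in_cell)
      moreover have "g a \<bullet> normal \<phi> = p" using ga Z(2) Zi by auto
      moreover have "chord a b \<bullet> normal \<phi> = 0"
      proof -
        have "(b - a) * (chord a b \<bullet> normal \<phi>) = (g b - g a) \<bullet> normal \<phi>"
          by (simp add: chord_eq)
        also have "\<dots> = 0" using ga Z(2) Zi by (simp add: inner_diff_left)
        finally show ?thesis using neab by simp
      qed
      ultimately have 3: "(\<phi>, p) \<in> meets n j k" using \<phi> by (auto simp: meets_def)
      show ?thesis using 1 2 3 hi by (simp add: j_def k_def)
    qed
    have "ennreal (c * (\<Sum>(x, y)\<in>?P. 1 / norm (y - x))) = (\<Sum>i\<in>?P. ennreal (c * (1 / norm (snd i - fst i))))"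
      using c(1) by (subst sum_ennreal) (auto simp: sum_distrib_left case_prod_unfold)
    also have "\<dots> \<le> (\<Sum>i\<in>?P. ennreal (2 * real n / of_int \<bar>snd (h i) - fst (h i)\<bar>) * indicator (meets n (fst (h i)) (snd (h i))) (\<phi>, p))"
    proof (rule sum_mono)
      fix i assume "i \<in> ?P"
      from hterm[OF this] show "ennreal (c * (1 / norm (snd i - fst i))) \<le>
        ennreal (2 * real n / of_int \<bar>snd (h i) - fst (h i)\<bar>) * indicator (meets n (fst (h i)) (snd (h i))) (\<phi>, p)"
        by (simp add: ennreal_leI)
    qed
    also have "\<dots> = (\<Sum>i\<in>h ` ?P. ennreal (2 * real n / of_int \<bar>snd i - fst i\<bar>) * indicator (meets n (fst i) (snd i)) (\<phi>, p))"
      by (simp add: sum.reindex[OF hinj])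
    also have "\<dots> \<le> (\<Sum>i\<in>cell_pairs n. ennreal (2 * real n / of_int \<bar>snd i - fst i\<bar>) * indicator (meets n (fst i) (snd i)) (\<phi>, p))"
      using hterm cell_pairs_bound(1)[of n] n by (intro sum_mono2) auto
    also have "\<dots> = energy n (\<phi>, p)" by (simp add: energy_def case_prod_unfold)
    finally show ?thesis .
  qed
  obtain n0 where "1 / \<delta> \<le> real n0" using real_arch_simple by blast
  then have "1 \<le> real n * \<delta>" if "n \<ge> n0" for n
    using that \<delta>(1) by (smt (verit) divide_le_eq of_nat_mono)
  then have "\<forall>\<^sub>F n in sequentially. ennreal (c * (\<Sum>(x, y)\<in>?P. 1 / norm (y - x))) \<le> energy n (\<phi>, p)"
    using bound by (intro eventually_sequentiallyI[of "max 8 n0"]) auto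
  then show ?thesis by (rule Liminf_bounded)
qed

text \<open>A Borel majorant valid on every line, so that the sum itself never has to be measurable
  in (\<phi>, p).\<close>

lemma integrable_line_energy:
  obtains E :: "real \<times> real \<Rightarrow> ennreal" where "E \<in> borel_measurable borel" "(\<integral>\<^sup>+x. E x \<partial>lborel) < \<infinity>"
    "\<And>\<phi> p Z. \<phi> \<in> {0..2*pi} \<Longrightarrow> finite Z \<Longrightarrow> Z \<subseteq> C \<Longrightarrow> (\<And>x. x \<in> Z \<Longrightarrow> x \<bullet> normal \<phi> = p) \<Longrightarrow>
       ennreal (\<Sum>(x, y)\<in>{(x, y). x \<in> Z \<and> y \<in> Z \<and> x \<noteq> y}. 1 / norm (y - x)) \<le> E (\<phi>, p)"
proof -
  obtain c where c: "c > 0" "\<And>s t. s \<in> {-1..2} \<Longrightarrow> t \<in> {-1..2} \<Longrightarrow> \<bar>t - s\<bar> \<le> 3/4 \<Longrightarrow> c \<le> norm (chord s t)"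
    by (rule chord_lower_bound) (rule that, assumption, blast)
  obtain B where B: "\<And>n. n \<ge> 8 \<Longrightarrow> (\<integral>\<^sup>+x. energy n x \<partial>lborel) \<le> ennreal B" by (rule energy_bounded) (rule that, blast)
  define E where "E x = ennreal (1 / c) * liminf (\<lambda>n. energy n x)" for x
  have "(\<integral>\<^sup>+x. liminf (\<lambda>n. energy n x) \<partial>lborel) \<le> liminf (\<lambda>n. \<integral>\<^sup>+x. energy n x \<partial>lborel)"
    by (rule nn_integral_liminf) simp
  also have "\<dots> \<le> limsup (\<lambda>n. \<integral>\<^sup>+x. energy n x \<partial>lborel)" by (rule Liminf_le_Limsup) simp
  also have "\<dots> \<le> ennreal B"
    using B by (intro Limsup_bounded eventually_sequentiallyI[of 8]) auto
  finally have fin: "(\<integral>\<^sup>+x. liminf (\<lambda>n. energy n x) \<partial>lborel) < \<infinity>" by (simp add: order_le_less_trans)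
  show ?thesis
  proof (rule that)
    show "E \<in> borel_measurable borel" unfolding E_def by measurable
    show "(\<integral>\<^sup>+x. E x \<partial>lborel) < \<infinity>"
      unfolding E_def using fin by (subst nn_integral_cmult) (auto simp: ennreal_mult_less_top)
    fix \<phi> p Z assume a: "\<phi> \<in> {0..2*pi}" "finite Z" "Z \<subseteq> C" "\<And>x. x \<in> Z \<Longrightarrow> x \<bullet> normal \<phi> = p"
    let ?S = "\<Sum>(x, y)\<in>{(x, y). x \<in> Z \<and> y \<in> Z \<and> x \<noteq> y}. 1 / norm (y - x)"
    have "?S \<ge> 0" by (intro sum_nonneg) auto
    then have "ennreal ?S = ennreal (1 / c) * ennreal (c * ?S)"
      using c(1) by (simp add: ennreal_mult[symmetric])
    also have "\<dots> \<le> E (\<phi>, p)" unfolding E_def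
      by (intro mult_left_mono line_energy_le_liminf[OF c a]) auto
    finally show "ennreal ?S \<le> E (\<phi>, p)" .
  qed
qed

end

section \<open>Integration against image measures\<close>

lemma space_image_measure [simp]: "space (image_measure M Y f) = Y"
  unfolding image_measure_def space_distr by (rule space_measure_of) auto

lemma sets_image_measureI:
  "A \<subseteq> Y \<Longrightarrow> f -` A \<inter> space M \<in> sets M \<Longrightarrow> A \<in> sets (image_measure M Y f)"
  unfolding image_measure_def by (subst sets_distr, subst sets_measure_of) auto

lemma measurable_image_measure:
  assumes "f \<in> space M \<rightarrow> Y"
  shows "f \<in> measurable M (sigma Y {A. A \<subseteq> Y \<and> f -` A \<inter> space M \<in> sets M})"
  using assms by (intro measurable_measure_of) auto

context
  fixes S :: "'a::euclidean_space set" and Y :: "'b set" and f :: "'a \<Rightarrow> 'b"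
    and w :: "'a \<Rightarrow> ennreal" and r :: ennreal and \<mu> :: "'b measure"
  assumes S: "S \<in> sets borel" and f: "f \<in> S \<rightarrow> Y" and w: "w \<in> borel_measurable borel"
    and \<mu>: "\<mu> = scale_measure r (image_measure (density (lebesgue_on S) w) Y f)"
begin

private lemma S_lebesgue: "S \<in> sets lebesgue"
  using S by simp

private lemma sets_\<mu>I:
  assumes "A \<subseteq> Y" "{x\<in>S. f x \<in> A} \<in> sets lebesgue"
  shows "A \<in> sets \<mu>"
proof -
  have "f -` A \<inter> space (density (lebesgue_on S) w) = {x\<in>S. f x \<in> A}" by (auto simp: space_restrict_space)
  moreover have "{x\<in>S. f x \<in> A} \<in> sets (lebesgue_on S)"
    using assms S_lebesgue by (subst sets_restrict_space_iff) auto
  ultimately show ?thesis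
    unfolding \<mu> sets_scale_measure using assms by (intro sets_image_measureI) auto
qed

private lemma w_lebesgue: "w \<in> borel_measurable (lebesgue_on S)"
proof -
  have "w \<in> borel_measurable lebesgue" using w by (intro measurable_completion) simp
  then show ?thesis by (rule measurable_restrict_space1)
qed

private lemma f_measurable:
  "f \<in> measurable (density (lebesgue_on S) w)
     (sigma Y {A. A \<subseteq> Y \<and> f -` A \<inter> space (density (lebesgue_on S) w) \<in> sets (density (lebesgue_on S) w)})"
  using f by (intro measurable_image_measure) (auto simp: space_restrict_space)

text \<open>The preimage of the good set agrees with \<open>S\<close> up to a null set and is
  therefore Lebesgue measurable; on the largest sigma-algebra this already makes the good set
  measurable.\<close>

lemma AE_scaled_image_measure:
  assumes "AE x in lborel. x \<in> S \<longrightarrow> Q (f x)"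
  shows "AE y in \<mu>. Q y"
proof -
  have AE: "AE x in lebesgue. x \<in> S \<longrightarrow> Q (f x)" using assms by (rule AE_completion)
  have "{x\<in>S. f x \<in> {y\<in>Y. Q y}} \<in> sets lebesgue"
  proof (rule completion.in_sets_AE[OF _ S_lebesgue])
    show "AE x in lebesgue. x \<in> S \<longleftrightarrow> x \<in> {x\<in>S. f x \<in> {y\<in>Y. Q y}}"
      using AE by eventually_elim (use f in auto)
  qed auto
  then have "{y\<in>Y. Q y} \<in> sets \<mu>" by (intro sets_\<mu>I) auto
  then have m: "{y\<in>Y. Q y} \<in> sets (image_measure (density (lebesgue_on S) w) Y f)" by (simp add: \<mu>)
  have "AE x in lebesgue_on S. Q (f x)" using AE S_lebesgue by (simp add: AE_restrict_space_iff)
  then have "AE x in density (lebesgue_on S) w. Q (f x)" unfolding AE_density[OF w_lebesgue] by eventually_elim simp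
  then have "AE y in image_measure (density (lebesgue_on S) w) Y f. Q y"
    using m unfolding image_measure_def
    by (subst AE_distr_iff[OF f_measurable]) (auto simp: space_measure_of_conv sets_distr)
  then obtain N where N: "{y \<in> Y. \<not> Q y} \<subseteq> N" "emeasure (image_measure (density (lebesgue_on S) w) Y f) N = 0"
    "N \<in> sets (image_measure (density (lebesgue_on S) w) Y f)"
    by (auto elim!: AE_E)
  then show ?thesis
    unfolding \<mu> by (intro AE_I[of _ _ N]) (auto simp: space_scale_measure)
qed

text \<open>Agreement of the pullback with a Borel function \<open>D\<close> almost everywhere gives
  measurability of the integrand, again by completeness and maximality of the sigma-algebra, and the
  integral can be computed from \<open>D\<close>.\<close>

lemma nn_integral_scaled_image_measure:
  fixes \<phi> :: "'b \<Rightarrow> real"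
  assumes D: "D \<in> borel_measurable borel"
    and good: "AE x in lborel. x \<in> S \<longrightarrow> 0 \<le> \<phi> (f x) \<and> ennreal (\<phi> (f x)) = D x"
  shows "\<phi> \<in> borel_measurable \<mu>" and "AE y in \<mu>. 0 \<le> \<phi> y"
    and "(\<integral>\<^sup>+y. ennreal (\<phi> y) \<partial>\<mu>) = r * (\<integral>\<^sup>+x. D x * w x * indicator S x \<partial>lborel)"
proof -
  have AE: "AE x in lebesgue. x \<in> S \<longrightarrow> 0 \<le> \<phi> (f x) \<and> ennreal (\<phi> (f x)) = D x" using good by (rule AE_completion)
  have sp: "space \<mu> = Y" by (simp add: \<mu> space_scale_measure)
  show meas: "\<phi> \<in> borel_measurable \<mu>"
  proof (rule measurableI)
    fix A :: "real set" assume A: "A \<in> sets borel"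
    have D': "(\<lambda>x. enn2real (D x)) \<in> borel_measurable borel" using D by measurable
    have "{x\<in>S. f x \<in> \<phi> -` A \<inter> Y} \<in> sets lebesgue"
    proof (rule completion.in_sets_AE)
      show "S \<inter> (\<lambda>x. enn2real (D x)) -` A \<in> sets lebesgue"
        using S measurable_sets[OF D' A] by auto
      show "AE x in lebesgue. x \<in> S \<inter> (\<lambda>x. enn2real (D x)) -` A \<longleftrightarrow> x \<in> {x\<in>S. f x \<in> \<phi> -` A \<inter> Y}"
        using AE
      proof eventually_elim
        case (elim x)
        then have "x \<in> S \<Longrightarrow> enn2real (D x) = \<phi> (f x)" by (metis enn2real_ennreal)
        then show ?case using f by auto
      qed
    qed auto
    then show "\<phi> -` A \<inter> space \<mu> \<in> sets \<mu>" unfolding sp by (intro sets_\<mu>I) auto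
  qed simp
  show "AE y in \<mu>. 0 \<le> \<phi> y" by (rule AE_scaled_image_measure) (use good in \<open>eventually_elim, auto\<close>)
  have meas': "(\<lambda>y. ennreal (\<phi> y)) \<in> borel_measurable (image_measure (density (lebesgue_on S) w) Y f)"
    using meas by (simp add: \<mu> cong: measurable_cong_sets)
  have "(\<integral>\<^sup>+y. ennreal (\<phi> y) \<partial>\<mu>) = r * (\<integral>\<^sup>+y. ennreal (\<phi> y) \<partial>image_measure (density (lebesgue_on S) w) Y f)"
    unfolding \<mu> by (rule nn_integral_scale_measure[OF meas'])
  also have "(\<integral>\<^sup>+y. ennreal (\<phi> y) \<partial>image_measure (density (lebesgue_on S) w) Y f)
     = (\<integral>\<^sup>+x. ennreal (\<phi> (f x)) \<partial>density (lebesgue_on S) w)"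
    using meas' unfolding image_measure_def by (intro nn_integral_distr[OF f_measurable]) auto
  also have "\<dots> = (\<integral>\<^sup>+x. D x \<partial>density (lebesgue_on S) w)"
  proof (rule nn_integral_cong_AE)
    have "AE x in lebesgue. x \<in> S \<longrightarrow> ennreal (\<phi> (f x)) = D x" using AE by eventually_elim auto
    then have "AE x in lebesgue_on S. ennreal (\<phi> (f x)) = D x" using S_lebesgue by (simp add: AE_restrict_space_iff)
    then show "AE x in density (lebesgue_on S) w. ennreal (\<phi> (f x)) = D x" unfolding AE_density[OF w_lebesgue] by eventually_elim simp
  qed
  also have "\<dots> = (\<integral>\<^sup>+x. w x * D x \<partial>lebesgue_on S)"
    using D by (intro nn_integral_density[OF w_lebesgue] measurable_restrict_space1 measurable_completion) simp
  also have "\<dots> = (\<integral>\<^sup>+x. w x * D x * indicator S x \<partial>lebesgue)"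
    using S_lebesgue by (subst nn_integral_restrict_space) auto
  also have "\<dots> = (\<integral>\<^sup>+x. D x * w x * indicator S x \<partial>lborel)"
    by (simp add: nn_integral_completion mult_ac)
  finally show "(\<integral>\<^sup>+y. ennreal (\<phi> y) \<partial>\<mu>) = r * (\<integral>\<^sup>+x. D x * w x * indicator S x \<partial>lborel)" .
qed

end

section \<open>A Borel version of the number of crossings\<close>

context C2_curve
begin

text \<open>The cells are half-open so that, for \<open>k < n\<close>, they partition one
  period.\<close>

definition hits :: "nat \<Rightarrow> nat \<Rightarrow> ((real^2) \<times> (real^2)) set" where
  "hits n k = {(z, w). \<exists>s\<in>{real k / real n..<(real k + 1) / real n}. g s \<in> open_segment z w}"

text \<open>The number of cells containing a crossing; it becomes the number of crossings for large
  \<open>n\<close> when that is finite, and the liminf keeps it Borel on all pairs.\<close>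

definition crossing_count :: "(real^2) \<times> (real^2) \<Rightarrow> ennreal" where
  "crossing_count p = liminf (\<lambda>n. \<Sum>k<n. indicator (hits n k) p)"

text \<open>The half-open cell times the open unit interval is a countable union of compact sets
  \<open>K i\<close>, and the incidence relation projects from each to a closed set. Pairs with
  \<open>z = w\<close>, whose open segment is empty, are removed separately.\<close>

lemma hits_borel: "hits n k \<in> sets borel"
proof -
  define a where "a = real k / real n"
  define b where "b = (real k + 1) / real n"
  define T where "T = {x :: (real \<times> real) \<times> ((real^2) \<times> (real^2)).
     g (fst (fst x)) = (1 - snd (fst x)) *\<^sub>R fst (snd x) + snd (fst x) *\<^sub>R snd (snd x)}"
  have "closed T" unfolding T_def
    by (intro closed_Collect_eq continuous_intros continuous_on_compose2[OF cont_g[of UNIV]]) auto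
  define K where "K i = {a..b - 1 / (real i + 1)} \<times> {1 / (real i + 1)..1 - 1 / (real i + 1)}" for i :: nat
  define H where "H i = {y. \<exists>x. x \<in> K i \<and> (x, y) \<in> T}" for i
  have "closed (H i)" for i
    unfolding H_def by (intro closed_compact_projection \<open>closed T\<close>) (auto simp: K_def intro!: compact_Times)
  then have [measurable]: "H i \<in> sets borel" for i by simp
  have UK: "(\<Union>i. K i) = {a..<b} \<times> {0<..<1}"
  proof (intro equalityI subsetI)
    fix x assume "x \<in> (\<Union>i. K i)"
    then obtain i where i: "a \<le> fst x" "fst x \<le> b - 1 / (real i + 1)" "1 / (real i + 1) \<le> snd x" "snd x \<le> 1 - 1 / (real i + 1)"
      by (auto simp: K_def)
    moreover have "0 < 1 / (real i + 1)" by simp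
    ultimately have "fst x < b" "0 < snd x" "snd x < 1" by linarith+
    then show "x \<in> {a..<b} \<times> {0<..<1}" using i by (auto simp: mem_Times_iff)
  next
    fix x assume x: "x \<in> {a..<b} \<times> {0<..<(1::real)}"
    define e where "e = min (b - fst x) (min (snd x) (1 - snd x))"
    have "e > 0" using x by (auto simp: e_def)
    then obtain i where i: "1 / (real (Suc i)) < e" using reals_Archimedean[of e] by (auto simp: inverse_eq_divide)
    then have "x \<in> K i" using x by (auto simp: K_def e_def mem_Times_iff add.commute)
    then show "x \<in> (\<Union>i. K i)" by blast
  qed
  have "hits n k = (\<Union>i. H i) \<inter> {(z, w). z \<noteq> w}"
  proof (intro equalityI subsetI)
    fix p assume p: "p \<in> hits n k"
    obtain z w where zw: "p = (z, w)" by fastforce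
    obtain s u where su: "s \<in> {a..<b}" "0 < u" "u < 1" "g s = (1 - u) *\<^sub>R z + u *\<^sub>R w" "z \<noteq> w"
      using p by (auto simp: zw hits_def a_def b_def in_segment)
    then have "(s, u) \<in> (\<Union>i. K i)" unfolding UK by auto
    then obtain i where "(s, u) \<in> K i" by blast
    moreover have "((s, u), p) \<in> T" using su by (simp add: T_def zw)
    ultimately have "p \<in> H i" by (auto simp: H_def)
    then show "p \<in> (\<Union>i. H i) \<inter> {(z, w). z \<noteq> w}" using su zw by auto
  next
    fix p assume p: "p \<in> (\<Union>i. H i) \<inter> {(z, w). z \<noteq> w}"
    obtain z w where zw: "p = (z, w)" by fastforce
    obtain i x where x: "x \<in> K i" "(x, p) \<in> T" using p by (auto simp: H_def)
    have "x \<in> (\<Union>i. K i)" using x by blast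
    then have x': "fst x \<in> {a..<b}" "0 < snd x" "snd x < 1" unfolding UK by auto
    have "g (fst x) \<in> open_segment z w"
      using x x' p by (auto simp: T_def zw in_segment)
    then show "p \<in> hits n k" using x' by (auto simp: hits_def zw a_def b_def)
  qed
  moreover have "{(z, w). z \<noteq> (w::real^2)} \<in> sets borel"
    unfolding case_prod_unfold by (intro borel_open open_Collect_neq continuous_intros)
  ultimately show ?thesis by auto
qed

lemma measurable_crossing_count [measurable]: "crossing_count \<in> borel_measurable borel"
proof -
  have [measurable]: "hits n k \<in> sets borel" for n k by (rule hits_borel)
  show ?thesis unfolding crossing_count_def by measurable
qed

text \<open>When 1/n is at most the separation of the crossing parameters, each cell contains at
  most one of them.\<close>

lemma crossing_count_finite:
  assumes fin: "finite (open_segment z w \<inter> C)"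
  shows "crossing_count (z, w) = ennreal (real (card (open_segment z w \<inter> C)))"
proof -
  define Z where "Z = open_segment z w \<inter> C"
  have finZ: "finite Z" using fin by (simp add: Z_def)
  define V where "V = {s\<in>{0..<1}. g s \<in> Z}"
  have bij: "bij_betw g V Z"
    unfolding bij_betw_def
  proof
    show "inj_on g V"
    proof (rule inj_onI)
      fix s t assume st: "s \<in> V" "t \<in> V" "g s = g t"
      then obtain k where k: "s - t = of_int k" using g_eq_iff by (auto elim: Ints_cases)
      have "\<bar>s - t\<bar> < 1" using st by (auto simp: V_def)
      then have "k = 0" unfolding k by linarith
      then show "s = t" using k by simp
    qed
    show "g ` V = Z"
    proof (intro equalityI subsetI)
      fix x assume x: "x \<in> Z"
      then have "x \<in> C" by (simp add: Z_def)
      then obtain s where "0 \<le> s" "s < 0 + 1" "g s = x" by (rule param)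
      then show "x \<in> g ` V" using x by (auto simp: V_def)
    qed (auto simp: V_def)
  qed
  then have finV: "finite V" and cardV: "card V = card Z"
    using finZ bij_betw_finite bij_betw_same_card by blast+
  obtain \<delta> where \<delta>: "\<delta> > 0" "\<And>a b. a \<in> V \<Longrightarrow> b \<in> V \<Longrightarrow> a \<noteq> b \<Longrightarrow> \<delta> \<le> \<bar>a - b\<bar>"
    by (rule finite_real_set_separated[OF finV]) (rule that, assumption, blast)
  have eq: "(\<Sum>k<n. indicator (hits n k) (z, w)) = (ennreal (real (card Z)))" if n: "n \<ge> 1" "1 \<le> real n * \<delta>" for n
  proof -
    have flinj: "inj_on (\<lambda>s. nat \<lfloor>real n * s\<rfloor>) V"
    proof (rule inj_onI, rule ccontr)
      fix a b assume ab: "a \<in> V" "b \<in> V" "nat \<lfloor>real n * a\<rfloor> = nat \<lfloor>real n * b\<rfloor>" "a \<noteq> b"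
      have "0 \<le> \<lfloor>real n * a\<rfloor>" "0 \<le> \<lfloor>real n * b\<rfloor>" using ab by (auto simp: V_def)
      then have e: "\<lfloor>real n * a\<rfloor> = \<lfloor>real n * b\<rfloor>" using ab(3) by linarith
      have "1 \<le> real n * \<delta>" by (rule n)
      also have "\<dots> \<le> real n * \<bar>a - b\<bar>" using ab by (intro mult_left_mono \<delta>) auto
      also have "\<dots> = \<bar>real n * a - real n * b\<bar>" by (simp add: right_diff_distrib[symmetric] abs_mult)
      finally show False using e by linarith
    qed
    have im: "{k\<in>{..<n}. (z, w) \<in> hits n k} = (\<lambda>s. nat \<lfloor>real n * s\<rfloor>) ` V"
    proof (intro equalityI subsetI)
      fix k assume "k \<in> {k\<in>{..<n}. (z, w) \<in> hits n k}"
      then obtain s where s: "k < n" "real k / real n \<le> s" "s < (real k + 1) / real n" "g s \<in> open_segment z w"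
        by (auto simp: hits_def)
      have "real k \<le> real n * s" "real n * s < real k + 1"
        using s n by (auto simp: field_simps)
      then have fl: "\<lfloor>real n * s\<rfloor> = int k" by linarith
      have "0 \<le> real k / real n" by simp
      then have "0 \<le> s" using s by linarith
      moreover have "(real k + 1) / real n \<le> 1" using s n by (simp add: divide_le_eq)
      then have "s < 1" using s by linarith
      ultimately have "s \<in> V" using s range_g by (auto simp: V_def Z_def)
      then show "k \<in> (\<lambda>s. nat \<lfloor>real n * s\<rfloor>) ` V" using fl by (auto intro!: rev_image_eqI[of s])
    next
      fix k assume "k \<in> (\<lambda>s. nat \<lfloor>real n * s\<rfloor>) ` V"
      then obtain s where s: "s \<in> V" "k = nat \<lfloor>real n * s\<rfloor>" by auto
      have s01: "0 \<le> s" "s < 1" "g s \<in> open_segment z w" using s by (auto simp: V_def Z_def)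
      then have "0 \<le> \<lfloor>real n * s\<rfloor>" by simp
      then have k: "of_int \<lfloor>real n * s\<rfloor> = real k" using s(2) by simp
      have "real k \<le> real n * s" "real n * s < real k + 1" using k by linarith+
      then have "real k / real n \<le> s" "s < (real k + 1) / real n" using n by (auto simp: field_simps)
      moreover have "real n * s < real n" using s01 n by simp
      then have "k < n" using \<open>real k \<le> real n * s\<close> by simp
      ultimately show "k \<in> {k\<in>{..<n}. (z, w) \<in> hits n k}" using s01 by (auto simp: hits_def)
    qed
    have "(\<Sum>k<n. indicator (hits n k) (z, w)) = (of_nat (card {k\<in>{..<n}. (z, w) \<in> hits n k}) :: ennreal)"
      by (simp add: indicator_def sum.If_cases Int_def)
    also have "\<dots> = of_nat (card Z)" unfolding im using card_image[OF flinj] cardV by simp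
    finally show ?thesis by (simp add: ennreal_of_nat_eq_real_of_nat)
  qed
  obtain n0 where "1 / \<delta> \<le> real n0" using real_arch_simple by blast
  then have "1 \<le> real n * \<delta>" if "n \<ge> n0" for n
    using that \<delta>(1) by (smt (verit) divide_le_eq of_nat_mono)
  then have "\<forall>\<^sub>F n in sequentially. (\<Sum>k<n. indicator (hits n k) (z, w)) = ennreal (real (card Z))"
    using eq by (intro eventually_sequentiallyI[of "max 1 n0"]) auto
  then have "(\<lambda>n. \<Sum>k<n. indicator (hits n k) (z, w)) \<longlonglongrightarrow> ennreal (real (card Z))"
    by (rule tendsto_eventually)
  then show ?thesis unfolding crossing_count_def Z_def[symmetric] by (intro lim_imp_Liminf) auto
qed

end

section \<open>Disintegration over lines\<close>

lemma pt_convex_combination: "pt m b ((1 - u) * s + u * t) = (1 - u) *\<^sub>R pt m b s + u *\<^sub>R pt m b t"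
  by (simp add: vec_eq_iff forall_2 algebra_simps)

lemma closed_segment_pt: "closed_segment (pt m b s) (pt m b t) = pt m b ` closed_segment s t"
  by (simp add: closed_segment_image_interval image_image pt_convex_combination)

lemma open_segment_pt: "open_segment (pt m b s) (pt m b t) = pt m b ` open_segment s t"
  by (auto simp: open_segment_def closed_segment_pt)

lemma norm_pt_diff: "norm (pt m b t - pt m b s) = sqrt (1 + m\<^sup>2) * \<bar>t - s\<bar>"
proof -
  have "norm (pt m b t - pt m b s) = sqrt ((t - s)\<^sup>2 + (m * t - m * s)\<^sup>2)"
    by (simp add: norm_vec_def L2_set_def sum_2)
  also have "(t - s)\<^sup>2 + (m * t - m * s)\<^sup>2 = (1 + m\<^sup>2) * (t - s)\<^sup>2"
    by (simp add: power2_eq_square algebra_simps)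
  finally show ?thesis by (simp add: real_sqrt_mult)
qed

lemma line_eq_range_pt:
  assumes "sin \<phi> \<noteq> 0"
  shows "{x. x$1 * cos \<phi> + x$2 * sin \<phi> = p} = range (pt (- cos \<phi> / sin \<phi>) (p / sin \<phi>))"
proof (intro equalityI subsetI)
  fix x :: "real^2" assume "x \<in> {x. x$1 * cos \<phi> + x$2 * sin \<phi> = p}"
  then have "x = pt (- cos \<phi> / sin \<phi>) (p / sin \<phi>) (x$1)"
    using assms by (intro pt_eqI) (auto simp: field_simps)
  then show "x \<in> range (pt (- cos \<phi> / sin \<phi>) (p / sin \<phi>))" by blast
qed (use assms in \<open>auto simp: field_simps\<close>)

lemma line_in_lines: "{x. x$1 * cos \<phi> + x$2 * sin \<phi> = p} \<in> lines"
proof -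
  have e: "{x. x$1 * cos \<phi> + x$2 * sin \<phi> = p} = {x. normal \<phi> \<bullet> x = p}"
    by (simp add: inner_normal inner_commute[of "normal \<phi>"])
  have "normal \<phi> \<noteq> 0" using norm_normal[of \<phi>] by fastforce
  then show ?thesis
    unfolding lines_def e by (simp add: affine_hyperplane aff_dim_hyperplane)
qed

context C2_curve
begin

lemma segment_Int_curve:
  "open_segment (pt m b s) (pt m b t) \<inter> C = pt m b ` (crossings m b \<inter> open_segment s t)"
  "closed_segment (pt m b s) (pt m b t) \<inter> C = pt m b ` (crossings m b \<inter> closed_segment s t)"
  by (auto simp: open_segment_pt closed_segment_pt crossings_def)

lemma card_pt_image: "card (pt m b ` A) = card A"
  by (intro card_image inj_onI) simp

text \<open>Swapping the points exchanges the pairs with x < y and those with y < x, hence the 2;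
  the root converts differences of abscissae into distances.\<close>

lemma line_sum_eq_gap_sum:
  assumes L: "L = range (pt m b)" and fin: "finite (crossings m b)"
  shows "(\<Sum>(x, y)\<in>{(x, y). x \<in> L \<inter> C \<and> y \<in> L \<inter> C \<and> x \<noteq> y}. (-1) ^ card (closed_segment x y \<inter> C) / norm (y - x))
    = 2 * gap_sum (crossings m b) / sqrt (1 + m\<^sup>2)"
proof -
  let ?X = "crossings m b"
  let ?Q = "\<lambda>x y. (-1) ^ card (closed_segment x y \<inter> C) / norm (y - x) :: real"
  let ?q = "\<lambda>x y. (-1) ^ card (?X \<inter> closed_segment x y) / \<bar>y - x\<bar> / sqrt (1 + m\<^sup>2)"
  let ?U = "{(x, y). x \<in> ?X \<and> y \<in> ?X \<and> x < y}" and ?D = "{(x, y). x \<in> ?X \<and> y \<in> ?X \<and> y < x}"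
  have LC: "L \<inter> C = pt m b ` ?X" by (auto simp: L crossings_def)
  have im: "{(x, y). x \<in> L \<inter> C \<and> y \<in> L \<inter> C \<and> x \<noteq> y} = map_prod (pt m b) (pt m b) ` (?U \<union> ?D)"
    unfolding LC by (auto simp: image_iff)
  have inj: "inj_on (map_prod (pt m b) (pt m b)) A" for A
    by (auto intro!: inj_onI)
  have "finite (?X \<times> ?X)" using fin by simp
  then have finU: "finite ?U" "finite ?D" by (auto elim: finite_subset[rotated])
  have "(\<Sum>(x, y)\<in>{(x, y). x \<in> L \<inter> C \<and> y \<in> L \<inter> C \<and> x \<noteq> y}. ?Q x y) = (\<Sum>i\<in>?U \<union> ?D. ?q (fst i) (snd i))"
    unfolding im sum.reindex[OF inj]
    by (intro sum.cong) (auto simp: segment_Int_curve card_pt_image norm_pt_diff mult.commute)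
  also have "\<dots> = (\<Sum>i\<in>?U. ?q (fst i) (snd i)) + (\<Sum>i\<in>?D. ?q (fst i) (snd i))"
    using finU by (intro sum.union_disjoint) auto
  also have "(\<Sum>i\<in>?D. ?q (fst i) (snd i)) = (\<Sum>i\<in>?U. ?q (fst i) (snd i))"
  proof -
    have D: "?D = prod.swap ` ?U" by (auto simp: image_iff)
    show ?thesis unfolding D by (subst sum.reindex) (auto simp: closed_segment_commute abs_minus_commute intro!: sum.cong)
  qed
  also have "(\<Sum>i\<in>?U. ?q (fst i) (snd i)) = gap_sum ?X / sqrt (1 + m\<^sup>2)"
    unfolding gap_sum_def sum_divide_distrib by (intro sum.cong) (auto simp: closed_segment_eq_real_ivl)
  finally show ?thesis by simp
qed

text \<open>In the (m, b)-plane the tangent lines are the image under \<open>h\<close> of a set of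
  reals, where \<open>h s\<close> consists of slope and intercept of the tangent at
  \<open>g s\<close>. As \<open>g'\<close> is differentiable, so is \<open>h\<close>, and the image
  is negligible for reasons of dimension. A vertical tangent never has a slope
  \<open>m\<close>.\<close>

lemma nontransversal_null:
  obtains N where "N \<in> null_sets lborel" "\<And>m b. (m, b) \<notin> N \<Longrightarrow> transversal m b"
proof -
  define h where "h s = (g' s $ 2 / g' s $ 1, g s $ 2 - g' s $ 2 / g' s $ 1 * g s $ 1)" for s
  let ?A = "{s. g' s $ 1 \<noteq> 0}"
  have d: "(\<lambda>s. g s $ i) differentiable (at s within ?A)" "(\<lambda>s. g' s $ i) differentiable (at s within ?A)" for i s
    using vec_nth_has_real_derivative[OF deriv, of i s] vec_nth_has_real_derivative[OF deriv2, of i s]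
    by (meson differentiable_at_withinI real_differentiable_def)+
  have "h differentiable_on ?A"
    unfolding differentiable_on_def h_def
    by (intro ballI differentiable_Pair derivative_intros differentiable_divide d) auto
  then have "negligible (h ` ?A)"
    by (intro negligible_differentiable_image_lowdim) simp_all
  then have "h ` ?A \<in> null_sets lebesgue" by (simp add: negligible_iff_null_sets)
  then obtain N where N: "N \<in> null_sets lborel" "h ` ?A \<subseteq> N"
    unfolding null_sets_completion_iff2 by blast
  have "(m, b) \<in> N" if nt: "\<not> transversal m b" for m b
  proof -
    obtain s where s: "g s $ 2 - m * g s $ 1 - b = 0" "g' s $ 2 - m * g' s $ 1 = 0"
      using nt by (auto simp: transversal_def height_def height'_def)
    have "g' s $ 1 \<noteq> 0"
    proof
      assume "g' s $ 1 = 0"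
      then have "g' s = 0" using s(2) by (simp add: vec_eq_iff forall_2)
      then show False using regular by blast
    qed
    moreover from this have "h s = (m, b)" using s by (simp add: h_def field_simps)
    ultimately show ?thesis using N(2) by force
  qed
  then show ?thesis using that[OF N(1)] by blast
qed

end

context separating_C2_curve
begin

text \<open>Borel counterpart, on pairs of ideal end points, of the integrand on
  \<open>geodesics\<close>.\<close>

definition defect :: "(real^2) \<times> (real^2) \<Rightarrow> ennreal" where
  "defect p = crossing_count p - indicator {(z, w). opposite z w} p"

lemma measurable_defect: "defect \<in> borel_measurable borel"
proof -
  have "{(z, w). opposite z w} = I \<times> V \<union> V \<times> I" by (auto simp: opposite_def)
  then have [measurable]: "{(z, w). opposite z w} \<in> sets borel"
    using open_I open_V by (auto intro!: borel_open open_Times)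
  show ?thesis unfolding defect_def by measurable
qed

lemma opposite_commute: "opposite z w \<longleftrightarrow> opposite w z"
  by (auto simp: opposite_def)

lemma defect_transversal:
  assumes tr: "transversal m b" and st: "s \<noteq> t" "s \<notin> crossings m b" "t \<notin> crossings m b"
  shows "finite (open_segment (pt m b s) (pt m b t) \<inter> C)"
    and "real (card (open_segment (pt m b s) (pt m b t) \<inter> C)) - of_bool (opposite (pt m b s) (pt m b t))
      = excess (crossings m b) (min s t) (max s t)"
    and "defect (pt m b s, pt m b t) = ennreal (excess (crossings m b) (min s t) (max s t))"
proof -
  let ?X = "crossings m b" and ?A = "open_segment (pt m b s) (pt m b t) \<inter> C"
  define K where "K = card (?X \<inter> {min s t<..<max s t})"
  have seg: "open_segment s t = {min s t<..<max s t}"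
    by (auto simp: open_segment_eq_real_ivl)
  have cK: "card ?A = K" by (simp add: segment_Int_curve card_pt_image seg K_def)
  show fin: "finite ?A" using finite_crossings[OF tr] by (simp add: segment_Int_curve)
  have "opposite (pt m b s) (pt m b t) \<longleftrightarrow> opposite (pt m b (min s t)) (pt m b (max s t))"
    by (auto simp: min_def max_def opposite_commute)
  also have "\<dots> \<longleftrightarrow> odd K"
    unfolding K_def using st by (intro opposite_iff_odd_crossings[OF tr]) (auto simp: min_def max_def)
  finally have opp: "opposite (pt m b s) (pt m b t) \<longleftrightarrow> odd K" .
  have K: "real K - of_bool (odd K) = real (2 * (K div 2))"
    by (cases "even K") (auto elim!: evenE oddE)
  then show eq: "real (card ?A) - of_bool (opposite (pt m b s) (pt m b t)) = excess ?X (min s t) (max s t)"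
    unfolding cK opp by (simp add: excess_def K_def)
  have "defect (pt m b s, pt m b t) = ennreal (real (card ?A)) - ennreal (of_bool (opposite (pt m b s) (pt m b t)))"
    using fin by (simp add: defect_def crossing_count_finite indicator_def)
  also have "\<dots> = ennreal (excess ?X (min s t) (max s t))"
    unfolding eq[symmetric] by (rule ennreal_minus) simp
  finally show "defect (pt m b s, pt m b t) = ennreal (excess ?X (min s t) (max s t))" .
qed

text \<open>The exceptional set \<open>Q\<close> is integrated by
  \<open>nn_integral_pairs_of_points\<close>: for almost every (m, b) the line is transversal, and
  then only pairs with an end point among finitely many crossings, or with \<open>s = t\<close>, can
  be exceptional.\<close>

lemma AE_pairs_on_transversal_lines:
  "AE p in lborel. \<exists>m b s t. p = (pt m b s, pt m b t) \<and> transversal m b \<and> s \<noteq> t \<and>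
      s \<notin> crossings m b \<and> t \<notin> crossings m b"
proof -
  obtain N where N: "N \<in> null_sets lborel" "\<And>m b. (m, b) \<notin> N \<Longrightarrow> transversal m b"
    by (rule nontransversal_null) (rule that, assumption, blast)
  have [measurable]: "N \<in> sets borel" using N by auto
  \<comment> \<open>\<open>sl\<close> and \<open>ic\<close> recover slope and intercept from a pair
    of points with distinct abscissae.\<close>
  define sl where "sl = (\<lambda>p :: (real^2) \<times> (real^2). (snd p $ 2 - fst p $ 2) / (snd p $ 1 - fst p $ 1))"
  define ic where "ic = (\<lambda>p :: (real^2) \<times> (real^2). fst p $ 2 - sl p * fst p $ 1)"
  have [measurable]: "(\<lambda>p :: (real^2) \<times> (real^2). fst p $ i) \<in> borel_measurable borel"
    "(\<lambda>p :: (real^2) \<times> (real^2). snd p $ i) \<in> borel_measurable borel" for i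
    by (intro borel_measurable_continuous_onI continuous_intros)+
  have [measurable]: "sl \<in> borel_measurable borel" unfolding sl_def by measurable
  have [measurable]: "ic \<in> borel_measurable borel" unfolding ic_def by measurable
  have [measurable]: "C \<in> sets borel" using closed_C by simp
  define Q where "Q = {p :: (real^2) \<times> (real^2). fst p $ 1 = snd p $ 1 \<or> (sl p, ic p) \<in> N \<or> fst p \<in> C \<or> snd p \<in> C}"
  have [measurable]: "Q \<in> sets borel"
  proof -
    have "(\<lambda>p. (sl p, ic p)) \<in> borel_measurable borel" by (intro borel_measurable_Pair) measurable
    from measurable_sets[OF this, of N] have [measurable]: "{p. (sl p, ic p) \<in> N} \<in> sets borel" by (simp add: vimage_def)
    have [measurable]: "{p :: (real^2) \<times> (real^2). fst p $ 1 = snd p $ 1} \<in> sets borel"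
      by (intro borel_closed closed_Collect_eq continuous_intros)
    have [measurable]: "{p :: (real^2) \<times> (real^2). fst p \<in> C} \<in> sets borel" "{p :: (real^2) \<times> (real^2). snd p \<in> C} \<in> sets borel"
      by (intro borel_closed closed_vimage_fst[OF closed_C, unfolded vimage_def]
          closed_vimage_snd[OF closed_C, unfolded vimage_def])+
    have "Q = {p. fst p $ 1 = snd p $ 1} \<union> {p. (sl p, ic p) \<in> N} \<union> {p. fst p \<in> C} \<union> {p. snd p \<in> C}"
      by (auto simp: Q_def)
    then show ?thesis by simp
  qed
  have "emeasure lborel Q = (\<integral>\<^sup>+p. indicator Q p \<partial>lborel)" by simp
  also have "\<dots> = (\<integral>\<^sup>+m. \<integral>\<^sup>+b. \<integral>\<^sup>+s. \<integral>\<^sup>+t. ennreal \<bar>t - s\<bar> * indicator Q (pt m b s, pt m b t) \<partial>lborel \<partial>lborel \<partial>lborel \<partial>lborel)"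
    by (rule nn_integral_pairs_of_points) measurable
  also have "\<dots> = (\<integral>\<^sup>+m. \<integral>\<^sup>+b. 0 \<partial>(lborel :: real measure) \<partial>(lborel :: real measure))"
  proof (rule nn_integral_cong_AE)
    have "AE x in lborel \<Otimes>\<^sub>M lborel. x \<notin> N" using AE_not_in[OF N(1)] unfolding lborel_prod .
    then have "AE m in lborel. AE b in lborel. (m, b) \<notin> N" by (rule lborel_pair.AE_pair)
    then show "AE m in lborel. (\<integral>\<^sup>+b. \<integral>\<^sup>+s. \<integral>\<^sup>+t. ennreal \<bar>t - s\<bar> * indicator Q (pt m b s, pt m b t) \<partial>lborel \<partial>lborel \<partial>lborel) = (\<integral>\<^sup>+b. 0 \<partial>(lborel :: real measure))"
    proof eventually_elim
      case (elim m)
      show ?case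
      proof (rule nn_integral_cong_AE)
        show "AE b in lborel. (\<integral>\<^sup>+s. \<integral>\<^sup>+t. ennreal \<bar>t - s\<bar> * indicator Q (pt m b s, pt m b t) \<partial>lborel \<partial>lborel) = 0"
          using elim
        proof eventually_elim
          case (elim b)
          then have AEX: "AE s in lborel. s \<notin> crossings m b"
            using N(2) finite_crossings AE_lborel_notin_finite by blast
          have z: "ennreal \<bar>t - s\<bar> * indicator Q (pt m b s, pt m b t) = 0"
            if "s \<notin> crossings m b" "t \<notin> crossings m b" for s t
          proof (cases "s = t")
            case False
            have "m * t + b - (m * s + b) = m * (t - s)" by (simp add: algebra_simps)
            then have "sl (pt m b s, pt m b t) = m" using False by (simp add: sl_def)
            then have "ic (pt m b s, pt m b t) = b" "sl (pt m b s, pt m b t) = m" by (auto simp: ic_def)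
            then show ?thesis using that False elim by (simp add: Q_def crossings_def)
          qed simp
          have "(\<integral>\<^sup>+s. \<integral>\<^sup>+t. ennreal \<bar>t - s\<bar> * indicator Q (pt m b s, pt m b t) \<partial>lborel \<partial>lborel) = (\<integral>\<^sup>+s. 0 \<partial>(lborel :: real measure))"
          proof (rule nn_integral_cong_AE)
            show "AE s in lborel. (\<integral>\<^sup>+t. ennreal \<bar>t - s\<bar> * indicator Q (pt m b s, pt m b t) \<partial>lborel) = 0"
              using AEX
            proof eventually_elim
              case (elim s)
              have "(\<integral>\<^sup>+t. ennreal \<bar>t - s\<bar> * indicator Q (pt m b s, pt m b t) \<partial>lborel) = (\<integral>\<^sup>+t. 0 \<partial>(lborel :: real measure))"
                by (rule nn_integral_cong_AE) (use AEX in \<open>eventually_elim, use z elim in blast\<close>)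
              then show ?case by simp
            qed
          qed
          then show ?case by simp
        qed
      qed
    qed
  qed
  finally have "emeasure lborel Q = 0" by simp
  then have "AE p in lborel. p \<notin> Q" by (intro AE_not_in null_setsI) auto
  then show ?thesis
  proof eventually_elim
    case (elim p)
    define m b where "m = sl p" and "b = ic p"
    obtain z w where zw: "p = (z, w)" by fastforce
    have ne: "z $ 1 \<noteq> w $ 1" and tr: "transversal m b" and C: "z \<notin> C" "w \<notin> C"
      using elim N(2) by (auto simp: Q_def m_def b_def zw)
    have z: "z = pt m b (z $ 1)" by (rule pt_eqI) (simp add: b_def m_def ic_def zw)
    have "m * (w $ 1 - z $ 1) = w $ 2 - z $ 2" using ne by (simp add: m_def sl_def zw)
    then have w: "w = pt m b (w $ 1)"
      by (intro pt_eqI) (simp add: b_def ic_def zw m_def algebra_simps)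
    show ?case
      using z w zw ne tr C by (intro exI[of _ m] exI[of _ b] exI[of _ "z $ 1"] exI[of _ "w $ 1"]) (auto simp: crossings_def)
  qed
qed

text \<open>The contribution of one line to the integral over ordered pairs of end points, in which
  both sides of the theorem are expressed.\<close>

definition line_density :: "real \<Rightarrow> real \<Rightarrow> ennreal" where
  "line_density m b = (\<integral>\<^sup>+s. \<integral>\<^sup>+t. ennreal \<bar>t - s\<bar> *
     (defect (pt m b s, pt m b t) * ennreal (4 / norm (pt m b t - pt m b s) ^ 4)) \<partial>lborel \<partial>lborel)"

lemma measurable_line_density: "(\<lambda>(m, b). line_density m b) \<in> borel_measurable borel"
proof -
  have [measurable]: "defect \<in> borel_measurable (borel \<Otimes>\<^sub>M borel)"
    using measurable_defect by (simp add: borel_prod)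
  show ?thesis unfolding line_density_def borel_prod[symmetric] by measurable
qed

text \<open>The Jacobian |t - s| reduces the fourth power of the distance to |t - s|^3 and leaves (1
  + m^2)^2; the density 4 times the 2 of \<open>nn_integral_excess\<close> gives 8.\<close>

lemma line_density_transversal:
  assumes tr: "transversal m b"
  shows "line_density m b = ennreal (8 * gap_sum (crossings m b) / (1 + m\<^sup>2)\<^sup>2)"
proof -
  let ?X = "crossings m b"
  have fin: "finite ?X" by (rule finite_crossings[OF tr])
  have AEX: "AE s in lborel. s \<notin> ?X" using fin by (rule AE_lborel_notin_finite)
  have p: "1 + m\<^sup>2 > 0" by (simp add: add_pos_nonneg)
  have pw: "ennreal \<bar>t - s\<bar> * (defect (pt m b s, pt m b t) * ennreal (4 / norm (pt m b t - pt m b s) ^ 4))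
     = ennreal (4 / (1 + m\<^sup>2)\<^sup>2) * ennreal (excess ?X (min s t) (max s t) / \<bar>t - s\<bar> ^ 3)"
    if "s \<notin> ?X" "t \<notin> ?X" for s t
  proof (cases "s = t")
    case False
    have ex: "0 \<le> excess ?X (min s t) (max s t)" by (simp add: excess_def)
    have sq: "sqrt (1 + m\<^sup>2) ^ 4 = (1 + m\<^sup>2)\<^sup>2"
    proof -
      have "q ^ 4 = (q ^ 2) ^ 2" for q :: real by (simp add: power4_eq_xxxx power2_eq_square)
      then show ?thesis using p by (simp only:) simp
    qed
    have "\<bar>t - s\<bar> * (excess ?X (min s t) (max s t) * (4 / norm (pt m b t - pt m b s) ^ 4))
      = 4 / (1 + m\<^sup>2)\<^sup>2 * (excess ?X (min s t) (max s t) / \<bar>t - s\<bar> ^ 3)"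
      using False p unfolding norm_pt_diff power_mult_distrib sq
      by (simp add: divide_simps) (simp add: power_numeral_reduce)
    then show ?thesis
      unfolding defect_transversal(3)[OF tr False that]
      using ex by (simp add: ennreal_mult[symmetric])
  qed simp
  have "line_density m b = (\<integral>\<^sup>+s. \<integral>\<^sup>+t. ennreal (4 / (1 + m\<^sup>2)\<^sup>2) * ennreal (excess ?X (min s t) (max s t) / \<bar>t - s\<bar> ^ 3) \<partial>lborel \<partial>lborel)"
    unfolding line_density_def
  proof (rule nn_integral_cong_AE)
    show "AE s in lborel. (\<integral>\<^sup>+t. ennreal \<bar>t - s\<bar> * (defect (pt m b s, pt m b t) * ennreal (4 / norm (pt m b t - pt m b s) ^ 4)) \<partial>lborel)
      = (\<integral>\<^sup>+t. ennreal (4 / (1 + m\<^sup>2)\<^sup>2) * ennreal (excess ?X (min s t) (max s t) / \<bar>t - s\<bar> ^ 3) \<partial>lborel)"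
      using AEX
    proof eventually_elim
      case (elim s)
      show ?case by (rule nn_integral_cong_AE) (use AEX in \<open>eventually_elim, use pw elim in blast\<close>)
    qed
  qed
  also have "\<dots> = ennreal (4 / (1 + m\<^sup>2)\<^sup>2) * (\<integral>\<^sup>+s. \<integral>\<^sup>+t. ennreal (excess ?X (min s t) (max s t) / \<bar>t - s\<bar> ^ 3) \<partial>lborel \<partial>lborel)"
  proof -
    have e: "(\<lambda>(s, t). excess ?X s t) \<in> borel_measurable (borel \<Otimes>\<^sub>M borel)"
      using measurable_excess[OF fin] by (simp cong: measurable_cong_sets)
    have [measurable]: "(\<lambda>(s, t). excess ?X (min s t) (max s t)) \<in> borel_measurable (borel \<Otimes>\<^sub>M borel)"
      using measurable_compose[OF _ e, of "\<lambda>(s, t). (min s t, max s t)" "borel \<Otimes>\<^sub>M borel"]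
      by (simp add: case_prod_unfold)
    show ?thesis by (subst nn_integral_cmult[symmetric], measurable) (intro nn_integral_cong nn_integral_cmult, measurable)
  qed
  also have "\<dots> = ennreal (4 / (1 + m\<^sup>2)\<^sup>2) * ennreal (2 * gap_sum ?X)"
    using nn_integral_excess[OF fin] by simp
  also have "\<dots> = ennreal (8 * gap_sum ?X / (1 + m\<^sup>2)\<^sup>2)"
    using nn_integral_excess_half(1)[OF fin] by (subst ennreal_mult[symmetric]) auto
  finally show ?thesis .
qed

end

section \<open>The two integrals as integrals of \<open>line_density\<close>\<close>

context separating_C2_curve
begin

abbreviation "cylinder \<equiv> C \<times> {0<..} :: ((real^2) \<times> real) set"

lemma AE_geodesics:
  "AE p in lborel. p \<in> {(z, w). z \<noteq> w} \<longrightarrow>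
     finite ((\<lambda>(z, w). geodesic_joining z w) p \<inter> cylinder) \<and>
     0 \<le> real (card ((\<lambda>(z, w). geodesic_joining z w) p \<inter> cylinder)) - lambda2 ((\<lambda>(z, w). geodesic_joining z w) p) C \<and>
     ennreal (real (card ((\<lambda>(z, w). geodesic_joining z w) p \<inter> cylinder)) - lambda2 ((\<lambda>(z, w). geodesic_joining z w) p) C) = defect p"
  using AE_pairs_on_transversal_lines
proof eventually_elim
  case (elim p)
  then obtain m b s t where p: "p = (pt m b s, pt m b t)" and tr: "transversal m b" "s \<noteq> t"
    "s \<notin> crossings m b" "t \<notin> crossings m b" by blast
  let ?z = "pt m b s" and ?w = "pt m b t"
  have ne: "?z \<noteq> ?w" using tr by simp
  have bij: "bij_betw fst (geodesic_joining ?z ?w \<inter> cylinder) (open_segment ?z ?w \<inter> C)"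
    by (rule bij_betw_geodesic_joining_segment[OF ne])
  have "real (card (geodesic_joining ?z ?w \<inter> cylinder)) - lambda2 (geodesic_joining ?z ?w) C
     = excess (crossings m b) (min s t) (max s t)"
    unfolding bij_betw_same_card[OF bij] lambda2_opposite[OF ideal_endpoints_geodesic_joining[OF ne]]
    by (rule defect_transversal(2)[OF tr])
  moreover have "finite (geodesic_joining ?z ?w \<inter> cylinder)"
    using bij_betw_finite[OF bij] defect_transversal(1)[OF tr] by simp
  ultimately show ?case
    unfolding p using defect_transversal(3)[OF tr] by (simp add: excess_def)
qed

lemma geodesic_integral:
  defines "\<psi> \<equiv> \<lambda>l. real (card (l \<inter> cylinder)) - lambda2 l C"
  shows "AE l in geodesic_measure. finite (l \<inter> cylinder)"
    and "\<psi> \<in> borel_measurable geodesic_measure" "AE l in geodesic_measure. 0 \<le> \<psi> l"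
    and "(\<integral>\<^sup>+l. ennreal (\<psi> l) \<partial>geodesic_measure) = (1 / 2) * (\<integral>\<^sup>+m. \<integral>\<^sup>+b. line_density m b \<partial>lborel \<partial>lborel)"
proof -
  define S where "S = {(z, w). z \<noteq> (w :: real^2)}"
  define f where "f = (\<lambda>(z, w). geodesic_joining z w)"
  define v where "v = (\<lambda>(z, w). ennreal (4 / norm (w - z :: real^2) ^ 4))"
  have S [measurable]: "S \<in> sets borel"
    unfolding S_def case_prod_unfold by (intro borel_open open_Collect_neq continuous_intros)
  have f: "f \<in> S \<rightarrow> geodesics" by (auto simp: S_def f_def geodesic_joining_in_geodesics)
  have v [measurable]: "v \<in> borel_measurable borel"
    unfolding v_def case_prod_unfold
    by (intro measurable_compose[OF _ measurable_ennreal] borel_measurable_divide borel_measurable_power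
        borel_measurable_const borel_measurable_continuous_onI continuous_intros)
  have \<mu>: "geodesic_measure = scale_measure (1 / 2) (image_measure (density (lebesgue_on S) v) geodesics f)"
    by (simp add: geodesic_measure_def S_def v_def f_def)
  have AE: "AE p in lborel. p \<in> S \<longrightarrow> finite (f p \<inter> cylinder) \<and> 0 \<le> \<psi> (f p) \<and> ennreal (\<psi> (f p)) = defect p"
    using AE_geodesics unfolding S_def f_def \<psi>_def .
  show "AE l in geodesic_measure. finite (l \<inter> cylinder)"
    by (rule AE_scaled_image_measure[OF S f v \<mu>]) (use AE in \<open>eventually_elim, auto\<close>)
  have good: "AE p in lborel. p \<in> S \<longrightarrow> 0 \<le> \<psi> (f p) \<and> ennreal (\<psi> (f p)) = defect p"
    using AE by eventually_elim auto
  note [measurable] = measurable_defect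
  note nn = nn_integral_scaled_image_measure[OF S f v \<mu> measurable_defect good]
  show "\<psi> \<in> borel_measurable geodesic_measure" "AE l in geodesic_measure. 0 \<le> \<psi> l"
    by (rule nn)+
  have "(\<integral>\<^sup>+p. defect p * v p * indicator S p \<partial>lborel) =
     (\<integral>\<^sup>+m. \<integral>\<^sup>+b. \<integral>\<^sup>+s. \<integral>\<^sup>+t. ennreal \<bar>t - s\<bar> * (defect (pt m b s, pt m b t) * v (pt m b s, pt m b t) * indicator S (pt m b s, pt m b t)) \<partial>lborel \<partial>lborel \<partial>lborel \<partial>lborel)"
    by (rule nn_integral_pairs_of_points) measurable
  also have "\<dots> = (\<integral>\<^sup>+m. \<integral>\<^sup>+b. line_density m b \<partial>lborel \<partial>lborel)"
    unfolding line_density_def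
    by (intro nn_integral_cong) (auto simp: S_def v_def indicator_def)
  finally show "(\<integral>\<^sup>+l. ennreal (\<psi> l) \<partial>geodesic_measure) = (1 / 2) * (\<integral>\<^sup>+m. \<integral>\<^sup>+b. line_density m b \<partial>lborel \<partial>lborel)"
    using nn(3) by simp
qed

lemma line_integral:
  defines "\<psi> \<equiv> \<lambda>L. \<Sum>(x, y) \<in> {(x, y). x \<in> L \<inter> C \<and> y \<in> L \<inter> C \<and> x \<noteq> y}.
             (-1) ^ card (closed_segment x y \<inter> C) / norm (y - x)"
  shows "AE L in line_measure. finite (L \<inter> C)"
    and "\<psi> \<in> borel_measurable line_measure" "AE L in line_measure. 0 \<le> \<psi> L"
    and "(\<integral>\<^sup>+L. ennreal (\<psi> L) \<partial>line_measure) = (1 / 2) * (\<integral>\<^sup>+m. \<integral>\<^sup>+b. line_density m b \<partial>lborel \<partial>lborel)"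
    and "(\<integral>\<^sup>+L. ennreal (\<psi> L) \<partial>line_measure) < \<infinity>"
proof -
  define S where "S = {0::real..} \<times> {0..<2*pi}"
  define f where "f = (\<lambda>(p, \<phi>). {x :: real^2. x$1 * cos \<phi> + x$2 * sin \<phi> = p})"
  have S [measurable]: "S \<in> sets borel"
    unfolding S_def borel_prod[symmetric] by (intro pair_measureI) auto
  have f: "f \<in> S \<rightarrow> lines" by (auto simp: f_def line_in_lines)
  have \<mu>: "line_measure = scale_measure 2 (image_measure (density (lebesgue_on S) (\<lambda>_. 1)) lines f)"
    by (simp add: line_measure_def S_def f_def density_1)
  \<comment> \<open>With q = sqrt (1 + m^2), the integrand 2 \<open>gap_sum\<close> / q is
    \<open>line_density\<close> = 8 \<open>gap_sum\<close> / q^4 multiplied by q^3 / 4; the q^3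
    cancels the density of the measure on lines in slope-intercept coordinates.\<close>
  define G where "G x = (case x of (m, b) \<Rightarrow> line_density m b) * ennreal (sqrt (1 + (fst x)\<^sup>2) ^ 3 / 4)" for x :: "real \<times> real"
  have [measurable]: "fst \<in> borel_measurable (borel :: (real \<times> real) measure)" "snd \<in> borel_measurable (borel :: (real \<times> real) measure)"
    by (intro borel_measurable_continuous_onI continuous_intros)+
  have G [measurable]: "G \<in> borel_measurable borel"
    unfolding G_def using measurable_line_density by measurable
  define c where "c x = (- cos (snd x) / sin (snd x), fst x / sin (snd x))" for x :: "real \<times> real"
  have [measurable]: "c \<in> borel_measurable borel"
    unfolding c_def by (intro borel_measurable_Pair) measurable
  define D where "D x = G (c x)" for x
  have D [measurable]: "D \<in> borel_measurable borel" unfolding D_def by measurable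
  have lines_formula: "(\<integral>\<^sup>+x. H (c x) * indicator S x \<partial>lborel) = (\<integral>\<^sup>+m. \<integral>\<^sup>+b. H (m, b) * ennreal (1 / sqrt (1 + m\<^sup>2) ^ 3) \<partial>lborel \<partial>lborel)"
    if H [measurable]: "H \<in> borel_measurable borel" for H
  proof -
    have "(\<lambda>x. H (c x) * indicator S x) \<in> borel_measurable borel" by measurable
    then have m: "(\<lambda>x. H (c x) * indicator S x) \<in> borel_measurable (lborel \<Otimes>\<^sub>M lborel)" by (simp add: lborel_prod)
    have "(\<integral>\<^sup>+x. H (c x) * indicator S x \<partial>lborel) = (\<integral>\<^sup>+\<phi>. \<integral>\<^sup>+p. H (c (p, \<phi>)) * indicator S (p, \<phi>) \<partial>lborel \<partial>lborel)"
      using lborel_pair.nn_integral_snd[OF m] by (simp add: lborel_prod)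
    also have "\<dots> = (\<integral>\<^sup>+\<phi>. \<integral>\<^sup>+p. H (- cos \<phi> / sin \<phi>, p / sin \<phi>) * indicator {0..} p * indicator {0..<2*pi} \<phi> \<partial>lborel \<partial>lborel)"
      by (intro nn_integral_cong) (auto simp: c_def S_def indicator_def)
    also have "\<dots> = (\<integral>\<^sup>+m. \<integral>\<^sup>+b. H (m, b) * ennreal (1 / sqrt (1 + m\<^sup>2) ^ 3) \<partial>lborel \<partial>lborel)"
      by (rule nn_integral_lines) measurable
    finally show ?thesis .
  qed
  have tr: "AE x in lborel. x \<in> S \<longrightarrow> transversal (fst (c x)) (snd (c x)) \<and> sin (snd x) \<noteq> 0"
  proof -
    obtain N where N: "N \<in> null_sets lborel" "\<And>m b. (m, b) \<notin> N \<Longrightarrow> transversal m b"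
      by (rule nontransversal_null) (rule that, assumption, blast)
    have [measurable]: "N \<in> sets borel" using N by auto
    have "AE x in lborel \<Otimes>\<^sub>M lborel. x \<notin> N" using AE_not_in[OF N(1)] unfolding lborel_prod .
    then have AEN: "AE m in lborel. AE b in lborel. (m, b) \<notin> N" by (rule lborel_pair.AE_pair)
    \<comment> \<open>The null set of tangent lines is pulled back to the coordinates (p, \<phi>) by
      applying the change of variables to its indicator.\<close>
    have "(\<integral>\<^sup>+x. indicator N (c x) * indicator S x \<partial>lborel) =
       (\<integral>\<^sup>+m. \<integral>\<^sup>+b. indicator N (m, b) * ennreal (1 / sqrt (1 + m\<^sup>2) ^ 3) \<partial>lborel \<partial>lborel)"
      by (rule lines_formula) measurable
    also have "\<dots> = (\<integral>\<^sup>+m. 0 \<partial>(lborel :: real measure))"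
    proof (rule nn_integral_cong_AE)
      show "AE m in lborel. (\<integral>\<^sup>+b. indicator N (m, b) * ennreal (1 / sqrt (1 + m\<^sup>2) ^ 3) \<partial>lborel) = 0"
        using AEN
      proof eventually_elim
        case (elim m)
        have "(\<integral>\<^sup>+b. indicator N (m, b) * ennreal (1 / sqrt (1 + m\<^sup>2) ^ 3) \<partial>lborel) = (\<integral>\<^sup>+b. 0 \<partial>(lborel :: real measure))"
          by (rule nn_integral_cong_AE) (use elim in \<open>eventually_elim, simp\<close>)
        then show ?case by simp
      qed
    qed
    finally have "(\<integral>\<^sup>+x. indicator N (c x) * indicator S x \<partial>lborel) = 0" by simp
    then have "AE x in lborel. indicator N (c x) * indicator S x = (0 :: ennreal)"
      by (subst (asm) nn_integral_0_iff_AE) measurable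
    moreover have "AE x in (lborel :: (real \<times> real) measure). snd x \<notin> {0, pi}"
    proof -
      have "AE x in (lborel :: real measure) \<Otimes>\<^sub>M lborel. (snd x :: real) \<notin> {0, pi}"
      proof (rule lborel_pair.AE_pair_measure)
        show "{x \<in> space ((lborel :: real measure) \<Otimes>\<^sub>M lborel). (snd x :: real) \<notin> {0, pi}} \<in> sets (lborel \<Otimes>\<^sub>M lborel)" by measurable
        show "AE x in lborel. AE y in lborel. (snd (x :: real, y :: real)) \<notin> {0, pi}"
          unfolding snd_conv by (rule AE_I2, rule AE_lborel_notin_finite) simp
      qed
      then show ?thesis unfolding lborel_prod .
    qed
    ultimately show ?thesis
    proof eventually_elim
      case (elim x)
      show ?case
      proof
        assume x: "x \<in> S"
        then have "c x \<notin> N" using elim(1) by (auto simp: indicator_def split: if_splits)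
        then have "transversal (fst (c x)) (snd (c x))" using N(2) by simp
        moreover have "sin (snd x) \<noteq> 0"
        proof (cases "snd x < pi")
          case True
          then have "sin (snd x) > 0" using x elim(2) by (intro sin_gt_zero) (auto simp: S_def)
          then show ?thesis by simp
        next
          case False
          then have "sin (snd x) < 0" using x elim(2) by (intro sin_lt_zero) (auto simp: S_def)
          then show ?thesis by simp
        qed
        ultimately show "transversal (fst (c x)) (snd (c x)) \<and> sin (snd x) \<noteq> 0" ..
      qed
    qed
  qed
  have line_value: "finite (f x \<inter> C) \<and> 0 \<le> \<psi> (f x) \<and> ennreal (\<psi> (f x)) = D x"
    if "transversal (fst (c x)) (snd (c x))" "sin (snd x) \<noteq> 0" for x
  proof -
    define m b where "m = fst (c x)" and "b = snd (c x)"
    have tr: "transversal m b" using that by (simp add: m_def b_def)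
    have fin: "finite (crossings m b)" by (rule finite_crossings[OF tr])
    have L: "f x = range (pt m b)"
      using line_eq_range_pt[OF that(2), of "fst x"] by (simp add: f_def case_prod_unfold m_def b_def c_def)
    have "f x \<inter> C = pt m b ` crossings m b" by (auto simp: L crossings_def)
    then have 1: "finite (f x \<inter> C)" using fin by simp
    have e: "\<psi> (f x) = 2 * gap_sum (crossings m b) / sqrt (1 + m\<^sup>2)"
      unfolding \<psi>_def by (rule line_sum_eq_gap_sum[OF L fin])
    have gs: "0 \<le> gap_sum (crossings m b)" by (rule nn_integral_excess_half(1)[OF fin])
    have p: "1 + m\<^sup>2 > 0" by (simp add: add_pos_nonneg)
    define q where "q = sqrt (1 + m\<^sup>2)"
    have q: "q > 0" "q\<^sup>2 = 1 + m\<^sup>2" using p by (auto simp: q_def)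
    have cx: "c x = (m, b)" by (simp add: m_def b_def)
    have "D x = ennreal (8 * gap_sum (crossings m b) / (q\<^sup>2)\<^sup>2) * ennreal (q ^ 3 / 4)"
      unfolding D_def G_def cx q(2) q_def by (simp add: line_density_transversal[OF tr])
    also have "\<dots> = ennreal (8 * gap_sum (crossings m b) / (q\<^sup>2)\<^sup>2 * (q ^ 3 / 4))"
      using gs q(1) by (intro ennreal_mult[symmetric]) auto
    also have "8 * gap_sum (crossings m b) / (q\<^sup>2)\<^sup>2 * (q ^ 3 / 4) = 2 * gap_sum (crossings m b) / q"
      using q(1) by (simp add: field_simps power2_eq_square power3_eq_cube)
    finally have "ennreal (\<psi> (f x)) = D x" unfolding e q_def by simp
    moreover have "0 \<le> \<psi> (f x)" unfolding e using gs by simp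
    ultimately show ?thesis using 1 by blast
  qed
  have good: "AE x in lborel. x \<in> S \<longrightarrow> 0 \<le> \<psi> (f x) \<and> ennreal (\<psi> (f x)) = D x"
    using tr by eventually_elim (use line_value in blast)
  have one: "(\<lambda>_. 1) \<in> borel_measurable borel" by simp
  show "AE L in line_measure. finite (L \<inter> C)"
    by (rule AE_scaled_image_measure[OF S f one \<mu>]) (use tr in \<open>eventually_elim, use line_value in blast\<close>)
  note nn = nn_integral_scaled_image_measure[OF S f one \<mu> D good]
  show "\<psi> \<in> borel_measurable line_measure" "AE L in line_measure. 0 \<le> \<psi> L"
    by (rule nn)+
  have nn': "(\<integral>\<^sup>+L. ennreal (\<psi> L) \<partial>line_measure) = 2 * (\<integral>\<^sup>+x. D x * indicator S x \<partial>lborel)"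
    using nn(3) by simp
  have "(\<integral>\<^sup>+x. D x * indicator S x \<partial>lborel) = (\<integral>\<^sup>+m. \<integral>\<^sup>+b. G (m, b) * ennreal (1 / sqrt (1 + m\<^sup>2) ^ 3) \<partial>lborel \<partial>lborel)"
    unfolding D_def by (rule lines_formula[OF G])
  also have "\<dots> = (\<integral>\<^sup>+m. \<integral>\<^sup>+b. ennreal (1 / 4) * line_density m b \<partial>lborel \<partial>lborel)"
  proof (intro nn_integral_cong)
    fix m b :: real
    have "sqrt (1 + m\<^sup>2) > 0" by (simp add: add_pos_nonneg)
    then have "ennreal (sqrt (1 + m\<^sup>2) ^ 3 / 4) * ennreal (1 / sqrt (1 + m\<^sup>2) ^ 3) = ennreal (1 / 4)"
      by (subst ennreal_mult[symmetric]) auto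
    then show "G (m, b) * ennreal (1 / sqrt (1 + m\<^sup>2) ^ 3) = ennreal (1 / 4) * line_density m b"
      by (simp add: G_def mult_ac)
  qed
  also have "\<dots> = ennreal (1 / 4) * (\<integral>\<^sup>+m. \<integral>\<^sup>+b. line_density m b \<partial>lborel \<partial>lborel)"
  proof -
    have [measurable]: "(\<lambda>(m, b). line_density m b) \<in> borel_measurable (borel \<Otimes>\<^sub>M borel)"
      using measurable_line_density by (simp add: borel_prod)
    show ?thesis
      by (subst nn_integral_cmult[symmetric], measurable) (rule nn_integral_cong, rule nn_integral_cmult, measurable)
  qed
  finally have "(\<integral>\<^sup>+L. ennreal (\<psi> L) \<partial>line_measure) = (ennreal 2 * ennreal (1 / 4)) * (\<integral>\<^sup>+m. \<integral>\<^sup>+b. line_density m b \<partial>lborel \<partial>lborel)"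
    unfolding nn' by (simp add: mult.assoc)
  also have "ennreal 2 * ennreal (1 / 4) = ennreal (1 / 2)"
    by (subst ennreal_mult[symmetric]) auto
  also have "\<dots> = 1 / 2"
    using divide_ennreal[of 1 2] by simp
  finally show "(\<integral>\<^sup>+L. ennreal (\<psi> L) \<partial>line_measure) = (1 / 2) * (\<integral>\<^sup>+m. \<integral>\<^sup>+b. line_density m b \<partial>lborel \<partial>lborel)" .
  obtain E :: "real \<times> real \<Rightarrow> ennreal" where E [measurable]: "E \<in> borel_measurable borel" and Efin: "(\<integral>\<^sup>+x. E x \<partial>lborel) < \<infinity>"
    and Ege: "\<And>\<phi> p Z. \<phi> \<in> {0..2*pi} \<Longrightarrow> finite Z \<Longrightarrow> Z \<subseteq> C \<Longrightarrow> (\<And>x. x \<in> Z \<Longrightarrow> x \<bullet> normal \<phi> = p) \<Longrightarrow>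
       ennreal (\<Sum>(x, y)\<in>{(x, y). x \<in> Z \<and> y \<in> Z \<and> x \<noteq> y}. 1 / norm (y - x)) \<le> E (\<phi>, p)"
    by (rule integrable_line_energy) (rule that, assumption, assumption, blast)
  \<comment> \<open>Each sign is bounded by 1, which leaves the sum controlled by \<open>E\<close>;
    the coordinates are swapped because \<open>E\<close> takes the angle first.\<close>
  have "(\<integral>\<^sup>+x. D x * indicator S x \<partial>lborel) \<le> (\<integral>\<^sup>+x. E (snd x, fst x) \<partial>lborel)"
  proof (rule nn_integral_mono_AE)
    show "AE x in lborel. D x * indicator S x \<le> E (snd x, fst x)"
      using tr
    proof eventually_elim
      case (elim x)
      show ?case
      proof (cases "x \<in> S")
        case True
        then have v: "finite (f x \<inter> C)" "ennreal (\<psi> (f x)) = D x" using elim line_value by auto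
        let ?P = "{(a, b). a \<in> f x \<inter> C \<and> b \<in> f x \<inter> C \<and> a \<noteq> b}"
        have "\<psi> (f x) \<le> (\<Sum>(a, b)\<in>?P. 1 / norm (b - a))"
          unfolding \<psi>_def by (intro sum_mono) (auto intro!: divide_right_mono simp: minus_one_power_iff)
        then have "D x \<le> ennreal (\<Sum>(a, b)\<in>?P. 1 / norm (b - a))"
          unfolding v(2)[symmetric] by (rule ennreal_leI)
        also have "\<dots> \<le> E (snd x, fst x)"
          using True v(1) by (intro Ege) (auto simp: S_def f_def inner_normal)
        finally show ?thesis using True by simp
      qed simp
    qed
  qed
  also have "\<dots> = (\<integral>\<^sup>+x. E x \<partial>lborel)"
  proof -
    have [measurable]: "E \<in> borel_measurable (lborel \<Otimes>\<^sub>M lborel)" using E by (simp add: lborel_prod)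
    have "(\<integral>\<^sup>+x. E (snd x, fst x) \<partial>(lborel \<Otimes>\<^sub>M lborel)) = (\<integral>\<^sup>+x. E x \<partial>(lborel \<Otimes>\<^sub>M lborel))"
      by (subst lborel_pair.distr_pair_swap, subst nn_integral_distr) (auto simp: case_prod_unfold)
    then show ?thesis by (simp add: lborel_prod)
  qed
  also note Efin
  finally show "(\<integral>\<^sup>+L. ennreal (\<psi> L) \<partial>line_measure) < \<infinity>"
    unfolding nn' by (simp add: ennreal_mult_less_top)
qed

end

theorem proposition10:
  fixes C :: "(real^2) set" and R :: "((real^2) \<times> real) set"
  assumes "C2_simple_closed_curve C" and "R = C \<times> {0<..}"
  shows "(AE l in geodesic_measure. finite (l \<inter> R)) \<and>
    integrable geodesic_measure (\<lambda>l. real (card (l \<inter> R)) - lambda2 l C) \<and>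
    (AE L in line_measure. finite (L \<inter> C)) \<and>
    integrable line_measure
      (\<lambda>L. \<Sum>(x, y) \<in> {(x, y). x \<in> L \<inter> C \<and> y \<in> L \<inter> C \<and> x \<noteq> y}.
             (-1) ^ card (closed_segment x y \<inter> C) / norm (y - x)) \<and>
    (\<integral>l. real (card (l \<inter> R)) - lambda2 l C \<partial>geodesic_measure) =
    (\<integral>L. (\<Sum>(x, y) \<in> {(x, y). x \<in> L \<inter> C \<and> y \<in> L \<inter> C \<and> x \<noteq> y}.
             (-1) ^ card (closed_segment x y \<inter> C) / norm (y - x)) \<partial>line_measure)"
proof -
  obtain g g' g'' where curve: "C2_curve g g' g'' C"
    using assms(1) unfolding C2_simple_closed_curve_def C2_curve_def by blast
  then interpret C2_curve g g' g'' C .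
  have "pathfinish g = pathstart g"
    using periodic[of 0] by (simp add: pathfinish_def pathstart_def)
  then obtain I V where "plane_separation C I V"
    using Jordan_plane_separation[OF simple] image by metis
  then interpret plane_separation C I V .
  interpret separating_C2_curve g g' g'' C I V by unfold_locales
  note geo = geodesic_integral[folded assms(2)] and lin = line_integral
  have "integrable geodesic_measure (\<lambda>l. real (card (l \<inter> R)) - lambda2 l C)"
    \<comment> \<open>The geodesic integral equals the same multiple of the integral of
      \<open>line_density\<close>, so it inherits finiteness from the line integral.\<close>
    using geo lin(4,5) by (intro integrableI_nonneg) auto
  moreover have "integrable line_measure
      (\<lambda>L. \<Sum>(x, y) \<in> {(x, y). x \<in> L \<inter> C \<and> y \<in> L \<inter> C \<and> x \<noteq> y}.
             (-1) ^ card (closed_segment x y \<inter> C) / norm (y - x))"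
    using lin by (intro integrableI_nonneg) auto
  moreover have "(\<integral>l. real (card (l \<inter> R)) - lambda2 l C \<partial>geodesic_measure) =
    (\<integral>L. (\<Sum>(x, y) \<in> {(x, y). x \<in> L \<inter> C \<and> y \<in> L \<inter> C \<and> x \<noteq> y}.
             (-1) ^ card (closed_segment x y \<inter> C) / norm (y - x)) \<partial>line_measure)"
    unfolding integral_eq_nn_integral[OF geo(2,3)] integral_eq_nn_integral[OF lin(2,3)] geo(4) lin(4) ..
  ultimately show ?thesis using geo(1) lin(1) by blast
qed

end
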